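(* Let $n,k$ be positive integers. There exist a strongly explicit matrix $\Phi\in\mathbb{R}^{m\times n}$ with \[ m=\mathcal{O}\Big(k^2\Big(\frac{\log n}{\log\log n+\log k}\Big)^2\Big) \] and an algorithm which, given $v=\Phi x$ for $x\in\mathbb{R}^n$ and a subset $S\subseteq[n]$ with $H(x,k,1)\subseteq S$, returns an $\mathcal{O}(k)$-sparse vector $\hat x\in\mathbb{R}^n$ such that \[ \|x-\hat x\|_\infty\le\frac1k\|x_{-k}\|_1, \] in time $\mathcal{O}(|S|\,k\log^2 n/(\log\log n+\log k))$.
   Context: For $x\in\mathbb{R}^n$, $x_{-k}$ is the vector obtained by zeroing out the $k$ largest coordinates of $x$ in absolute value, and $H(x,k,\epsilon)=\{i\in[n]:|x_i|\ge\frac{\epsilon}{k}\|x_{-k}\|_1\}$, so $H(x,k,1)=\{i:|x_i|\ge\frac1k\|x_{-k}\|_1\}$. A matrix is strongly explicit if each entry can be computed in time $\mathrm{poly}(k,\log n)$. The word size is $\Theta(\log n)$ bits. *)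

theory Defs
  imports "Jordan_Normal_Form.Matrix" "HOL-Library.Log_Nat"
begin

section \<open>Vectors\<close>

text \<open>Coordinates are indexed by \<open>{0..<n}\<close> instead of \<open>{1..n}\<close>.\<close>

definition l1_norm :: "real vec \<Rightarrow> real" where
  "l1_norm x = (\<Sum>i<dim_vec x. \<bar>x $ i\<bar>)"

text \<open>Only meant for vectors of positive dimension.\<close>

definition linf_norm :: "real vec \<Rightarrow> real" where
  "linf_norm x = Max ((\<lambda>i. \<bar>x $ i\<bar>) ` {..<dim_vec x})"

definition sparse :: "nat \<Rightarrow> real vec \<Rightarrow> bool" where
  "sparse s x \<longleftrightarrow> card {i. i < dim_vec x \<and> x $ i \<noteq> 0} \<le> s"

text \<open>Number of coordinates that precede \<open>i\<close> when the coordinates are listed by decreasing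
  absolute value; ties are broken in favour of the smaller index (the norm of the tail
  does not depend on this choice).\<close>

definition mag_rank :: "real vec \<Rightarrow> nat \<Rightarrow> nat" where
  "mag_rank x i = card {j. j < dim_vec x \<and> (\<bar>x $ j\<bar> > \<bar>x $ i\<bar> \<or> (\<bar>x $ j\<bar> = \<bar>x $ i\<bar> \<and> j < i))}"

text \<open>The vector \<open>x\<close> with its \<open>k\<close> largest coordinates (in absolute value) zeroed out.\<close>

definition tail_vec :: "real vec \<Rightarrow> nat \<Rightarrow> real vec" where
  "tail_vec x k = vec (dim_vec x) (\<lambda>i. if mag_rank x i < k then 0 else x $ i)"

definition heavy :: "real vec \<Rightarrow> nat \<Rightarrow> real \<Rightarrow> nat set" where
  "heavy x k \<epsilon> = {i. i < dim_vec x \<and> \<bar>x $ i\<bar> \<ge> \<epsilon> / real k * l1_norm (tail_vec x k)}"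


section \<open>A word RAM with real-valued cells\<close>

text \<open>The machine has \<open>w\<close>-bit words and, for the coordinates of the real vectors, cells holding
  exact real numbers.  A program is a fixed finite text, so it mentions only finitely many
  registers and memory banks.  Memory banks are addressed by words.  Arithmetic on words is
  modulo \<open>2 ^ w\<close>.  Real cells admit field operations and comparisons only; the only real constants
  are the embeddings of words, and there is no conversion (such as rounding) from reals to words.\<close>

record state =
  wreg :: "nat \<Rightarrow> nat"
  wmem :: "nat \<Rightarrow> nat \<Rightarrow> nat"
  rreg :: "nat \<Rightarrow> real"
  rmem :: "nat \<Rightarrow> nat \<Rightarrow> real"

datatype wexp =
    WConst nat
  | WReg nat
  | WLoad nat wexp
  | WAdd wexp wexp
  | WSub wexp wexp
  | WMul wexp wexp
  | WDiv wexp wexp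
  | WMod wexp wexp

datatype rexp =
    ROfWord wexp
  | RReg nat
  | RLoad nat wexp
  | RAdd rexp rexp
  | RSub rexp rexp
  | RMul rexp rexp
  | RDiv rexp rexp

datatype bexp =
    WLess wexp wexp
  | RLess rexp rexp
  | BNot bexp
  | BAnd bexp bexp

datatype com =
    Skip
  | WAssign nat wexp
  | WStore nat wexp wexp
  | RAssign nat rexp
  | RStore nat wexp rexp
  | Seq com com
  | Cond bexp com com
  | While bexp com

text \<open>In \<open>WSub\<close> the summand \<open>2 ^ w\<close> prevents truncation; operands are always below \<open>2 ^ w\<close>.\<close>

fun wval :: "nat \<Rightarrow> wexp \<Rightarrow> state \<Rightarrow> nat" where
  "wval w (WConst a) s = a mod 2 ^ w"
| "wval w (WReg r) s = wreg s r"
| "wval w (WLoad b e) s = wmem s b (wval w e s)"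
| "wval w (WAdd e f) s = (wval w e s + wval w f s) mod 2 ^ w"
| "wval w (WSub e f) s = (2 ^ w + wval w e s - wval w f s) mod 2 ^ w"
| "wval w (WMul e f) s = (wval w e s * wval w f s) mod 2 ^ w"
| "wval w (WDiv e f) s = wval w e s div wval w f s"
| "wval w (WMod e f) s = wval w e s mod wval w f s"

fun rval :: "nat \<Rightarrow> rexp \<Rightarrow> state \<Rightarrow> real" where
  "rval w (ROfWord e) s = real (wval w e s)"
| "rval w (RReg r) s = rreg s r"
| "rval w (RLoad b e) s = rmem s b (wval w e s)"
| "rval w (RAdd e f) s = rval w e s + rval w f s"
| "rval w (RSub e f) s = rval w e s - rval w f s"
| "rval w (RMul e f) s = rval w e s * rval w f s"
| "rval w (RDiv e f) s = rval w e s / rval w f s"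

fun bval :: "nat \<Rightarrow> bexp \<Rightarrow> state \<Rightarrow> bool" where
  "bval w (WLess e f) s \<longleftrightarrow> wval w e s < wval w f s"
| "bval w (RLess e f) s \<longleftrightarrow> rval w e s < rval w f s"
| "bval w (BNot b) s \<longleftrightarrow> \<not> bval w b s"
| "bval w (BAnd b c) s \<longleftrightarrow> bval w b s \<and> bval w c s"

text \<open>Every operation, constant and memory access in an expression costs one time unit.\<close>

fun wcost :: "wexp \<Rightarrow> nat" where
  "wcost (WConst a) = 1"
| "wcost (WReg r) = 1"
| "wcost (WLoad b e) = 1 + wcost e"
| "wcost (WAdd e f) = 1 + wcost e + wcost f"
| "wcost (WSub e f) = 1 + wcost e + wcost f"
| "wcost (WMul e f) = 1 + wcost e + wcost f"
| "wcost (WDiv e f) = 1 + wcost e + wcost f"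
| "wcost (WMod e f) = 1 + wcost e + wcost f"

fun rcost :: "rexp \<Rightarrow> nat" where
  "rcost (ROfWord e) = 1 + wcost e"
| "rcost (RReg r) = 1"
| "rcost (RLoad b e) = 1 + wcost e"
| "rcost (RAdd e f) = 1 + rcost e + rcost f"
| "rcost (RSub e f) = 1 + rcost e + rcost f"
| "rcost (RMul e f) = 1 + rcost e + rcost f"
| "rcost (RDiv e f) = 1 + rcost e + rcost f"

fun bcost :: "bexp \<Rightarrow> nat" where
  "bcost (WLess e f) = 1 + wcost e + wcost f"
| "bcost (RLess e f) = 1 + rcost e + rcost f"
| "bcost (BNot b) = 1 + bcost b"
| "bcost (BAnd b c) = 1 + bcost b + bcost c"

text \<open>\<open>exec w c s t s'\<close>: on \<open>w\<close>-bit words, \<open>c\<close> started in \<open>s\<close> halts after \<open>t\<close> steps in \<open>s'\<close>.\<close>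

inductive exec :: "nat \<Rightarrow> com \<Rightarrow> state \<Rightarrow> nat \<Rightarrow> state \<Rightarrow> bool" for w :: nat where
  exec_Skip: "exec w Skip s 1 s"
| exec_WAssign: "exec w (WAssign r e) s (1 + wcost e) (s\<lparr>wreg := (wreg s)(r := wval w e s)\<rparr>)"
| exec_WStore: "exec w (WStore b a e) s (1 + wcost a + wcost e)
    (s\<lparr>wmem := (wmem s)(b := (wmem s b)(wval w a s := wval w e s))\<rparr>)"
| exec_RAssign: "exec w (RAssign r e) s (1 + rcost e) (s\<lparr>rreg := (rreg s)(r := rval w e s)\<rparr>)"
| exec_RStore: "exec w (RStore b a e) s (1 + wcost a + rcost e)
    (s\<lparr>rmem := (rmem s)(b := (rmem s b)(wval w a s := rval w e s))\<rparr>)"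
| exec_Seq: "exec w c s t s' \<Longrightarrow> exec w d s' u s'' \<Longrightarrow> exec w (Seq c d) s (t + u) s''"
| exec_CondT: "bval w b s \<Longrightarrow> exec w c s t s' \<Longrightarrow> exec w (Cond b c d) s (1 + bcost b + t) s'"
| exec_CondF: "\<not> bval w b s \<Longrightarrow> exec w d s t s' \<Longrightarrow> exec w (Cond b c d) s (1 + bcost b + t) s'"
| exec_WhileF: "\<not> bval w b s \<Longrightarrow> exec w (While b c) s (1 + bcost b) s"
| exec_WhileT: "bval w b s \<Longrightarrow> exec w c s t s' \<Longrightarrow> exec w (While b c) s' u s'' \<Longrightarrow>
    exec w (While b c) s (1 + bcost b + t + u) s''"

inductive_cases exec_SkipE: "exec w Skip s t s'"
inductive_cases exec_WAssignE: "exec w (WAssign r e) s t s'"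
inductive_cases exec_WStoreE: "exec w (WStore b a e) s t s'"
inductive_cases exec_RAssignE: "exec w (RAssign r e) s t s'"
inductive_cases exec_RStoreE: "exec w (RStore b a e) s t s'"
inductive_cases exec_SeqE: "exec w (Seq c d) s t s'"
inductive_cases exec_CondE: "exec w (Cond b c d) s t s'"
inductive_cases exec_WhileE: "exec w (While b c) s t s'"

text \<open>The running time and the final state are determined by the input.\<close>

lemma exec_deterministic:
  "exec w c s t s' \<Longrightarrow> exec w c s u s'' \<Longrightarrow> u = t \<and> s'' = s'"
proof (induction arbitrary: u s'' rule: exec.induct)
  case (exec_Seq c s t s' d t2 s2)
  obtain t1' t2' m where "u = t1' + t2'" "exec w c s t1' m" "exec w d m t2' s''"
    using exec_Seq.prems by (rule exec_SeqE)
  then show ?case using exec_Seq.IH by fastforce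
next
  case (exec_CondT b s c t s' d)
  obtain v where "u = 1 + bcost b + v" "exec w c s v s''"
    by (rule exec_CondE[OF exec_CondT.prems]) (simp_all add: exec_CondT.hyps)
  then show ?case using exec_CondT.IH by simp
next
  case (exec_CondF b s d t s' c)
  obtain v where "u = 1 + bcost b + v" "exec w d s v s''"
    by (rule exec_CondE[OF exec_CondF.prems]) (simp_all add: exec_CondF.hyps)
  then show ?case using exec_CondF.IH by simp
next
  case (exec_WhileF b s c)
  show ?case
    by (rule exec_WhileE[OF exec_WhileF.prems]) (simp_all add: exec_WhileF.hyps)
next
  case (exec_WhileT b s c t s' t2 s2)
  show ?case
    by (rule exec_WhileE[OF exec_WhileT.prems])
      (use exec_WhileT.hyps(1) in simp, metis exec_WhileT.IH plus_1_eq_Suc add_Suc)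
qed (erule exec_SkipE exec_WAssignE exec_WStoreE exec_RAssignE exec_RStoreE, simp)+


section \<open>Strongly explicit matrices and recovery algorithms\<close>

text \<open>A constant multiple of the bit length of the parameters, that is \<open>\<Theta>(log n)\<close> whenever \<open>k \<le> n\<close>.
  For \<open>k > n\<close> a word still has to be able to hold \<open>k\<close>.\<close>

definition word_size :: "nat \<Rightarrow> nat \<Rightarrow> nat \<Rightarrow> nat" where
  "word_size c n k = c * floorlog 2 (max n k)"

definition blank :: state where
  "blank = \<lparr>wreg = (\<lambda>_. 0), wmem = (\<lambda>_ _. 0), rreg = (\<lambda>_. 0), rmem = (\<lambda>_ _. 0)\<rparr>"

definition entry_input :: "nat \<Rightarrow> nat \<Rightarrow> nat \<Rightarrow> nat \<Rightarrow> state" where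
  "entry_input n k i j = blank\<lparr>wreg := (\<lambda>_. 0)(0 := n, 1 := k, 2 := i, 3 := j)\<rparr>"

text \<open>A single program computes all entries of all matrices of the family, entry \<open>(i, j)\<close> of the
  matrix for \<open>(n, k)\<close> in time polynomial in \<open>k\<close> and \<open>log n\<close>.  The condition on the number of rows
  says that row indices fit into a word.\<close>

definition strongly_explicit :: "nat \<Rightarrow> (nat \<Rightarrow> nat \<Rightarrow> real mat) \<Rightarrow> bool" where
  "strongly_explicit c \<Phi> \<longleftrightarrow>
     (\<exists>entry C d. \<forall>n\<ge>1. \<forall>k\<ge>1.
        dim_row (\<Phi> n k) < 2 ^ word_size c n k \<and>
        (\<forall>i<dim_row (\<Phi> n k). \<forall>j<dim_col (\<Phi> n k).
           \<exists>t s'. exec (word_size c n k) entry (entry_input n k i j) t s' \<and>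
             rreg s' 0 = \<Phi> n k $$ (i, j) \<and>
             real t \<le> C * (real k + log 2 (real n)) ^ d))"

text \<open>The arrays \<open>v\<close> and \<open>xs\<close> are given together with their lengths; all other cells are zero.\<close>

definition recover_input :: "nat \<Rightarrow> nat \<Rightarrow> real vec \<Rightarrow> nat list \<Rightarrow> state" where
  "recover_input n k v xs = blank\<lparr>
     wreg := (\<lambda>_. 0)(0 := n, 1 := k, 2 := dim_vec v, 3 := length xs),
     wmem := (\<lambda>_ _. 0)(0 := (\<lambda>p. if p < length xs then xs ! p else 0)),
     rmem := (\<lambda>_ _. 0)(0 := (\<lambda>p. if p < dim_vec v then v $ p else 0))\<rparr>"

text \<open>The final state lists the vector \<open>y\<close> as (index, value) pairs with distinct indices: register
  \<open>0\<close> holds the number of pairs, and bank \<open>1\<close> the indices (words) and the values (reals).\<close>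

definition outputs_vec :: "state \<Rightarrow> real vec \<Rightarrow> bool" where
  "outputs_vec s y \<longleftrightarrow>
     inj_on (wmem s 1) {..<wreg s 0} \<and>
     wmem s 1 ` {..<wreg s 0} \<subseteq> {..<dim_vec y} \<and>
     (\<forall>p<wreg s 0. y $ wmem s 1 p = rmem s 1 p) \<and>
     (\<forall>i<dim_vec y. i \<notin> wmem s 1 ` {..<wreg s 0} \<longrightarrow> y $ i = 0)"

text \<open>\<open>log n / (log log n + log k)\<close>\<close>

definition log_ratio :: "nat \<Rightarrow> nat \<Rightarrow> real" where
  "log_ratio n k = log 2 (real n) / (log 2 (log 2 (real n)) + log 2 (real k))"

text \<open>The pairs of positive integers for which \<open>log_ratio\<close> is meaningful and positive, i.e. all but
  \<open>n = 1\<close> and \<open>(n, k) = (2, 1)\<close>.\<close>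

definition log_ratio_dom :: "nat \<Rightarrow> nat \<Rightarrow> bool" where
  "log_ratio_dom n k \<longleftrightarrow> n > 1 \<and> k \<ge> 1 \<and> log 2 (log 2 (real n)) + log 2 (real k) > 0"

end

theory Submission
  imports Defs "HOL-Computational_Algebra.Primes" "HOL-Computational_Algebra.Polynomial"
begin

text \<open>For \<open>k < n\<close> the matrix is a Reed-Solomon design: index \<open>j\<close> is read as the polynomial over \<open>F\<^sub>q\<close>
  whose coefficients are its base-\<open>q\<close> digits, and row \<open>(a, b)\<close> sums the coordinates whose polynomial
  takes the value \<open>b\<close> at \<open>a\<close>. Two polynomials agree in \<open>O(d)\<close> points, where
  \<open>d = \<Theta>(log n / (log log n + log k))\<close>, and \<open>q = \<Theta>(k d)\<close> is prime. For a fixed index, the \<open>k\<close> largest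
  coordinates spoil \<open>O(k d)\<close> of its \<open>q\<close> measurements, and the tail perturbs only \<open>O(k d)\<close> of them by more
  than \<open>T / (4 k)\<close>, \<open>T\<close> being the \<open>l\<^sub>1\<close> norm of the tail, so the median of the \<open>q\<close> measurements has error at most that. Reporting the
  \<open>3 k\<close> largest medians among the candidates then meets the guarantee. The median is found by removing
  \<open>q / 2\<close> minima from a tournament tree, and \<open>q\<close> by a sieve, both in time \<open>O(q log n)\<close>. For \<open>k \<ge> n\<close> the
  identity matrix has few enough rows.\<close>

text \<open>The tail norm T is unknown to the algorithm, so estimates cannot be tested against a
  threshold; they are only compared with one another, which suits a machine that compares reals but
  cannot round them. Two counts fix the constants. At most 3 k coordinates exceed T / (2 k), namely
  k large ones and 2 k of the tail, whence the 3 k slots. With at most D = 2 d agreements per pair,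
  at most 5 k D = 10 k d measurements are spoiled, a minority once q > 20 k d; the code takes q at
  least 32 k d.

  The field size must be prime, computable in time, and within a constant factor of 32 k d, since
  there are q^2 rows. A prime in [N, 16 N) suffices, and this weak form of Bertrand's postulate
  follows by comparing a lower and an upper bound for \<open>Lcm {1..X}\<close>.

  The budget per candidate is O(k d log n). Evaluating the digits at all points costs O(q d), the
  tournament O(q log q), the pass over the slots O(k), and both d and log q are O(log n). Preparing
  q costs no more than one candidate up to a constant, so a nonempty candidate list pays for
  it.\<close>

subsection \<open>Primes in short intervals\<close>

text \<open>Recursion in Leibniz' harmonic triangle: the reciprocals of \<open>(n + 1) (n choose k)\<close> are integer
  combinations of \<open>1, 1/2, \<dots>, 1/(n + 1)\<close>.\<close>

lemma leibniz_harmonic_dvd: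
  "k \<le> n \<Longrightarrow> Suc n * (n choose k) dvd Lcm {1..Suc n}"
proof (induction k arbitrary: n)
  case 0
  then show ?case by (simp add: dvd_Lcm)
next
  case (Suc k)
  then obtain n' where n: "n = Suc n'" and kn: "k \<le> n'" by (cases n) auto
  define L where "L = Lcm {1..Suc n}"
  let ?A = "Suc n * (n choose Suc k)" and ?B = "Suc n * (n choose k)" and ?C = "Suc n' * (n' choose k)"
  have B: "?B dvd L" using Suc.IH[of n] kn n by (simp add: L_def)
  have "Lcm {1..Suc n'} dvd L" unfolding L_def n by (rule Lcm_subset) auto
  then have C: "?C dvd L" using Suc.IH[OF kn] dvd_trans by blast
  have pos: "?A > 0" "?B > 0" "?C > 0" using Suc.prems n kn by auto
  from B obtain u where u: "L = ?B * u" by auto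
  from C obtain v where v: "L = ?C * v" by auto
  \<comment> \<open>The recurrence of the triangle. As \<open>L\<close> is a multiple of both
    denominators on the right, multiplying by \<open>L\<close> exhibits \<open>L / ?A\<close> as the
    integer \<open>v - u\<close>.\<close>
  have eq: "(1::real) / ?A = 1 / ?C - 1 / ?B"
  proof -
    define x y where "x = real (n' choose k)" and "y = real (n' choose Suc k)"
    have xp: "x > 0" using kn by (simp add: x_def)
    have r: "real (Suc k) * y = (real n' - real k) * x"
    proof -
      have "Suc k * (n' choose Suc k) = (n' - k) * (n' choose k)"
        by (metis binomial_absorb_comp binomial_absorption mult.commute)
      then have "real (Suc k * (n' choose Suc k)) = real ((n' - k) * (n' choose k))" by simp
      then show ?thesis using Suc.prems n by (simp add: x_def y_def of_nat_diff algebra_simps)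
    qed
    have nk: "n choose Suc k = (n' choose k) + (n' choose Suc k)" by (simp add: n)
    have nk2: "real (n choose k) * (real n - real k) = real n * x"
    proof -
      have "(n - k) * (n choose k) = n * (n' choose k)"
        using binomial_absorb_comp[of n k] n by simp
      then have "real ((n - k) * (n choose k)) = real (n * (n' choose k))" by simp
      then show ?thesis using Suc.prems by (simp add: x_def of_nat_diff mult.commute)
    qed
    have d: "real n - real k > 0" using Suc.prems by simp
    have a: "real (n choose Suc k) = x + y" by (simp add: nk x_def y_def)
    have b: "real (n choose k) = real n * x / (real n - real k)" using nk2 d by (simp add: field_simps)
    have yv: "y = (real n - 1 - real k) * x / (real k + 1)"
      using r n by (simp add: field_simps)
    have xy: "x + y = real n * x / (real k + 1)" by (simp add: yv field_simps)
    show ?thesis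
      unfolding of_nat_mult a b x_def[symmetric] xy using d xp n
      by (simp add: divide_simps)
  qed
  have "real L / ?A = real L / ?C - real L / ?B" using eq by (metis divide_inverse inverse_eq_divide right_diff_distrib)
  also have "real L / ?C = v"
    using pos(3) by (metis v nonzero_mult_div_cancel_left of_nat_mult of_nat_0_less_iff less_irrefl)
  also have "real L / ?B = u"
    using pos(2) by (metis u nonzero_mult_div_cancel_left of_nat_mult of_nat_0_less_iff less_irrefl)
  finally have "real L / ?A = real v - real u" .
  moreover have "real ?A \<noteq> 0" using pos(1) by linarith
  ultimately have "real L = real ?A * (real v - real u)"
    by (metis nonzero_mult_div_cancel_left times_divide_eq_right)
  then have "real_of_int (int L) = real_of_int (int ?A * (int v - int u))" by simp
  then have "int L = int ?A * (int v - int u)" using of_int_eq_iff by blast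
  then have "int ?A dvd int L" by simp
  then show ?case unfolding L_def int_dvd_int_iff .
qed

text \<open>Chebyshev's lower bound: \<open>m * (2 * m choose m)\<close> is a middle denominator of
  the triangle, so it divides the Lcm, and the central binomial coefficient is at least 4^m / (2
  m).\<close>

lemma Lcm_upto_ge:
  assumes "m > 0"
  shows "4 ^ m \<le> 2 * Lcm {1..2 * m}"
proof -
  obtain n where m: "m = Suc n" using assms by (cases m) auto
  have "Suc (2*m - 1) * ((2*m-1) choose m) dvd Lcm {1..Suc (2*m - 1)}"
    by (rule leibniz_harmonic_dvd) (use assms in simp)
  moreover have "Suc (2*m - 1) = 2 * m" using assms by simp
  ultimately have "2 * m * ((2*m-1) choose m) dvd Lcm {1..2*m}" by (simp del: mult_Suc)
  moreover have "2 * m * ((2*m-1) choose m) = m * ((2 * m) choose m)"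
    using binomial_absorb_comp[of "2 * m" m] assms by (simp add: mult_2)
  ultimately have "m * ((2 * m) choose m) dvd Lcm {1..2*m}" by (simp only:)
  moreover have "Lcm {1..2*m} > 0" by (rule Nat.gr0I) (auto simp: Lcm_0_iff)
  ultimately have "m * ((2 * m) choose m) \<le> Lcm {1..2*m}" by (rule dvd_imp_le)
  moreover have "4 ^ m \<le> 2 * real (m * ((2 * m) choose m))"
    using central_binomial_lower_bound[OF assms] assms by (simp add: field_simps)
  ultimately have "4 ^ m \<le> 2 * real (Lcm {1..2*m})" by (smt (verit) of_nat_le_iff)
  then have "real (4 ^ m) \<le> real (2 * Lcm {1..2*m})" by simp
  then show ?thesis by (simp only: of_nat_le_iff)
qed

section \<open>Upper bounds for products of primes and for least common multiples\<close>

lemma prod_dvd_of_pairwise_coprime: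
  fixes b :: nat
  assumes "finite A" "\<And>a. a \<in> A \<Longrightarrow> a dvd b" "\<And>a a'. a \<in> A \<Longrightarrow> a' \<in> A \<Longrightarrow> a \<noteq> a' \<Longrightarrow> coprime a a'"
  shows "\<Prod>A dvd b"
  using assms
proof (induction A rule: finite_induct)
  case (insert a A)
  have "coprime a (\<Prod>A)" using insert.hyps insert.prems(2) by (intro prod_coprime_right) auto
  moreover have "a dvd b" "\<Prod>A dvd b" using insert.IH insert.prems by auto
  ultimately show ?case using insert.hyps by (simp add: divides_mult)
qed simp

text \<open>Erdos' argument: the primes in (m, 2 m] all divide \<open>2 * m choose m\<close>, which
  is at most 4^m. Staying with powers of two turns the induction into pure doubling.\<close>

lemma primorial_two_power_le:
  "\<Prod>{p::nat. prime p \<and> p \<le> 2 ^ r} \<le> 4 ^ (2 ^ r)"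
proof (induction r)
  case 0
  have "{p::nat. prime p \<and> p \<le> 2 ^ 0} = {}" by (auto dest: prime_gt_1_nat)
  then show ?case by (simp only: prod.empty) simp
next
  case (Suc r)
  define m :: nat where "m = 2 ^ r"
  let ?A = "{p::nat. prime p \<and> p \<le> m}" and ?B = "{p::nat. prime p \<and> m < p \<and> p \<le> 2 * m}"
  have fin: "finite ?A" "finite ?B" by auto
  have "\<Prod>?B dvd (2 * m choose m)"
  proof (rule prod_dvd_of_pairwise_coprime[OF fin(2)])
    fix p assume p: "p \<in> ?B"
    have "p dvd fact (2 * m)" using p by (auto simp: prime_dvd_fact_iff)
    also have "fact (2 * m) = fact m * fact m * (2 * m choose m)"
      using binomial_fact_lemma[of m "2 * m"] by simp
    finally show "p dvd (2 * m choose m)"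
      using p by (auto simp: prime_dvd_mult_iff prime_dvd_fact_iff)
  next
    fix p p' assume "p \<in> ?B" "p' \<in> ?B" "p \<noteq> p'"
    then show "coprime p p'" by (auto intro: primes_coprime)
  qed
  moreover have "(2 * m choose m) > 0" by simp
  ultimately have "\<Prod>?B \<le> (2 * m choose m)" by (rule dvd_imp_le)
  also have "(2 * m choose m) \<le> (\<Sum>i\<le>2 * m. 2 * m choose i)"
    by (rule member_le_sum) auto
  also have "\<dots> = 4 ^ m" by (simp add: choose_row_sum power_mult)
  finally have B: "\<Prod>?B \<le> 4 ^ m" .
  have "{p::nat. prime p \<and> p \<le> 2 ^ Suc r} = ?A \<union> ?B" by (auto simp: m_def)
  then have "\<Prod>{p::nat. prime p \<and> p \<le> 2 ^ Suc r} = \<Prod>?A * \<Prod>?B"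
    by (simp, subst prod.union_disjoint) auto
  also have "\<dots> \<le> 4 ^ m * 4 ^ m" using Suc.IH B by (intro mult_mono) (auto simp: m_def)
  also have "\<dots> = 4 ^ (2 ^ Suc r)" by (simp add: m_def power_add[symmetric] mult_2)
  finally show ?case .
qed

text \<open>\<open>Y\<close> is at least the integer square root of \<open>X\<close>, so a prime
  above \<open>Y\<close> has exponent at most one in the Lcm; these primes are covered by the
  primorial of \<open>2 ^ r\<close>. Each of the at most \<open>Y\<close> smaller primes contributes
  a power not exceeding \<open>X\<close>.\<close>

lemma Lcm_upto_le:
  assumes noprime: "\<And>p. prime p \<Longrightarrow> p \<le> X \<Longrightarrow> p \<le> 2 ^ r" and Y: "X < (Suc Y)\<^sup>2" and X: "X > 0"
  shows "Lcm {1..X} \<le> X ^ Y * 4 ^ (2 ^ r)"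
proof -
  define P where "P = {p::nat. prime p \<and> p \<le> X}"
  define e where "e p = floorlog p X - 1" for p
  define G where "G = (\<Prod>p\<in>P. p ^ e p)"
  have finP: "finite P" by (simp add: P_def)
  have e: "p ^ e p \<le> X" "X < p ^ Suc (e p)" if "p \<in> P" for p
  proof -
    have "p > 1" using that by (auto simp: P_def dest: prime_gt_1_nat)
    then have "p ^ (floorlog p X - 1) \<le> X \<and> X < p ^ floorlog p X" using X floorlog_bounds by auto
    moreover have "floorlog p X \<noteq> 0" using \<open>p > 1\<close> X by (simp add: floorlog_eq_zero_iff)
    ultimately show "p ^ e p \<le> X" "X < p ^ Suc (e p)" by (auto simp: e_def)
  qed
  have "G \<noteq> 0" unfolding G_def using finP by (auto simp: P_def)
  have "Lcm {1..X} dvd G"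
  proof (rule Lcm_least)
    fix x assume x: "x \<in> {1..X}"
    show "x dvd G"
    proof (rule multiplicity_le_imp_dvd)
      show "x \<noteq> 0" using x by simp
      fix p :: nat assume p: "prime p"
      have pm: "p ^ multiplicity p x \<le> x" using x by (intro dvd_imp_le multiplicity_dvd) auto
      show "multiplicity p x \<le> multiplicity p G"
      proof (cases "p \<in> P")
        case True
        have "p ^ multiplicity p x < p ^ Suc (e p)" using pm x e(2)[OF True] by simp
        then have "multiplicity p x \<le> e p" using prime_gt_1_nat[OF p]
          by (metis less_Suc_eq_le power_strict_increasing_iff)
        also have "e p = multiplicity p G"
          unfolding G_def using True p finP by (subst multiplicity_prod_prime_powers) (auto simp: P_def)
        finally show ?thesis .
      next
        case False
        then have "\<not> p dvd x" using p x by (auto simp: P_def dest!: dvd_imp_le)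
        then show ?thesis by (simp add: not_dvd_imp_multiplicity_0)
      qed
    qed
  qed
  then have "Lcm {1..X} \<le> G" using \<open>G \<noteq> 0\<close> by (intro dvd_imp_le) auto
  \<comment> \<open>The extra factor \<open>p\<close> for small primes is wasteful, but it makes the
    second factor the product over all of \<open>P\<close>.\<close>
  also have "G \<le> (\<Prod>p\<in>P. (if p \<le> Y then X else 1) * p)"
    unfolding G_def
  proof (intro prod_mono conjI)
    fix p assume p: "p \<in> P"
    have p1: "p > 1" using p by (auto simp: P_def dest: prime_gt_1_nat)
    show "p ^ e p \<le> (if p \<le> Y then X else 1) * p"
    proof (cases "p \<le> Y")
      case True
      then show ?thesis using e(1)[OF p] p1 by (simp add: mult_le_mono[of _ X 1 p, simplified])
    next
      case False
      then have "(Suc Y)\<^sup>2 \<le> p\<^sup>2" by (intro power_mono) auto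
      then have "p ^ e p < p ^ 2" using Y e(1)[OF p] by linarith
      then have "e p < 2" using p1 power_strict_increasing_iff by blast
      then have "p ^ e p \<le> p ^ 1" using p1 by (intro power_increasing) auto
      then show ?thesis using False by simp
    qed
  qed simp
  also have "\<dots> = (\<Prod>p\<in>P. if p \<le> Y then X else 1) * \<Prod>P" by (simp add: prod.distrib)
  also have "(\<Prod>p\<in>P. if p \<le> Y then X else 1) = X ^ card {p\<in>P. p \<le> Y}"
    using finP by (simp add: prod.If_cases Int_def)
  also have "X ^ card {p\<in>P. p \<le> Y} \<le> X ^ Y"
  proof (rule power_increasing)
    have "card {p\<in>P. p \<le> Y} \<le> card {1..Y}"
      by (rule card_mono) (auto simp: P_def dest: prime_gt_0_nat)
    then show "card {p\<in>P. p \<le> Y} \<le> Y" by simp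
  qed (use X in simp)
  also have "\<Prod>P \<le> \<Prod>{p::nat. prime p \<and> p \<le> 2 ^ r}"
  proof (rule dvd_imp_le)
    show "\<Prod>P dvd \<Prod>{p::nat. prime p \<and> p \<le> 2 ^ r}"
      by (rule prod_dvd_prod_subset) (use noprime in \<open>auto simp: P_def\<close>)
  qed (auto intro!: prod_pos simp: prime_gt_0_nat)
  also have "\<dots> \<le> 4 ^ (2 ^ r)" by (rule primorial_two_power_le)
  finally show ?thesis by simp
qed

text \<open>Supplies the contradiction in the prime search. It fails for \<open>f\<close> below 5,
  which dictates \<open>r \<ge> 6\<close> and \<open>N \<ge> 32\<close> further on.\<close>

lemma two_power_dominates: "5 \<le> f \<Longrightarrow> 16 * f * 2 ^ f + 8 < 3 * (2::nat) ^ (2 * f)"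
proof (induction f rule: dec_induct)
  case (step f)
  have "1 * (2::nat) ^ f \<le> f * 2 ^ f" using step.hyps by (intro mult_right_mono) linarith+
  then have "32 * (f * 2 ^ f) + 32 * (2::nat) ^ f + 8 \<le> 64 * (f * 2 ^ f) + 32" by linarith
  then have "16 * Suc f * 2 ^ Suc f + 8 \<le> 4 * (16 * f * 2 ^ f + 8)" by (simp add: algebra_simps)
  also have "\<dots> < 4 * (3 * 2 ^ (2 * f))" using step.IH by simp
  finally show ?case by simp
qed simp

text \<open>Without such a prime, compare exponents of two in the bounds for the Lcm up to 2^e with
  e = r + 3. The lower one is about 2^e, the upper one e * 2^f + 2 * 2^r. Here 2 * 2^r is a quarter
  of 2^e, and the other term is of lower order because 2^f is about the square root of 2^e. With a
  single doubling, as in Bertrand's postulate, 2 * 2^r would already equal 2^e.\<close>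

lemma prime_between_two_powers:
  assumes r: "r \<ge> 6"
  shows "\<exists>p::nat. prime p \<and> 2 ^ r < p \<and> p \<le> 2 ^ (r + 3)"
proof (rule ccontr)
  assume no: "\<not> ?thesis"
  define e where "e = r + 3"
  have four_eq: "(4::nat) = 2 ^ 2" by simp
  define f where "f = (e + 1) div 2"
  have f: "5 \<le> f" "2 * f - 1 \<le> e" "e \<le> 2 * f" using r by (auto simp: e_def f_def)
  have "4 ^ (2 ^ (r + 2)) \<le> 2 * Lcm {1..2 * (2::nat) ^ (r + 2)}" by (rule Lcm_upto_ge) simp
  also have "2 * 2 ^ (r + 2) = (2::nat) ^ e" by (simp add: e_def power_add)
  also have "Lcm {1..(2::nat) ^ e} \<le> (2 ^ e) ^ (2 ^ f) * 4 ^ (2 ^ r)"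
  proof (rule Lcm_upto_le)
    have "(2::nat) ^ e \<le> 2 ^ (2 * f)" using f by (intro power_increasing) auto
    also have "\<dots> = (2 ^ f)\<^sup>2" by (simp add: power_mult mult.commute)
    also have "\<dots> < (Suc (2 ^ f))\<^sup>2" by (intro power_strict_mono) auto
    finally show "(2::nat) ^ e < (Suc (2 ^ f))\<^sup>2" .
  qed (use no in \<open>auto simp: e_def not_less\<close>)
  finally have "(4::nat) ^ (2 ^ (r + 2)) \<le> 2 * ((2 ^ e) ^ (2 ^ f) * 4 ^ (2 ^ r))" by simp
  also have "(4::nat) ^ (2 ^ (r + 2)) = 2 ^ (2 ^ e)"
    unfolding four_eq power_mult[symmetric] by (simp add: e_def power_add)
  also have "2 * ((2 ^ e) ^ (2 ^ f) * (4::nat) ^ (2 ^ r)) = 2 ^ (1 + e * 2 ^ f + 2 * 2 ^ r)"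
    unfolding four_eq power_mult[symmetric] by (simp add: power_add)
  finally have "2 ^ e \<le> 1 + e * 2 ^ f + 2 * (2::nat) ^ r"
    by (subst (asm) power_increasing_iff) auto
  then have "3 * 2 ^ e \<le> 4 + 4 * (e * (2::nat) ^ f)" by (simp add: e_def power_add)
  moreover have "e * 2 ^ f \<le> 2 * f * (2::nat) ^ f" using f(3) by simp
  moreover have "(2::nat) ^ (2 * f) \<le> 2 * 2 ^ e"
  proof -
    have "(2::nat) ^ (2 * f) \<le> 2 ^ Suc e" using f by (intro power_increasing) auto
    then show ?thesis by simp
  qed
  moreover have "16 * f * 2 ^ f + 8 < 3 * (2::nat) ^ (2 * f)" by (rule two_power_dominates[OF f(1)])
  ultimately show False by linarith
qed

lemma prime_between:
  assumes "N \<ge> 32"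
  shows "\<exists>p::nat. prime p \<and> N \<le> p \<and> p < 16 * N"
proof -
  define r where "r = floorlog 2 N"
  have b: "2 ^ (r - 1) \<le> N" "N < 2 ^ r" using floorlog_bounds[of N 2] assms by (auto simp: r_def)
  have "Suc 5 \<le> r" unfolding r_def by (rule floorlog_ge_SucI) (use assms in auto)
  then obtain p :: nat where p: "prime p" "2 ^ r < p" "p \<le> 2 ^ (r + 3)"
    using prime_between_two_powers[of r] by auto
  have "2 ^ (r + 3) = 16 * (2::nat) ^ (r - 1)"
    using \<open>Suc 5 \<le> r\<close> by (cases r) (auto simp: power_add)
  then have le: "p \<le> 16 * N" using p(3) b(1) by simp
  \<comment> \<open>The bound must be strict, because the sieve covers only the numbers below
    \<open>16 * N\<close>; the end point itself is composite.\<close>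
  have "p \<noteq> 16 * N"
  proof
    assume "p = 16 * N"
    then have "p = 2 * (8 * N)" by simp
    then show False using p(1) assms by (metis prime_product numeral_eq_one_iff semiring_norm(85)
      le_0_eq mult_eq_1_iff nat_mult_eq_1_iff one_eq_numeral_iff zero_neq_numeral)
  qed
  then show ?thesis using p b le by (intro exI[of _ p]) auto
qed

subsection \<open>Reed-Solomon codes\<close>

text \<open>Coefficients stay integers and arithmetic in the field becomes divisibility by
  \<open>q\<close>, so no residue type depending on the value \<open>q\<close> is involved. The
  guard \<open>q \<le> 1\<close> is for termination.\<close>

fun digit_poly :: "nat \<Rightarrow> nat \<Rightarrow> int poly" where
  "digit_poly q j = (if j = 0 \<or> q \<le> 1 then 0 else pCons (int (j mod q)) (digit_poly q (j div q)))"

fun digit_eval :: "nat \<Rightarrow> nat \<Rightarrow> nat \<Rightarrow> nat" where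
  "digit_eval q a j = (if j = 0 \<or> q \<le> 1 then 0 else j mod q + a * digit_eval q a (j div q))"

declare digit_poly.simps [simp del] digit_eval.simps [simp del]

lemma poly_digit_poly: "poly (digit_poly q j) (int a) = int (digit_eval q a j)"
  by (induction q j rule: digit_poly.induct) (subst digit_poly.simps, subst digit_eval.simps, simp)

lemma degree_digit_poly: "q > 1 \<Longrightarrow> j < q ^ Suc d \<Longrightarrow> degree (digit_poly q j) \<le> d"
proof (induction d arbitrary: j)
  case 0
  then show ?case by (simp add: digit_poly.simps[of q j] digit_poly.simps[of q 0])
next
  case (Suc d)
  have "j div q < q ^ Suc d" using Suc.prems by (simp add: less_mult_imp_div_less mult.commute)
  then have "degree (digit_poly q (j div q)) \<le> d" using Suc by simp
  then show ?case by (subst digit_poly.simps) (auto simp: degree_pCons_eq_if)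
qed

lemma coeff_digit_poly: "q > 1 \<Longrightarrow> coeff (digit_poly q j) t = int (j div q ^ t mod q)"
proof (induction t arbitrary: j)
  case 0
  then show ?case by (subst digit_poly.simps) auto
next
  case (Suc t)
  then show ?case
    by (subst digit_poly.simps) (auto simp: div_mult2_eq)
qed

text \<open>Lagrange's bound on roots, with "not the zero polynomial" expressed by one coefficient
  not divisible by \<open>q\<close>. Synthetic division at a root \<open>c\<close> leaves a
  remainder divisible by \<open>q\<close>, so by primality every other root is a root of the
  quotient.\<close>

lemma roots_mod_prime:
  fixes f :: "int poly" and q :: nat
  assumes "prime q" "degree f \<le> d" "\<not> int q dvd coeff f t"
  shows "card {a. a < q \<and> int q dvd poly f (int a)} \<le> d"
  using assms(2,3)
proof (induction d arbitrary: f t)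
  case 0
  then obtain c where "f = [:c:]" by (auto elim: degree_eq_zeroE)
  then have "\<not> int q dvd c" using 0 by (cases t) (auto simp: coeff_pCons)
  then show ?case by (simp add: \<open>f = [:c:]\<close>)
next
  case (Suc d)
  let ?R = "\<lambda>f. {a. a < q \<and> int q dvd poly f (int a)}"
  show ?case
  proof (cases "?R f = {}")
    case False
    then obtain c where c: "c < q" "int q dvd poly f (int c)" by auto
    define g where "g = synthetic_div f (int c)"
    have f: "f = [:- int c, 1:] * g + [:poly f (int c):]"
      unfolding g_def by (rule synthetic_div_correct'[symmetric])
    have deg: "degree g \<le> d" using Suc.prems by (simp add: g_def degree_synthetic_div)
    \<comment> \<open>The quotient is again nonzero modulo \<open>q\<close>: otherwise all
      coefficients of the product, and with the divisible remainder all of \<open>f\<close>, would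
      vanish modulo \<open>q\<close>.\<close>
    have "\<exists>t. \<not> int q dvd coeff g t"
    proof (rule ccontr)
      assume "\<not> ?thesis"
      then have "int q dvd coeff g s" for s by blast
      moreover have "coeff f t = coeff ([:- int c, 1:] * g) t + coeff [:poly f (int c):] t"
        by (subst f) simp
      ultimately have "int q dvd coeff f t"
        using c by (cases t) (auto simp: coeff_pCons)
      then show False using Suc.prems by simp
    qed
    then obtain t' where "\<not> int q dvd coeff g t'" by blast
    then have IH: "card (?R g) \<le> d" using Suc.IH deg by blast
    have "?R f \<subseteq> insert c (?R g)"
    proof
      fix a assume a: "a \<in> ?R f"
      have "poly f (int a) = (int a - int c) * poly g (int a) + poly f (int c)"
        by (subst f) (simp add: algebra_simps)
      then have "int q dvd (int a - int c) * poly g (int a)"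
        using a c by (metis (no_types, lifting) dvd_add_left_iff mem_Collect_eq)
      moreover have "prime (int q)" using assms(1) by simp
      ultimately have "int q dvd int a - int c \<or> int q dvd poly g (int a)"
        using prime_dvd_mult_iff by blast
      moreover have "a = c" if "int q dvd int a - int c"
        using that a c zdvd_imp_le[of "int q" "int a - int c"] zdvd_imp_le[of "int q" "int c - int a"]
        by (cases "int a - int c" "0 :: int" rule: linorder_cases) (auto simp: dvd_diff_commute)
      ultimately show "a \<in> insert c (?R g)" using a by auto
    qed
    then have "card (?R f) \<le> card (insert c (?R g))" by (intro card_mono) auto
    also have "\<dots> \<le> Suc (card (?R g))" by (rule card_insert_le_m1) auto
    finally show ?thesis using IH by simp
  next
    case True
    then show ?thesis by (simp only: card.empty)
  qed
qed

lemma digits_differ: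
  fixes q :: nat
  assumes "q > 1" "j < q ^ d" "j' < q ^ d" "\<And>t. j div q ^ t mod q = j' div q ^ t mod q"
  shows "j = j'"
  using assms(2,3,4)
proof (induction d arbitrary: j j')
  case (Suc d)
  have "j div q = j' div q"
  proof (rule Suc.IH)
    show "j div q < q ^ d" "j' div q < q ^ d"
      using Suc.prems by (auto simp: less_mult_imp_div_less mult.commute)
    show "j div q div q ^ t mod q = j' div q div q ^ t mod q" for t
      using Suc.prems(3)[of "Suc t"] by (simp add: div_mult2_eq)
  qed
  moreover have "j mod q = j' mod q" using Suc.prems(3)[of 0] by simp
  ultimately show ?case by (metis div_mult_mod_eq)
qed simp

lemma code_agreements:
  assumes "prime q" "j < q ^ d" "j' < q ^ d" "j \<noteq> j'"
  shows "card {a. a < q \<and> digit_eval q a j mod q = digit_eval q a j' mod q} \<le> d"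
proof -
  have q: "q > 1" using assms(1) by (rule prime_gt_1_nat)
  let ?f = "digit_poly q j - digit_poly q j'"
  obtain t where t: "j div q ^ t mod q \<noteq> j' div q ^ t mod q"
    using digits_differ[OF q assms(2,3)] assms(4) by blast
  \<comment> \<open>The degrees are even below \<open>d\<close> when \<open>d > 0\<close>. Weakening
    the bound concedes one agreement and treats \<open>d = 0\<close> uniformly.\<close>
  have lt: "j < q ^ Suc d" "j' < q ^ Suc d" using assms q
    by (auto intro: less_le_trans[of _ "q ^ d"])
  have "degree ?f \<le> d"
    by (intro degree_diff_le degree_digit_poly q lt)
  moreover have "\<not> int q dvd coeff ?f t"
    using t q by (auto simp: coeff_digit_poly mod_eq_dvd_iff[symmetric] zmod_int[symmetric])
  ultimately have "card {a. a < q \<and> int q dvd poly ?f (int a)} \<le> d"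
    by (rule roots_mod_prime[OF assms(1)])
  then show ?thesis
    by (simp add: poly_digit_poly mod_eq_dvd_iff[symmetric] zmod_int[symmetric])
qed

subsection \<open>Robustness of the median\<close>

definition top_set :: "real vec \<Rightarrow> nat \<Rightarrow> nat set" where
  "top_set x k = {i. i < dim_vec x \<and> mag_rank x i < k}"

lemma mag_rank_less:
  assumes "i < dim_vec x" "\<bar>x $ i\<bar> > \<bar>x $ j\<bar> \<or> (\<bar>x $ i\<bar> = \<bar>x $ j\<bar> \<and> i < j)"
  shows "mag_rank x i < mag_rank x j"
  unfolding mag_rank_def
proof (rule psubset_card_mono)
  show "{l. l < dim_vec x \<and> (\<bar>x $ i\<bar> < \<bar>x $ l\<bar> \<or> \<bar>x $ l\<bar> = \<bar>x $ i\<bar> \<and> l < i)}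
    \<subset> {l. l < dim_vec x \<and> (\<bar>x $ j\<bar> < \<bar>x $ l\<bar> \<or> \<bar>x $ l\<bar> = \<bar>x $ j\<bar> \<and> l < j)}"
    using assms by fastforce
qed simp

lemma card_top_set: "card (top_set x k) \<le> k"
proof -
  \<comment> \<open>Breaking ties by index is what makes the rank injective.\<close>
  have "inj_on (mag_rank x) (top_set x k)"
  proof (rule inj_onI)
    fix i j assume "i \<in> top_set x k" "j \<in> top_set x k" "mag_rank x i = mag_rank x j"
    then show "i = j"
      using mag_rank_less[of i x j] mag_rank_less[of j x i]
      by (cases "\<bar>x $ i\<bar>" "\<bar>x $ j\<bar>" rule: linorder_cases; cases i j rule: linorder_cases)
        (auto simp: top_set_def)
  qed
  moreover have "mag_rank x ` top_set x k \<subseteq> {..<k}" by (auto simp: top_set_def)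
  ultimately have "card (top_set x k) \<le> card {..<k}" by (intro card_inj_on_le) auto
  then show ?thesis by simp
qed

lemma l1_norm_tail: "l1_norm (tail_vec x k) = (\<Sum>i \<in> {..<dim_vec x} - top_set x k. \<bar>x $ i\<bar>)"
proof -
  have "l1_norm (tail_vec x k) = (\<Sum>i<dim_vec x. if i \<in> top_set x k then 0 else \<bar>x $ i\<bar>)"
    unfolding l1_norm_def by (rule sum.cong) (auto simp: tail_vec_def top_set_def)
  also have "\<dots> = (\<Sum>i \<in> {..<dim_vec x} - top_set x k. \<bar>x $ i\<bar>)"
    by (rule sum.mono_neutral_cong_right) auto
  finally show ?thesis .
qed

lemma l1_norm_nonneg: "0 \<le> l1_norm x"
  by (simp add: l1_norm_def sum_nonneg)

definition is_median :: "nat \<Rightarrow> (nat \<Rightarrow> real) \<Rightarrow> real \<Rightarrow> bool" where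
  "is_median q V z \<longleftrightarrow> q \<le> 2 * card {a. a < q \<and> V a \<le> z} \<and> q \<le> 2 * card {a. a < q \<and> z \<le> V a}"

text \<open>The bad positions are fewer than half, so each of the two weak majorities contains a
  good one; \<open>z\<close> is then squeezed between two values close to \<open>c\<close>.\<close>

lemma median_between:
  assumes "is_median q V z" "2 * card {a. a < q \<and> \<not> \<bar>V a - c\<bar> \<le> \<epsilon>} < q"
  shows "\<bar>z - c\<bar> \<le> \<epsilon>"
proof -
  let ?B = "{a. a < q \<and> \<not> \<bar>V a - c\<bar> \<le> \<epsilon>}"
  have "\<exists>a<q. V a \<le> z \<and> \<bar>V a - c\<bar> \<le> \<epsilon>"
  proof (rule ccontr)
    assume "\<not> ?thesis"
    then have "{a. a < q \<and> V a \<le> z} \<subseteq> ?B" by auto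
    then have "card {a. a < q \<and> V a \<le> z} \<le> card ?B" by (intro card_mono) auto
    then show False using assms by (auto simp: is_median_def)
  qed
  moreover have "\<exists>a<q. z \<le> V a \<and> \<bar>V a - c\<bar> \<le> \<epsilon>"
  proof (rule ccontr)
    assume "\<not> ?thesis"
    then have "{a. a < q \<and> z \<le> V a} \<subseteq> ?B" by auto
    then have "card {a. a < q \<and> z \<le> V a} \<le> card ?B" by (intro card_mono) auto
    then show False using assms by (auto simp: is_median_def)
  qed
  ultimately show ?thesis by fastforce
qed

text \<open>A measurement is spoiled for \<open>i\<close> if some large coordinate collides with \<open>i\<close>, or if the colliding
  part of the tail has mass more than \<open>T / (4 k)\<close>; double counting bounds both kinds.\<close>

lemma few_spoiled_measurements:
  fixes h :: "nat \<Rightarrow> nat \<Rightarrow> nat"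
  assumes agree: "\<And>j. j < n \<Longrightarrow> j \<noteq> i \<Longrightarrow> card {a. a < q \<and> h a j = h a i} \<le> D"
    and x: "x \<in> carrier_vec n" and i: "i < n" and k: "k > 0"
  shows "card {a. a < q \<and> \<not> \<bar>(\<Sum>j<n. if h a j = h a i then x $ j else 0) - x $ i\<bar>
      \<le> l1_norm (tail_vec x k) / (4 * real k)} \<le> 5 * k * D"
proof -
  define T where "T = l1_norm (tail_vec x k)"
  define \<epsilon> where "\<epsilon> = T / (4 * real k)"
  define H where "H = top_set x k"
  define L where "L = {..<n} - H - {i}"
  define coll where "coll a j = (if h a j = h a i then 1 else 0 :: real)" for a j
  have dim: "dim_vec x = n" using x by simp
  have Hn: "H \<subseteq> {..<n}" by (auto simp: H_def top_set_def dim)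
  have finH: "finite H" using Hn finite_subset by blast
  have T0: "T \<ge> 0" by (simp add: T_def l1_norm_nonneg)
  have tail: "(\<Sum>j\<in>L. \<bar>x $ j\<bar>) \<le> T"
    unfolding T_def l1_norm_tail dim L_def H_def[symmetric] by (rule sum_mono2) auto
  define M where "M a = (\<Sum>j\<in>L. coll a j * \<bar>x $ j\<bar>)" for a
  define B1 where "B1 = (\<Union>j \<in> H - {i}. {a. a < q \<and> h a j = h a i})"
  define B2 where "B2 = {a. a < q \<and> M a > \<epsilon>}"
  have fin2: "finite B2" by (simp add: B2_def)
  have B1: "card B1 \<le> k * D"
  proof -
    have "card B1 \<le> (\<Sum>j \<in> H - {i}. card {a. a < q \<and> h a j = h a i})"
      unfolding B1_def by (rule card_UN_le) (use finH in simp)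
    also have "\<dots> \<le> (\<Sum>j \<in> H - {i}. D)"
      by (rule sum_mono) (use agree Hn in auto)
    also have "\<dots> \<le> card H * D" using finH by (simp add: card_Diff1_le)
    also have "\<dots> \<le> k * D" using card_top_set[of x k] by (simp add: H_def)
    finally show ?thesis .
  qed
  \<comment> \<open>Markov's inequality over the evaluation points: a tail coordinate meets
    \<open>i\<close> at most \<open>D\<close> times, so the colliding mass totals at most D T, while
    each member of \<open>B2\<close> carries more than T / (4 k).\<close>
  have B2: "card B2 \<le> 4 * k * D"
  proof -
    have "(\<Sum>a\<in>B2. M a) \<le> (\<Sum>a<q. M a)"
      by (rule sum_mono2) (auto simp: B2_def M_def coll_def intro!: sum_nonneg)
    also have "\<dots> = (\<Sum>j\<in>L. (\<Sum>a<q. coll a j) * \<bar>x $ j\<bar>)"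
      unfolding M_def by (subst sum.swap) (simp add: sum_distrib_right)
    also have "\<dots> \<le> (\<Sum>j\<in>L. real D * \<bar>x $ j\<bar>)"
    proof (intro sum_mono mult_right_mono)
      fix j assume "j \<in> L"
      then have "card {a. a < q \<and> h a j = h a i} \<le> D" using agree by (auto simp: L_def)
      moreover have "(\<Sum>a<q. coll a j) = real (card {a. a < q \<and> h a j = h a i})"
        by (simp add: coll_def sum.If_cases Int_def)
      ultimately show "(\<Sum>a<q. coll a j) \<le> real D" by simp
    qed simp
    also have "\<dots> = real D * (\<Sum>j\<in>L. \<bar>x $ j\<bar>)" by (simp add: sum_distrib_left)
    also have "\<dots> \<le> real D * T" by (intro mult_left_mono tail) simp
    finally have up: "(\<Sum>a\<in>B2. M a) \<le> real D * T" .
    show ?thesis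
    \<comment> \<open>For \<open>T = 0\<close> the threshold is 0 and cannot be cancelled. The
      strict inequality in \<open>B2\<close> then gives each member positive mass, against a total
      of at most 0.\<close>
    proof (cases "T = 0 \<or> B2 = {}")
      case True
      have "B2 = {}"
      proof (rule ccontr)
        assume ne: "B2 \<noteq> {}"
        then have "T = 0" using True by simp
        then have "\<And>a. a \<in> B2 \<Longrightarrow> M a > 0" by (auto simp: B2_def \<epsilon>_def)
        then have "(\<Sum>a\<in>B2. M a) > 0" using ne fin2 by (intro sum_pos)
        then show False using up \<open>T = 0\<close> by simp
      qed
      then show ?thesis by simp
    next
      case False
      then have T: "T > 0" using T0 by simp
      have "real (card B2) * \<epsilon> \<le> (\<Sum>a\<in>B2. M a)"
        by (rule sum_bounded_below) (auto simp: B2_def)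
      then have "real (card B2) * \<epsilon> \<le> real D * T" using up by simp
      then have "real (card B2) \<le> 4 * real k * real D"
        using T k by (simp add: \<epsilon>_def field_simps)
      then have "real (card B2) \<le> real (4 * k * D)" by simp
      then show ?thesis by (simp only: of_nat_le_iff)
    qed
  qed
  have "{a. a < q \<and> \<not> \<bar>(\<Sum>j<n. if h a j = h a i then x $ j else 0) - x $ i\<bar> \<le> \<epsilon>} \<subseteq> B1 \<union> B2"
  proof (rule subsetI, rule ccontr)
    fix a assume a: "a \<in> {a. a < q \<and> \<not> \<bar>(\<Sum>j<n. if h a j = h a i then x $ j else 0) - x $ i\<bar> \<le> \<epsilon>}"
      and nB: "a \<notin> B1 \<union> B2"
    have aq: "a < q" using a by simp
    have part: "{..<n} = insert i ((H - {i}) \<union> L)" using Hn i by (auto simp: L_def)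
    have "(\<Sum>j<n. if h a j = h a i then x $ j else 0) = (\<Sum>j<n. coll a j * x $ j)"
      by (rule sum.cong) (auto simp: coll_def)
    also have "\<dots> = x $ i + ((\<Sum>j\<in>H - {i}. coll a j * x $ j) + (\<Sum>j\<in>L. coll a j * x $ j))"
      unfolding part using finH
      by (subst sum.insert) (auto simp: L_def coll_def intro!: sum.union_disjoint)
    also have "(\<Sum>j\<in>H - {i}. coll a j * x $ j) = 0"
      using nB aq by (intro sum.neutral) (auto simp: B1_def coll_def)
    finally have "\<bar>(\<Sum>j<n. if h a j = h a i then x $ j else 0) - x $ i\<bar> = \<bar>\<Sum>j\<in>L. coll a j * x $ j\<bar>"
      by simp
    also have "\<dots> \<le> (\<Sum>j\<in>L. \<bar>coll a j * x $ j\<bar>)" by (rule sum_abs)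
    also have "\<dots> = M a" by (simp add: M_def abs_mult coll_def)
    also have "M a \<le> \<epsilon>" using nB aq by (auto simp: B2_def)
    finally show False using a by simp
  qed
  then have "card {a. a < q \<and> \<not> \<bar>(\<Sum>j<n. if h a j = h a i then x $ j else 0) - x $ i\<bar> \<le> \<epsilon>}
      \<le> card (B1 \<union> B2)"
    by (rule card_mono[rotated]) (auto simp: B1_def B2_def finH)
  also have "\<dots> \<le> card B1 + card B2" by (rule card_Un_le)
  also have "\<dots> \<le> 5 * k * D" using B1 B2 by simp
  finally show ?thesis by (simp add: \<epsilon>_def T_def)
qed

text \<open>The origin of 3 k: the top set has at most k members, and more than 2 k tail coordinates
  above T / (2 k) would have mass exceeding T. The comparison is strict, so it also covers T =
  0.\<close>

lemma card_large_coordinates: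
  assumes T: "T = l1_norm (tail_vec x k)" and k: "k > 0"
  shows "card {j. j < dim_vec x \<and> \<bar>x $ j\<bar> > T / (2 * real k)} \<le> 3 * k"
proof -
  define A where "A = {j. j < dim_vec x \<and> \<bar>x $ j\<bar> > T / (2 * real k)}"
  define B where "B = A - top_set x k"
  have finA: "finite A" by (simp add: A_def)
  have "card B \<le> 2 * k"
  proof (rule ccontr)
    assume "\<not> ?thesis"
    then have c: "card B > 2 * k" by simp
    then have ne: "B \<noteq> {}" by auto
    have finB: "finite B" using finA by (simp add: B_def)
    have T0: "T \<ge> 0" by (simp add: T l1_norm_nonneg)
    have "T = 2 * real k * (T / (2 * real k))" using k by simp
    also have "\<dots> \<le> real (card B) * (T / (2 * real k))"
      using c T0 by (intro mult_right_mono) auto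
    also have "\<dots> = (\<Sum>j\<in>B. T / (2 * real k))" by simp
    also have "\<dots> < (\<Sum>j\<in>B. \<bar>x $ j\<bar>)"
      by (rule sum_strict_mono[OF finB ne]) (simp add: B_def A_def)
    also have "\<dots> \<le> T"
      unfolding T l1_norm_tail by (rule sum_mono2) (auto simp: B_def A_def)
    finally show False by simp
  qed
  moreover have "card A \<le> card B + card (top_set x k)"
  proof -
    have "card A \<le> card (B \<union> top_set x k)"
      by (rule card_mono) (auto simp: B_def finA top_set_def)
    also have "\<dots> \<le> card B + card (top_set x k)" by (rule card_Un_le)
    finally show ?thesis .
  qed
  ultimately show ?thesis using card_top_set[of x k] by (simp add: A_def)
qed

text \<open>With estimates accurate to \<open>T / (4 k)\<close>, an unreported \<open>i\<close> with \<open>\<bar>x\<^sub>i\<bar> > T / k\<close> would force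
  \<open>3 k + 1\<close> coordinates above \<open>T / (2 k)\<close>, one more than there can be.\<close>

lemma recovery_guarantee:
  assumes k: "k > 0" and x: "x \<in> carrier_vec n" and y: "y \<in> carrier_vec n" and n: "n > 0"
    and heavy: "heavy x k 1 \<subseteq> S" and RS: "R \<subseteq> S" and S: "S \<subseteq> {..<n}"
    and T: "T = l1_norm (tail_vec x k)"
    and yR: "\<And>i. i \<in> R \<Longrightarrow> \<bar>y $ i - x $ i\<bar> \<le> T / (4 * real k)"
    and y0: "\<And>i. i < n \<Longrightarrow> i \<notin> R \<Longrightarrow> y $ i = 0"
    and out: "\<And>i. i \<in> S - R \<Longrightarrow>
       card R = 3 * k \<and> (\<exists>e. \<bar>e - x $ i\<bar> \<le> T / (4 * real k) \<and> (\<forall>j\<in>R. \<bar>e\<bar> \<le> \<bar>y $ j\<bar>))"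
  shows "linf_norm (x - y) \<le> 1 / real k * l1_norm (tail_vec x k)"
proof -
  have T0: "T \<ge> 0" by (simp add: T l1_norm_nonneg)
  have dims: "dim_vec x = n" "dim_vec y = n" using x y by auto
  have finR: "finite R" using RS S by (meson finite_lessThan finite_subset)
  have bound: "\<bar>x $ i - y $ i\<bar> \<le> T / real k" if i: "i < n" for i
  proof (cases "i \<in> R")
    case True
    have "T / (4 * real k) \<le> T / real k" using T0 k by (intro divide_left_mono) auto
    then show ?thesis using yR[OF True] by linarith
  next
    case False
    have "\<bar>x $ i\<bar> \<le> T / real k"
    proof (cases "i \<in> S")
      case False
      then have "i \<notin> Defs.heavy x k 1" using heavy by auto
      then show ?thesis using i by (simp add: heavy_def dims T)
    next
      case True
      then obtain e where c: "card R = 3 * k" and e: "\<bar>e - x $ i\<bar> \<le> T / (4 * real k)"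
        and ey: "\<And>j. j \<in> R \<Longrightarrow> \<bar>e\<bar> \<le> \<bar>y $ j\<bar>"
        using out \<open>i \<notin> R\<close> by blast
      show ?thesis
      proof (rule ccontr)
        assume "\<not> ?thesis"
        then have xi: "\<bar>x $ i\<bar> > T / real k" by simp
        define u where "u = T / (4 * real k)"
        have u: "T / real k = 4 * u" "T / (2 * real k) = 2 * u" "u \<ge> 0" using k T0 by (auto simp: u_def)
        let ?A = "{j. j < dim_vec x \<and> \<bar>x $ j\<bar> > T / (2 * real k)}"
        have "insert i R \<subseteq> ?A"
        proof
          fix j assume j: "j \<in> insert i R"
          show "j \<in> ?A"
          proof (cases "j = i")
            case True
            then show ?thesis using i xi u by (simp add: dims)
          next
            case False
            then have jR: "j \<in> R" using j by simp
            \<comment> \<open>Two estimation errors of at most \<open>u\<close> separate the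
              coordinates: \<bar>x_j\<bar> \<ge> \<bar>y_j\<bar> - u \<ge> \<bar>e\<bar> - u \<ge>
              \<bar>x_i\<bar> - 2 u, and \<bar>x_i\<bar> exceeds 4 u.\<close>
            have "\<bar>x $ j\<bar> > 2 * u"
              using ey[OF jR] yR[OF jR] e xi u unfolding u_def[symmetric] by linarith
            then show ?thesis using jR RS S u by (auto simp: dims)
          qed
        qed
        then have "card (insert i R) \<le> card ?A" by (intro card_mono) auto
        also have "\<dots> \<le> 3 * k" by (rule card_large_coordinates[OF T k])
        finally show False using c finR \<open>i \<notin> R\<close> by simp
      qed
    qed
    then show ?thesis using y0[OF i False] by simp
  qed
  show ?thesis
    unfolding linf_norm_def
  proof (rule Max.boundedI)
    fix a assume "a \<in> (\<lambda>i. \<bar>(x - y) $ i\<bar>) ` {..<dim_vec (x - y)}"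
    then show "a \<le> 1 / real k * l1_norm (tail_vec x k)"
      using bound by (auto simp: dims T)
  qed (use n in \<open>auto simp: dims\<close>)
qed

subsection \<open>Running times of programs\<close>

text \<open>Total correctness as a weakest precondition. The time is an argument of the
  postcondition, so that costs add up along the program text during simplification.\<close>

definition runs :: "nat \<Rightarrow> com \<Rightarrow> state \<Rightarrow> (nat \<Rightarrow> state \<Rightarrow> bool) \<Rightarrow> bool" where
  "runs w c s Q \<longleftrightarrow> (\<exists>t s'. exec w c s t s' \<and> Q t s')"

lemma runs_mono: "runs w c s Q \<Longrightarrow> (\<And>t s'. Q t s' \<Longrightarrow> Q' t s') \<Longrightarrow> runs w c s Q'"
  by (auto simp: runs_def)

lemma exec_iffs:
  "exec w Skip s t s' \<longleftrightarrow> t = 1 \<and> s' = s"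
  "exec w (WAssign r e) s t s' \<longleftrightarrow> t = 1 + wcost e \<and> s' = s\<lparr>wreg := (wreg s)(r := wval w e s)\<rparr>"
  "exec w (WStore b a e) s t s' \<longleftrightarrow> t = 1 + wcost a + wcost e \<and>
    s' = s\<lparr>wmem := (wmem s)(b := (wmem s b)(wval w a s := wval w e s))\<rparr>"
  "exec w (RAssign r f) s t s' \<longleftrightarrow> t = 1 + rcost f \<and> s' = s\<lparr>rreg := (rreg s)(r := rval w f s)\<rparr>"
  "exec w (RStore b a f) s t s' \<longleftrightarrow> t = 1 + wcost a + rcost f \<and>
    s' = s\<lparr>rmem := (rmem s)(b := (rmem s b)(wval w a s := rval w f s))\<rparr>"
  "exec w (Seq c d) s t s' \<longleftrightarrow> (\<exists>t1 t2 s1. exec w c s t1 s1 \<and> exec w d s1 t2 s' \<and> t = t1 + t2)"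
  "exec w (Cond g c d) s t s' \<longleftrightarrow>
    (\<exists>u. (if bval w g s then exec w c s u s' else exec w d s u s') \<and> t = 1 + bcost g + u)"
  by ((subst exec.simps, auto)[1])+

lemma runs_simps [simp]:
  "runs w Skip s Q \<longleftrightarrow> Q 1 s"
  "runs w (WAssign r e) s Q \<longleftrightarrow> Q (1 + wcost e) (s\<lparr>wreg := (wreg s)(r := wval w e s)\<rparr>)"
  "runs w (WStore b a e) s Q \<longleftrightarrow> Q (1 + wcost a + wcost e)
    (s\<lparr>wmem := (wmem s)(b := (wmem s b)(wval w a s := wval w e s))\<rparr>)"
  "runs w (RAssign r f) s Q \<longleftrightarrow> Q (1 + rcost f) (s\<lparr>rreg := (rreg s)(r := rval w f s)\<rparr>)"
  "runs w (RStore b a f) s Q \<longleftrightarrow> Q (1 + wcost a + rcost f)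
    (s\<lparr>rmem := (rmem s)(b := (rmem s b)(wval w a s := rval w f s))\<rparr>)"
  "runs w (Seq c d) s Q \<longleftrightarrow> runs w c s (\<lambda>t s'. runs w d s' (\<lambda>u. Q (t + u)))"
  "runs w (Cond g c d) s Q \<longleftrightarrow>
    (if bval w g s then runs w c s (\<lambda>t. Q (1 + bcost g + t)) else runs w d s (\<lambda>t. Q (1 + bcost g + t)))"
  by (auto simp: runs_def exec_iffs) blast

text \<open>\<open>\<Phi>\<close> is a potential that pays for the remaining iterations.\<close>

lemma runs_While:
  fixes \<Phi> :: "state \<Rightarrow> nat"
  assumes "J s"
    and body: "\<And>s. J s \<Longrightarrow> bval w b s \<Longrightarrow> runs w c s (\<lambda>t s'. J s' \<and> t + 1 + bcost b + \<Phi> s' \<le> \<Phi> s)"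
  shows "runs w (While b c) s (\<lambda>t s'. J s' \<and> \<not> bval w b s' \<and> t \<le> \<Phi> s + 1 + bcost b)"
  using \<open>J s\<close>
proof (induction "\<Phi> s" arbitrary: s rule: less_induct)
  case less
  show ?case
  proof (cases "bval w b s")
    case False
    then have "exec w (While b c) s (1 + bcost b) s" by (rule exec_WhileF)
    moreover have "1 + bcost b \<le> \<Phi> s + 1 + bcost b" by simp
    ultimately show ?thesis using False less.prems unfolding runs_def by blast
  next
    case True
    from body[OF less.prems True] obtain t s' where
      1: "exec w c s t s'" "J s'" "t + 1 + bcost b + \<Phi> s' \<le> \<Phi> s" by (auto simp: runs_def)
    \<comment> \<open>The test alone costs at least one unit, so the potential that bounds the time
      also proves termination.\<close>
    then have "\<Phi> s' < \<Phi> s" by simp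
    from less.hyps[OF this 1(2)] obtain u s'' where
      2: "exec w (While b c) s' u s''" "J s''" "\<not> bval w b s''" "u \<le> \<Phi> s' + 1 + bcost b"
      by (auto simp: runs_def)
    have "exec w (While b c) s (1 + bcost b + t + u) s''" by (rule exec_WhileT[OF True 1(1) 2(1)])
    moreover have "1 + bcost b + t + u \<le> \<Phi> s + 1 + bcost b" using 1(3) 2(4) by simp
    ultimately show ?thesis using 2 unfolding runs_def by blast
  qed
qed

text \<open>Folding \<open>2 ^ w\<close> keeps the simplifier from rewriting the side conditions of \<open>wval_simps\<close>.\<close>

definition wlim :: "nat \<Rightarrow> nat" where "wlim w = 2 ^ w"

lemma wval_simps [simp]:
  "a < wlim w \<Longrightarrow> wval w (WConst a) s = a"
  "wval w e s + wval w f s < wlim w \<Longrightarrow> wval w (WAdd e f) s = wval w e s + wval w f s"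
  "wval w f s \<le> wval w e s \<Longrightarrow> wval w e s < wlim w \<Longrightarrow> wval w (WSub e f) s = wval w e s - wval w f s"
  "wval w e s * wval w f s < wlim w \<Longrightarrow> wval w (WMul e f) s = wval w e s * wval w f s"
  by (auto simp: wlim_def mod_if)

declare wval.simps(1,4,5,6) [simp del]

abbreviation seq_com :: "com \<Rightarrow> com \<Rightarrow> com" (infixr \<open>;;\<close> 60) where "c ;; d \<equiv> Seq c d"

definition same_regs :: "nat set \<Rightarrow> state \<Rightarrow> state \<Rightarrow> bool" where
  "same_regs R s s' \<longleftrightarrow> (\<forall>r. r \<notin> R \<longrightarrow> wreg s' r = wreg s r)"

lemma floorlog_step: "x > 0 \<Longrightarrow> b > 1 \<Longrightarrow> floorlog b x = Suc (floorlog b (x div b))"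
  by (subst compute_floorlog) simp

subsection \<open>Finding the field size\<close>

text \<open>Registers 0 to 3 hold the input and 4 the field size; 5 to 9 belong to the preparation, 10 to 17
  to the point query (10 is the queried index), 18 to 20 to the selection (19 counts the occupied
  slots), and 21 is the position in the list. Bank 1 holds the slots, word bank 2 the sieve,
  word bank 3 the tournament tree and real bank 2 the values of its leaves.\<close>

definition count_digits :: "wexp \<Rightarrow> com" where
  "count_digits B =
    WAssign 5 (WConst 0) ;; WAssign 6 (WReg 0) ;;
    While (WLess (WConst 0) (WReg 6))
      (WAssign 5 (WAdd (WReg 5) (WConst 1)) ;; WAssign 6 (WDiv (WReg 6) B))"

text \<open>Needed for two bases, the constant 2 and a value kept in register 7; hence the
  hypothesis that \<open>B\<close> has the same value in every state agreeing on that
  register.\<close>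

lemma runs_count_digits:
  assumes b: "1 < b" and B: "\<And>s'. wreg s' 7 = wreg s 7 \<Longrightarrow> wval w B s' = b"
    and w: "floorlog b (wreg s 0) < wlim w" "1 < wlim w"
  shows "runs w (count_digits B) s (\<lambda>t s'. wreg s' 5 = floorlog b (wreg s 0) \<and>
    t \<le> (14 + wcost B) * floorlog b (wreg s 0) + 10 \<and> same_regs {5,6} s s' \<and>
    wmem s' = wmem s \<and> rreg s' = rreg s \<and> rmem s' = rmem s)"
proof -
  define J where "J s' \<longleftrightarrow> wreg s' 5 + floorlog b (wreg s' 6) = floorlog b (wreg s 0) \<and>
    same_regs {5,6} s s' \<and> wmem s' = wmem s \<and> rreg s' = rreg s \<and> rmem s' = rmem s" for s'
  define \<Phi> where "\<Phi> s' = floorlog b (wreg s' 6) * (14 + wcost B)" for s' :: state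
  show ?thesis
    unfolding count_digits_def using w
    apply simp
    apply (rule runs_mono[OF runs_While[of J _ _ _ _ \<Phi>]])
    subgoal by (auto simp: J_def same_regs_def)
    subgoal for s'
      using w b B[of "s'\<lparr>wreg := (wreg s')(5 := Suc (wreg s' 5))\<rparr>"] floorlog_step[of "wreg s' 6" b]
      by (auto simp: J_def same_regs_def \<Phi>_def)
    subgoal using w by (auto simp: J_def \<Phi>_def same_regs_def floorlog_eq_zero_iff[THEN iffD2] mult.commute)
    done
qed

text \<open>Cost of the sieve, by dyadic blocks: the upper half of the range has at most
  \<open>Suc h\<close> terms, each at most \<open>M div Suc h\<close>, so every halving contributes
  at most \<open>M\<close>.\<close>

lemma sum_div_le_floorlog: "(\<Sum>p\<in>{0<..m}. M div p) \<le> M * floorlog 2 m"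
proof (induction m rule: less_induct)
  case (less m)
  show ?case
  proof (cases "m = 0")
    case False
    define h where "h = m div 2"
    have "{0<..m} = {0<..h} \<union> {h<..m}" by (auto simp: h_def)
    then have "(\<Sum>p\<in>{0<..m}. M div p) = (\<Sum>p\<in>{0<..h}. M div p) + (\<Sum>p\<in>{h<..m}. M div p)"
      by (simp, subst sum.union_disjoint) auto
    also have "(\<Sum>p\<in>{0<..h}. M div p) \<le> M * floorlog 2 h"
      by (rule less.IH) (use False in \<open>simp add: h_def\<close>)
    also have "(\<Sum>p\<in>{h<..m}. M div p) \<le> (\<Sum>p\<in>{h<..m}. M div Suc h)"
      by (intro sum_mono div_le_mono2) auto
    also have "\<dots> = (m - h) * (M div Suc h)" by simp
    also have "\<dots> \<le> Suc h * (M div Suc h)" by (intro mult_right_mono) (auto simp: h_def)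
    also have "\<dots> \<le> M" by (rule times_div_less_eq_dividend)
    finally show ?thesis using floorlog_step[of m 2] False by (simp add: h_def)
  qed simp
qed

section \<open>The sieve and the scan for the first prime\<close>

definition strike :: com where
  "strike = WAssign 9 (WAdd (WReg 6) (WReg 6)) ;;
    While (WLess (WReg 9) (WReg 8))
      (WStore 2 (WReg 9) (WConst 1) ;; WAssign 9 (WAdd (WReg 9) (WReg 6)))"

lemma runs_strike:
  assumes p: "wreg s 6 = p" "0 < p" "p < M" and M: "wreg s 8 = M" "2 * M < wlim w"
  shows "runs w strike s (\<lambda>t s'. t \<le> 12 * (M div p) + 10 \<and> same_regs {9} s s' \<and>
    (\<forall>b. b \<noteq> 2 \<longrightarrow> wmem s' b = wmem s b) \<and> rreg s' = rreg s \<and> rmem s' = rmem s \<and>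
    (\<forall>y<M. wmem s' 2 y \<noteq> 0 \<longleftrightarrow> wmem s 2 y \<noteq> 0 \<or> (\<exists>c\<ge>2. y = c * p)))"
proof -
  define J where "J s' \<longleftrightarrow> same_regs {9} s s' \<and>
    (\<forall>b. b \<noteq> 2 \<longrightarrow> wmem s' b = wmem s b) \<and> rreg s' = rreg s \<and> rmem s' = rmem s \<and>
    (\<exists>m\<ge>2. wreg s' 9 = m * p \<and>
      (\<forall>y<M. wmem s' 2 y \<noteq> 0 \<longleftrightarrow> wmem s 2 y \<noteq> 0 \<or> (\<exists>c. 2 \<le> c \<and> c < m \<and> y = c * p)))" for s'
  \<comment> \<open>Adding \<open>p\<close> before the division rounds up, so the potential still
    pays for the last multiple below \<open>M\<close>; the start at \<open>2 * p\<close> brings the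
    total back to \<open>M div p\<close>.\<close>
  define \<Phi> where "\<Phi> s' = 12 * ((M + p - wreg s' 9) div p)" for s' :: state
  have init: "J (s\<lparr>wreg := (wreg s)(9 := wreg s 6 + wreg s 6)\<rparr>)"
    unfolding J_def using p by (auto simp: same_regs_def intro!: exI[of _ 2])
  have step: "runs w (WStore 2 (WReg 9) (WConst 1) ;; WAssign 9 (WAdd (WReg 9) (WReg 6))) s'
      (\<lambda>t s''. J s'' \<and> t + 1 + bcost (WLess (WReg 9) (WReg 8)) + \<Phi> s'' \<le> \<Phi> s')"
    if J: "J s'" and b: "bval w (WLess (WReg 9) (WReg 8)) s'" for s'
  proof -
    have r: "wreg s' 6 = p" "wreg s' 8 = M" using J p M by (auto simp: J_def same_regs_def)
    from J obtain m where m: "m \<ge> 2" "wreg s' 9 = m * p"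
      "\<forall>y<M. wmem s' 2 y \<noteq> 0 \<longleftrightarrow> wmem s 2 y \<noteq> 0 \<or> (\<exists>c. 2 \<le> c \<and> c < m \<and> y = c * p)"
      by (auto simp: J_def)
    have lt: "m * p < M" using b m r by simp
    let ?s = "s'\<lparr>wmem := (wmem s')(2 := (wmem s' 2)(m * p := 1)), wreg := (wreg s')(9 := m * p + p)\<rparr>"
    have "J ?s"
      unfolding J_def
    proof (intro conjI exI[of _ "Suc m"] allI impI)
      fix y assume y: "y < M"
      show "(wmem ?s 2 y \<noteq> 0) = (wmem s 2 y \<noteq> 0 \<or> (\<exists>c\<ge>2. c < Suc m \<and> y = c * p))"
        using m(1) m(3)[rule_format, OF y] by (auto simp: less_Suc_eq)
    qed (use J m in \<open>auto simp: J_def same_regs_def\<close>)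
    moreover have "(M + p - m * p) div p = Suc ((M - m * p) div p)"
    proof -
      have "M + p - m * p = (M - m * p) + p" using lt by simp
      moreover have "p \<noteq> 0" using p by simp
      ultimately show ?thesis by (metis div_add_self2 Suc_eq_plus1)
    qed
    then have "12 + \<Phi> ?s \<le> \<Phi> s'" using m(2) by (simp add: \<Phi>_def)
    ultimately show ?thesis using m(2) r p M lt by simp
  qed
  let ?s0 = "s\<lparr>wreg := (wreg s)(9 := wreg s 6 + wreg s 6)\<rparr>"
  let ?post = "\<lambda>t s'. t \<le> 12 * (M div p) + 6 \<and> same_regs {9} s s' \<and>
    (\<forall>b. b \<noteq> 2 \<longrightarrow> wmem s' b = wmem s b) \<and> rreg s' = rreg s \<and> rmem s' = rmem s \<and>
    (\<forall>y<M. wmem s' 2 y \<noteq> 0 \<longleftrightarrow> wmem s 2 y \<noteq> 0 \<or> (\<exists>c\<ge>2. y = c * p))"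
  have loop: "runs w (While (WLess (WReg 9) (WReg 8))
      (WStore 2 (WReg 9) (WConst 1) ;; WAssign 9 (WAdd (WReg 9) (WReg 6)))) ?s0 ?post"
  proof (rule runs_mono[OF runs_While[of J _ _ _ _ \<Phi>, OF init step]])
    fix t s' assume a: "J s' \<and> \<not> bval w (WLess (WReg 9) (WReg 8)) s' \<and>
      t \<le> \<Phi> (s\<lparr>wreg := (wreg s)(9 := wreg s 6 + wreg s 6)\<rparr>) + 1 + bcost (WLess (WReg 9) (WReg 8))"
    then obtain m where m: "m \<ge> 2" "wreg s' 9 = m * p"
      "\<forall>y<M. wmem s' 2 y \<noteq> 0 \<longleftrightarrow> wmem s 2 y \<noteq> 0 \<or> (\<exists>c. 2 \<le> c \<and> c < m \<and> y = c * p)"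
      by (auto simp: J_def)
    have "wreg s' 8 = M" using a M by (auto simp: J_def same_regs_def)
    then have ge: "M \<le> m * p" using a m by simp
    have "(wmem s' 2 y \<noteq> 0) = (wmem s 2 y \<noteq> 0 \<or> (\<exists>c\<ge>2. y = c * p))" if y: "y < M" for y
    proof -
      have "c < m" if "y = c * p" for c
      proof -
        have "c * p < m * p" using ge y that by linarith
        then show ?thesis by (metis mult_less_cancel2)
      qed
      then show ?thesis using m(3)[rule_format, OF y] by blast
    qed
    moreover have "(M + p - (p + p)) div p \<le> M div p" by (intro div_le_mono) simp
    ultimately show "?post t s'"
      using a p by (simp add: J_def \<Phi>_def)
  qed
  have "wreg s 6 + wreg s 6 < wlim w" using p M by simp
  then show ?thesis
    unfolding strike_def using runs_mono[OF loop] by simp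
qed

lemma runs_SeqI:
  "runs w c s R \<Longrightarrow> (\<And>t s'. R t s' \<Longrightarrow> runs w d s' (\<lambda>u. Q (t + u))) \<Longrightarrow> runs w (Seq c d) s Q"
  by (simp add: runs_mono)

text \<open>Multiples of every number are struck, not only those of primes. This keeps the invariant
  simple, and the full harmonic sum is affordable.\<close>

definition sieve :: com where
  "sieve = WAssign 6 (WConst 2) ;;
    While (WLess (WReg 6) (WReg 8)) (strike ;; WAssign 6 (WAdd (WReg 6) (WConst 1)))"

lemma runs_sieve:
  assumes M: "wreg s 8 = M" "2 * M < wlim w" "2 \<le> M" and clean: "\<And>y. wmem s 2 y = 0"
  shows "runs w sieve s (\<lambda>t s'. t \<le> 12 * (M * floorlog 2 M) + 20 * M + 10 \<and> same_regs {6, 9} s s' \<and>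
    (\<forall>b. b \<noteq> 2 \<longrightarrow> wmem s' b = wmem s b) \<and> rreg s' = rreg s \<and> rmem s' = rmem s \<and>
    (\<forall>y<M. wmem s' 2 y \<noteq> 0 \<longleftrightarrow> (\<exists>p\<ge>2. \<exists>c\<ge>2. y = c * p)))"
proof -
  define J where "J s' \<longleftrightarrow> same_regs {6, 9} s s' \<and> 2 \<le> wreg s' 6 \<and>
    (\<forall>b. b \<noteq> 2 \<longrightarrow> wmem s' b = wmem s b) \<and> rreg s' = rreg s \<and> rmem s' = rmem s \<and>
    (\<forall>y<M. wmem s' 2 y \<noteq> 0 \<longleftrightarrow> (\<exists>p\<ge>2. p < wreg s' 6 \<and> (\<exists>c\<ge>2. y = c * p)))" for s'
  define \<Phi> where "\<Phi> s' = (\<Sum>p\<in>{wreg s' 6..<M}. 12 * (M div p) + 20)" for s' :: state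
  let ?s0 = "s\<lparr>wreg := (wreg s)(6 := 2)\<rparr>"
  let ?post = "\<lambda>t s'. t \<le> 12 * (M * floorlog 2 M) + 20 * M + 5 \<and> same_regs {6, 9} s s' \<and>
    (\<forall>b. b \<noteq> 2 \<longrightarrow> wmem s' b = wmem s b) \<and> rreg s' = rreg s \<and> rmem s' = rmem s \<and>
    (\<forall>y<M. wmem s' 2 y \<noteq> 0 \<longleftrightarrow> (\<exists>p\<ge>2. \<exists>c\<ge>2. y = c * p))"
  have init: "J ?s0" using clean by (auto simp: J_def same_regs_def)
  have step: "runs w (strike ;; WAssign 6 (WAdd (WReg 6) (WConst 1))) s'
      (\<lambda>t s''. J s'' \<and> t + 1 + bcost (WLess (WReg 6) (WReg 8)) + \<Phi> s'' \<le> \<Phi> s')"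
    if J: "J s'" and b: "bval w (WLess (WReg 6) (WReg 8)) s'" for s'
  proof -
    define p where "p = wreg s' 6"
    have r8: "wreg s' 8 = M" using J M by (auto simp: J_def same_regs_def)
    have p: "2 \<le> p" "p < M" using J b r8 by (auto simp: J_def p_def)
    have "runs w strike s' (\<lambda>t s''. t \<le> 12 * (M div p) + 10 \<and> same_regs {9} s' s'' \<and>
        (\<forall>b. b \<noteq> 2 \<longrightarrow> wmem s'' b = wmem s' b) \<and> rreg s'' = rreg s' \<and> rmem s'' = rmem s' \<and>
        (\<forall>y<M. wmem s'' 2 y \<noteq> 0 \<longleftrightarrow> wmem s' 2 y \<noteq> 0 \<or> (\<exists>c\<ge>2. y = c * p)))"
      by (rule runs_strike) (use p r8 M in \<open>auto simp: p_def\<close>)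
    then show ?thesis
    proof (rule runs_SeqI, goal_cases)
      case (1 t s'')
      have r6: "wreg s'' 6 = p" using 1 by (simp add: same_regs_def p_def)
      let ?s = "s''\<lparr>wreg := (wreg s'')(6 := Suc p)\<rparr>"
      have "J ?s"
        unfolding J_def
      proof (intro conjI allI impI)
        fix y assume y: "y < M"
        have "wmem s'' 2 y \<noteq> 0 \<longleftrightarrow> wmem s' 2 y \<noteq> 0 \<or> (\<exists>c\<ge>2. y = c * p)" using 1 y by blast
        also have "wmem s' 2 y \<noteq> 0 \<longleftrightarrow> (\<exists>p'\<ge>2. p' < p \<and> (\<exists>c\<ge>2. y = c * p'))"
          using J y unfolding J_def p_def by blast
        finally show "(wmem ?s 2 y \<noteq> 0) = (\<exists>p\<ge>2. p < wreg ?s 6 \<and> (\<exists>c\<ge>2. y = c * p))"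
          using p by (auto simp: less_Suc_eq)
      qed (use J 1 p in \<open>auto simp: J_def same_regs_def\<close>)
      moreover have "\<Phi> s' = 12 * (M div p) + 20 + \<Phi> ?s"
        unfolding \<Phi>_def using p by (simp add: p_def[symmetric] sum.atLeast_Suc_lessThan)
      ultimately show ?case using 1 r6 p M by simp
    qed
  qed
  have loop: "runs w (While (WLess (WReg 6) (WReg 8)) (strike ;; WAssign 6 (WAdd (WReg 6) (WConst 1)))) ?s0 ?post"
  proof (rule runs_mono[OF runs_While[of J _ _ _ _ \<Phi>, OF init step]], goal_cases)
    case (3 t s')
    have "wreg s' 8 = M" using 3 M by (auto simp: J_def same_regs_def)
    then have ge: "M \<le> wreg s' 6" using 3 by simp
    have "(wmem s' 2 y \<noteq> 0) = (\<exists>p\<ge>2. \<exists>c\<ge>2. y = c * p)" if y: "y < M" for y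
    proof -
      have "p < wreg s' 6" if "y = c * p" "2 \<le> c" for p c
      proof -
        have "p \<le> y" using that by simp
        then show ?thesis using ge y by simp
      qed
      moreover have "(wmem s' 2 y \<noteq> 0) = (\<exists>p\<ge>2. p < wreg s' 6 \<and> (\<exists>c\<ge>2. y = c * p))"
        using 3 y by (simp add: J_def)
      ultimately show ?thesis by blast
    qed
    moreover have "\<Phi> ?s0 \<le> 12 * (M * floorlog 2 M) + 20 * M"
    proof -
      have "\<Phi> ?s0 = 12 * (\<Sum>p\<in>{2..<M}. M div p) + 20 * (M - 2)"
        by (simp add: \<Phi>_def sum.distrib sum_distrib_left)
      moreover have "(\<Sum>p\<in>{2..<M}. M div p) \<le> (\<Sum>p\<in>{0<..M}. M div p)"
        by (rule sum_mono2) auto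
      ultimately show ?thesis using sum_div_le_floorlog[of M M] by linarith
    qed
    ultimately show ?case using 3 by (simp add: J_def)
  qed
  show ?thesis unfolding sieve_def using runs_mono[OF loop] M by simp
qed

definition least_prime_from :: "nat \<Rightarrow> nat" where
  "least_prime_from N = (LEAST p. prime p \<and> N \<le> p)"

lemma least_prime_from:
  assumes "N \<ge> 32"
  shows "prime (least_prime_from N)" "N \<le> least_prime_from N" "least_prime_from N < 16 * N"
proof -
  obtain p where p: "prime p" "N \<le> p" "p < 16 * N" using prime_between[OF assms] by auto
  then have "prime (least_prime_from N) \<and> N \<le> least_prime_from N"
    unfolding least_prime_from_def by (intro LeastI[of "\<lambda>p. prime p \<and> N \<le> p" p]) auto
  then show "prime (least_prime_from N)" "N \<le> least_prime_from N" by auto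
  have "least_prime_from N \<le> p" unfolding least_prime_from_def using p by (intro Least_le) auto
  then show "least_prime_from N < 16 * N" using p by simp
qed

lemma prime_iff_not_product:
  assumes "2 \<le> (y::nat)"
  shows "prime y \<longleftrightarrow> \<not> (\<exists>p\<ge>2. \<exists>c\<ge>2. y = c * p)"
proof
  assume y: "prime y"
  show "\<not> (\<exists>p\<ge>2. \<exists>c\<ge>2. y = c * p)"
  proof
    assume "\<exists>p\<ge>2. \<exists>c\<ge>2. y = c * p"
    then obtain p c where "p \<ge> 2" "c \<ge> 2" "y = c * p" by blast
    then show False using y prime_product[of c p] by auto
  qed
next
  assume a: "\<not> (\<exists>p\<ge>2. \<exists>c\<ge>2. y = c * p)"
  obtain p where p: "prime p" "p dvd y" using assms prime_factor_nat[of y] by auto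
  then obtain c where c: "y = c * p" by (auto simp: mult.commute)
  have "p \<ge> 2" using p prime_ge_2_nat by blast
  then have "c < 2" using a c not_less by blast
  moreover have "c \<noteq> 0" using c assms by (intro notI) simp
  ultimately have "c = 1" by simp
  then show "prime y" using c p by simp
qed

definition find_unmarked :: com where
  "find_unmarked = While (WLess (WConst 0) (WLoad 2 (WReg 4))) (WAssign 4 (WAdd (WReg 4) (WConst 1)))"

text \<open>A prime below \<open>16 * N\<close> plays two parts: it stops the scan, and it keeps all
  inspected cells inside the range where the marks are known to be correct.\<close>

lemma runs_find_unmarked:
  assumes N: "wreg s 4 = N" "32 \<le> N" and w: "16 * N < wlim w"
    and marks: "\<forall>y<16 * N. wmem s 2 y \<noteq> 0 \<longleftrightarrow> (\<exists>p\<ge>2. \<exists>c\<ge>2. y = c * p)"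
  shows "runs w find_unmarked s (\<lambda>t s'. t \<le> 9 * (16 * N) + 10 \<and> same_regs {4} s s' \<and>
    wreg s' 4 = least_prime_from N \<and> wmem s' = wmem s \<and> rreg s' = rreg s \<and> rmem s' = rmem s)"
proof -
  define q where "q = least_prime_from N"
  have q: "prime q" "N \<le> q" "q < 16 * N" using least_prime_from[OF N(2)] by (auto simp: q_def)
  have prime_iff: "prime y \<longleftrightarrow> wmem s 2 y = 0" if "N \<le> y" "y < 16 * N" for y
  proof -
    have "2 \<le> y" using that N by simp
    moreover have "wmem s 2 y \<noteq> 0 \<longleftrightarrow> (\<exists>p\<ge>2. \<exists>c\<ge>2. y = c * p)" using marks that by blast
    ultimately show ?thesis using prime_iff_not_product[of y] by blast
  qed
  define J where "J s' \<longleftrightarrow> same_regs {4} s s' \<and> N \<le> wreg s' 4 \<and> wreg s' 4 \<le> q \<and>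
    wmem s' = wmem s \<and> rreg s' = rreg s \<and> rmem s' = rmem s" for s'
  define \<Phi> where "\<Phi> s' = 9 * (q - wreg s' 4)" for s' :: state
  have init: "J s" using N q by (auto simp: J_def same_regs_def)
  have step: "runs w (WAssign 4 (WAdd (WReg 4) (WConst 1))) s'
      (\<lambda>t s''. J s'' \<and> t + 1 + bcost (WLess (WConst 0) (WLoad 2 (WReg 4))) + \<Phi> s'' \<le> \<Phi> s')"
    if J: "J s'" and b: "bval w (WLess (WConst 0) (WLoad 2 (WReg 4))) s'" for s'
  proof -
    have "wreg s' 4 \<noteq> q" using J b w prime_iff[of q] q by (auto simp: J_def)
    then have "wreg s' 4 < q" using J by (simp add: J_def)
    then show ?thesis using J q w by (auto simp: J_def \<Phi>_def same_regs_def)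
  qed
  show ?thesis
    unfolding find_unmarked_def q_def[symmetric]
  proof (rule runs_mono[OF runs_While[of J _ _ _ _ \<Phi>, OF init step]], goal_cases)
    case (3 t s')
    then have r: "N \<le> wreg s' 4" "wreg s' 4 \<le> q" "wmem s 2 (wreg s' 4) = 0"
      using w by (auto simp: J_def)
    then have "prime (wreg s' 4)" using prime_iff q by auto
    then have "q \<le> wreg s' 4" unfolding q_def least_prime_from_def using r by (intro Least_le) auto
    moreover have "\<Phi> s \<le> 9 * (16 * N)" using q by (simp add: \<Phi>_def)
    ultimately show ?case using 3 r by (auto simp: J_def)
  qed
qed

text \<open>The base \<open>k \<cdot> floorlog 2 n\<close> is at most the square of the field size (see \<open>parameter_bounds\<close>), so twice
  \<open>num_digits\<close> many digits in the field suffice for all indices below \<open>n\<close>, and no search for the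
  optimal degree is needed.\<close>

definition num_digits :: "nat \<Rightarrow> nat \<Rightarrow> nat" where
  "num_digits n k = floorlog (k * floorlog 2 n) n"

text \<open>The factor 32 serves twice: more than 20 k d points are needed for the spoiled ones to
  be a minority, and the existence of the prime is proved from 32 on.\<close>

definition field_size :: "nat \<Rightarrow> nat \<Rightarrow> nat" where
  "field_size n k = least_prime_from (32 * (k * num_digits n k))"

definition prepare :: com where
  "prepare = count_digits (WConst 2) ;; WAssign 7 (WMul (WReg 1) (WReg 5)) ;;
    count_digits (WReg 7) ;; WAssign 4 (WMul (WConst 32) (WMul (WReg 1) (WReg 5))) ;;
    WAssign 8 (WMul (WConst 16) (WReg 4)) ;; sieve ;; find_unmarked"

lemma floorlog2_ge_2: "2 \<le> n \<Longrightarrow> 2 \<le> floorlog 2 n"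
  by (rule floorlog_geI) auto

lemma num_digits_pos:
  assumes "2 \<le> n" "1 \<le> k"
  shows "1 \<le> num_digits n k"
proof -
  have "1 * 2 \<le> k * floorlog 2 n" using assms floorlog2_ge_2 by (intro mult_le_mono) auto
  then have "num_digits n k \<noteq> 0" using assms by (auto simp: num_digits_def floorlog_eq_zero_iff)
  then show ?thesis by simp
qed

lemma runs_prepare:
  fixes n k :: nat
  defines "d \<equiv> num_digits n k" and "l \<equiv> floorlog 2 n"
  assumes nk: "wreg s 0 = n" "wreg s 1 = k" "2 \<le> n" "1 \<le> k"
    and w: "1024 * (k * d) < wlim w" "k * l < wlim w" and clean: "\<And>y. wmem s 2 y = 0"
  shows "runs w prepare s (\<lambda>t s'.
    t \<le> 15 * l + 15 * d + 12 * (512 * (k * d) * floorlog 2 (512 * (k * d))) + 40 * (512 * (k * d)) + 100 \<and>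
    same_regs {4,5,6,7,8,9} s s' \<and> wreg s' 4 = field_size n k \<and>
    (\<forall>b. b \<noteq> 2 \<longrightarrow> wmem s' b = wmem s b) \<and> rreg s' = rreg s \<and> rmem s' = rmem s)"
proof -
  have d: "1 \<le> d" unfolding d_def by (rule num_digits_pos[OF nk(3,4)])
  have kd: "1 * 1 \<le> k * d" using d nk by (intro mult_le_mono) auto
  have b: "1 * 2 \<le> k * l" using nk floorlog2_ge_2[of n] unfolding l_def by (intro mult_le_mono) auto
  have "l \<le> k * l" "d \<le> k * d" using nk by auto
  then have lw: "l < wlim w" and dw: "d < wlim w" using w by linarith+
  have c: "1024 < wlim w" "2 \<le> 512 * (k * d)" "32 \<le> 32 * (k * d)" "2 * (512 * (k * d)) < wlim w"
    "16 * (32 * (k * d)) < wlim w" using w kd by linarith+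
  note sr = same_regs_def
  define X where "X = 12 * (512 * (k * d) * floorlog 2 (512 * (k * d)))"
  have A: "runs w (count_digits (WConst 2)) s (\<lambda>t s'. wreg s' 5 = l \<and>
    t \<le> 15 * l + 10 \<and> same_regs {5,6} s s' \<and>
    wmem s' = wmem s \<and> rreg s' = rreg s \<and> rmem s' = rmem s)"
    by (rule runs_mono[OF runs_count_digits[where b=2]]) (use c(1) lw nk in \<open>auto simp: l_def\<close>)
  show ?thesis
    unfolding prepare_def
  proof (rule runs_SeqI[OF A], goal_cases)
    case s1: (1 t1 s1)
    have r1: "wreg s1 5 = l" "wreg s1 0 = n" "wreg s1 1 = k" using s1 nk by (auto simp: sr)
    let ?s2 = "s1\<lparr>wreg := (wreg s1)(7 := k * l)\<rparr>"
    have B: "runs w (count_digits (WReg 7)) ?s2 (\<lambda>t s'. wreg s' 5 = d \<and>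
      t \<le> 15 * d + 10 \<and> same_regs {5,6} ?s2 s' \<and>
      wmem s' = wmem ?s2 \<and> rreg s' = rreg ?s2 \<and> rmem s' = rmem ?s2)"
      by (rule runs_mono[OF runs_count_digits[where b="k * l"]])
        (use c(1) dw r1 b in \<open>auto simp: d_def l_def num_digits_def\<close>)
    have C: "runs w (WAssign 7 (WMul (WReg 1) (WReg 5))) s1 (\<lambda>t s'. t = 4 \<and> s' = ?s2)"
      using r1 w by simp
    show ?case
    proof (rule runs_SeqI[OF C], goal_cases)
      case s2: (1 t2 s2)
      then have "s2 = ?s2" by simp
      show ?case
        unfolding \<open>s2 = ?s2\<close>
      proof (rule runs_SeqI[OF B], goal_cases)
        case s3: (1 t3 s3)
        have r3: "wreg s3 5 = d" "wreg s3 0 = n" "wreg s3 1 = k"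
          using s3 r1 by (auto simp: sr)
        let ?s4 = "s3\<lparr>wreg := (wreg s3)(4 := 32 * (k * d), 8 := 512 * (k * d))\<rparr>"
        have D: "runs w sieve ?s4 (\<lambda>t s'. t \<le> X + 20 * (512 * (k * d)) + 10
          \<and> same_regs {6, 9} ?s4 s' \<and>
          (\<forall>b. b \<noteq> 2 \<longrightarrow> wmem s' b = wmem ?s4 b) \<and> rreg s' = rreg ?s4 \<and> rmem s' = rmem ?s4 \<and>
          (\<forall>y<512 * (k * d). wmem s' 2 y \<noteq> 0 \<longleftrightarrow> (\<exists>p\<ge>2. \<exists>c\<ge>2. y = c * p)))"
          unfolding X_def by (rule runs_sieve) (use c clean s1 s3 in \<open>simp_all (no_asm_simp)\<close>)
        have E: "runs w (WAssign 4 (WMul (WConst 32) (WMul (WReg 1) (WReg 5)))) s3 (\<lambda>t s'. t = 6 \<and>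
            s' = s3\<lparr>wreg := (wreg s3)(4 := 32 * (k * d))\<rparr>)"
          using r3 w c(1) by simp
        show ?case
        proof (rule runs_SeqI[OF E], goal_cases)
          case s4: (1 t4 s4)
          have F: "runs w (WAssign 8 (WMul (WConst 16) (WReg 4))) s4 (\<lambda>t s'. t = 4 \<and> s' = ?s4)"
            using r3 s4 w c(1,5) by simp
          show ?case
          proof (rule runs_SeqI[OF F], goal_cases)
            case s5: (1 t5 s5)
            then have "s5 = ?s4" by simp
            show ?case unfolding \<open>s5 = ?s4\<close>
            proof (rule runs_SeqI[OF D], goal_cases)
              case s6: (1 t6 s6)
              have G: "runs w find_unmarked s6 (\<lambda>t s'. t \<le> 9 * (16 * (32 * (k * d))) + 10 \<and>
                same_regs {4} s6 s' \<and> wreg s' 4 = least_prime_from (32 * (k * d)) \<and>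
                wmem s' = wmem s6 \<and> rreg s' = rreg s6 \<and> rmem s' = rmem s6)"
              proof (rule runs_find_unmarked)
                show "wreg s6 4 = 32 * (k * d)" using s6 by (simp add: sr)
                show "\<forall>y<16 * (32 * (k * d)). (wmem s6 2 y \<noteq> 0) = (\<exists>p\<ge>2. \<exists>c\<ge>2. y = c * p)"
                  using s6 by simp
              qed (use c in \<open>simp_all (no_asm_simp)\<close>)
              show ?case
              proof (rule runs_mono[OF G], goal_cases)
                case s7: (1 t7 s7)
                have "wreg s7 r = wreg s r" if "r \<notin> {4,5,6,7,8,9}" for r
                  using s7 s6 s3 s1 that by (simp add: sr)
                moreover have "t1 + (t2 + (t3 + (t4 + (t5 + (t6 + t7))))) \<le>
                    15 * l + 15 * d + X + 40 * (512 * (k * d)) + 100"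
                  using s1 s2 s3 s4 s5 s6 s7 by linarith
                moreover have "wreg s7 4 = field_size n k" using s7 by (simp add: field_size_def d_def)
                moreover have "\<forall>b. b \<noteq> 2 \<longrightarrow> wmem s7 b = wmem s b" "rreg s7 = rreg s" "rmem s7 = rmem s"
                  using s1 s3 s6 s7 by auto
                ultimately show ?case unfolding X_def by (simp add: sr)
              qed
            qed
          qed
        qed
      qed
    qed
  qed
qed

subsection \<open>Median estimates\<close>

definition eval_digits :: com where
  "eval_digits =
    WAssign 12 (WConst 0) ;; WAssign 13 (WConst 1) ;; WAssign 14 (WReg 10) ;;
    While (WLess (WConst 0) (WReg 14))
      (WAssign 12 (WMod (WAdd (WReg 12) (WMul (WMod (WReg 14) (WReg 4)) (WReg 13))) (WReg 4)) ;;
       WAssign 13 (WMod (WMul (WReg 13) (WReg 11)) (WReg 4)) ;;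
       WAssign 14 (WDiv (WReg 14) (WReg 4)))"

text \<open>The digits come out lowest first, so register 13 carries the running power of
  \<open>a\<close>. Accumulator plus power times the value of the unread digits stays congruent to
  the result.\<close>

lemma runs_eval_digits:
  assumes r: "wreg s 4 = q" "wreg s 10 = j" "wreg s 11 = a" and q: "1 < q" "q * q < wlim w" and a: "a < q"
  shows "runs w eval_digits s (\<lambda>t s'. t \<le> 30 * floorlog q j + 20 \<and> same_regs {12,13,14} s s' \<and>
    wreg s' 12 = digit_eval q a j mod q \<and> wmem s' = wmem s \<and> rreg s' = rreg s \<and> rmem s' = rmem s)"
proof -
  define J where "J s' \<longleftrightarrow> same_regs {12,13,14} s s' \<and> wreg s' 12 < q \<and> wreg s' 13 < q \<and>
    (wreg s' 12 + wreg s' 13 * digit_eval q a (wreg s' 14)) mod q = digit_eval q a j mod q \<and>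
    wmem s' = wmem s \<and> rreg s' = rreg s \<and> rmem s' = rmem s" for s'
  define \<Phi> where "\<Phi> s' = floorlog q (wreg s' 14) * 30" for s' :: state
  have "q < q * q" using q by simp
  then have qw: "q < wlim w" using q by linarith
  let ?s0 = "s\<lparr>wreg := (wreg s)(12 := 0, 13 := 1, 14 := j)\<rparr>"
  have init: "J ?s0" using q r by (auto simp: J_def same_regs_def)
  let ?body = "WAssign 12 (WMod (WAdd (WReg 12) (WMul (WMod (WReg 14) (WReg 4)) (WReg 13))) (WReg 4)) ;;
       WAssign 13 (WMod (WMul (WReg 13) (WReg 11)) (WReg 4)) ;;
       WAssign 14 (WDiv (WReg 14) (WReg 4))"
  have step: "runs w ?body s'
      (\<lambda>t s''. J s'' \<and> t + 1 + bcost (WLess (WConst 0) (WReg 14)) + \<Phi> s'' \<le> \<Phi> s')"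
    if J: "J s'" and b: "bval w (WLess (WConst 0) (WReg 14)) s'" for s'
  proof -
    define u v x where "u = wreg s' 12" "v = wreg s' 13" "x = wreg s' 14"
    note uvx = this
    have rr: "wreg s' 4 = q" "wreg s' 11 = a" using J r by (auto simp: J_def same_regs_def)
    have lt: "u < q" "v < q" "x > 0" using J b qw by (auto simp: J_def uvx)
    \<comment> \<open>Reduced operands keep the largest intermediate value at (q - 1) + (q - 1)^2 <
      q^2, so words that hold \<open>q * q\<close> are wide enough.\<close>
    have "x mod q \<le> q - 1" "v \<le> q - 1" "u \<le> q - 1" using lt q mod_less_divisor[of q x] by linarith+
    then have "u + (x mod q) * v \<le> (q - 1) + (q - 1) * (q - 1)" by (intro add_mono mult_mono) auto
    also have "\<dots> = (q - 1) * q" using q by (cases q) auto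
    also have "\<dots> < q * q" using q by simp
    finally have b1: "u + (x mod q) * v < wlim w" using q by simp
    have "v * a \<le> q * q" using lt a by (intro mult_mono) auto
    then have b2: "v * a < wlim w" using q by simp
    have J': "J (s'\<lparr>wreg := (wreg s')(12 := (u + (x mod q) * v) mod q, 13 := v * a mod q, 14 := x div q)\<rparr>)"
    proof -
      have "((u + (x mod q) * v) mod q + v * a mod q * digit_eval q a (x div q)) mod q
          = (u + (x mod q) * v + v * a * digit_eval q a (x div q)) mod q"
        by (metis mod_add_left_eq mod_add_right_eq mod_mult_left_eq)
      also have "u + (x mod q) * v + v * a * digit_eval q a (x div q) = u + v * digit_eval q a x"
        using lt q by (subst (2) digit_eval.simps) (simp add: algebra_simps)
      also have "\<dots> mod q = digit_eval q a j mod q" using J by (simp add: J_def uvx)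
      finally show ?thesis using J q by (simp add: J_def same_regs_def)
    qed
    have f: "floorlog q x = Suc (floorlog q (x div q))" using lt q by (simp add: floorlog_step)
    have "(x mod q) * v < wlim w" using b1 by simp
    then show ?thesis using J' f b1 b2 rr q qw
      by (simp add: uvx[symmetric] \<Phi>_def)
  qed
  have loop: "runs w (While (WLess (WConst 0) (WReg 14)) ?body) ?s0 (\<lambda>t s'. t \<le> 30 * floorlog q j + 10 \<and>
    same_regs {12,13,14} s s' \<and> wreg s' 12 = digit_eval q a j mod q \<and>
    wmem s' = wmem s \<and> rreg s' = rreg s \<and> rmem s' = rmem s)"
  proof (rule runs_mono[OF runs_While[of J _ _ _ _ \<Phi>, OF init step]], goal_cases)
    case (3 t s')
    then have "wreg s' 14 = 0" using qw by auto
    then show ?case using 3 by (auto simp: J_def \<Phi>_def digit_eval.simps[of q a 0])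
  qed
  show ?thesis unfolding eval_digits_def using runs_mono[OF loop] r qw q by simp
qed

section \<open>Tournament trees\<close>

definition win :: "(nat \<Rightarrow> real) \<Rightarrow> nat \<Rightarrow> nat \<Rightarrow> nat" where
  "win V l r = (if 0 < r \<and> \<not> (0 < l \<and> \<not> V r < V l) then r else l)"

text \<open>Tournament tree in heap layout: node \<open>z\<close> has children \<open>2 z\<close> and \<open>2 z + 1\<close>, the leaves are
  \<open>q, \<dots>, 2 q - 1\<close> (\<open>q\<close> need not be a power of two), \<open>tr z\<close> is the winning leaf below \<open>z\<close>, and \<open>0\<close>
  says that all leaves there have been removed.\<close>

definition node_ok :: "(nat \<Rightarrow> real) \<Rightarrow> (nat \<Rightarrow> nat) \<Rightarrow> nat \<Rightarrow> bool" where
  "node_ok V tr z \<longleftrightarrow> tr z = win V (tr (2 * z)) (tr (2 * z + 1))"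

text \<open>Passing from children to parents, by induction on \<open>2 * q - x\<close>, every entry
  is zero or a surviving leaf; along the path \<open>x div 2\<close> to the root the winning value
  can only decrease. Neither argument needs a balanced tree.\<close>

lemma tournament_root:
  assumes ok: "\<And>z. 1 \<le> z \<Longrightarrow> z < q \<Longrightarrow> node_ok V tr z"
    and leaf: "\<And>y. q \<le> y \<Longrightarrow> y < 2 * q \<Longrightarrow> tr y = 0 \<or> tr y = y" and q: "1 \<le> q"
  shows "tr 1 = 0 \<or> q \<le> tr 1 \<and> tr 1 < 2 * q \<and> tr (tr 1) = tr 1"
    and "\<And>y. q \<le> y \<Longrightarrow> y < 2 * q \<Longrightarrow> tr y = y \<Longrightarrow> tr 1 \<noteq> 0 \<and> V (tr 1) \<le> V y"
proof -
  have "tr x = 0 \<or> q \<le> tr x \<and> tr x < 2 * q \<and> tr (tr x) = tr x" if "1 \<le> x" "x < 2 * q" for x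
    using that
  proof (induction "2 * q - x" arbitrary: x rule: less_induct)
    case less
    show ?case
    proof (cases "x < q")
      case True
      have "tr x = tr (2 * x) \<or> tr x = tr (2 * x + 1)"
        using ok[OF less.prems(1) True] by (auto simp: node_ok_def win_def)
      moreover have "2 * q - 2 * x < 2 * q - x" "2 * q - (2 * x + 1) < 2 * q - x"
        using less.prems True by auto
      ultimately show ?thesis using less.hyps[of "2 * x"] less.hyps[of "2 * x + 1"] less.prems True
        by fastforce
    next
      case False
      then show ?thesis using leaf[of x] less.prems by fastforce
    qed
  qed
  then show "tr 1 = 0 \<or> q \<le> tr 1 \<and> tr 1 < 2 * q \<and> tr (tr 1) = tr 1" using q by simp
  have up: "tr 1 \<noteq> 0 \<and> V (tr 1) \<le> V (tr x)" if "1 \<le> x" "x < 2 * q" "tr x \<noteq> 0" for x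
    using that
  proof (induction x rule: less_induct)
    case (less x)
    show ?case
    proof (cases "x = 1")
      case False
      define z where "z = x div 2"
      have z: "1 \<le> z" "z < q" "z < x" using less.prems False by (auto simp: z_def)
      have "x = 2 * z \<or> x = 2 * z + 1" unfolding z_def by presburger
      then have "tr z \<noteq> 0 \<and> V (tr z) \<le> V (tr x)"
        using ok[OF z(1,2)] less.prems by (auto simp: node_ok_def win_def)
      then show ?thesis using less.IH[OF z(3)] z by fastforce
    qed (use less.prems in simp)
  qed
  show "tr 1 \<noteq> 0 \<and> V (tr 1) \<le> V y" if "q \<le> y" "y < 2 * q" "tr y = y" for y
    using up[of y] that q by simp
qed

text \<open>Boolean expressions offer only negation and conjunction, which explains the shape of the
  guard and of \<open>win\<close>.\<close>

definition store_winner :: "wexp \<Rightarrow> wexp \<Rightarrow> com" where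
  "store_winner l r =
    Cond (BAnd (WLess (WConst 0) r)
           (BNot (BAnd (WLess (WConst 0) l) (BNot (RLess (RLoad 2 r) (RLoad 2 l))))))
      (WStore 3 (WReg 15) r) (WStore 3 (WReg 15) l)"

lemma runs_store_winner:
  assumes "wval w l s = u" "wval w r s = v" "0 < wlim w"
  shows "runs w (store_winner l r) s (\<lambda>t s'. t \<le> 20 + 3 * wcost l + 4 * wcost r \<and>
    s' = s\<lparr>wmem := (wmem s)(3 := (wmem s 3)(wreg s 15 := win (rmem s 2) u v))\<rparr>)"
  using assms by (simp add: store_winner_def win_def)

definition update_node :: com where
  "update_node = store_winner (WLoad 3 (WMul (WConst 2) (WReg 15)))
    (WLoad 3 (WAdd (WMul (WConst 2) (WReg 15)) (WConst 1)))"

lemma runs_update_node: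
  assumes "wreg s 15 = x" "2 * x + 1 < wlim w" "2 < wlim w"
  shows "runs w update_node s (\<lambda>t s'. t \<le> 60 \<and>
    s' = s\<lparr>wmem := (wmem s)(3 := (wmem s 3)(x := win (rmem s 2) (wmem s 3 (2 * x)) (wmem s 3 (2 * x + 1))))\<rparr>)"
proof -
  have m: "2 * x < wlim w" using assms by linarith
  have l: "wval w (WLoad 3 (WMul (WConst 2) (WReg 15))) s = wmem s 3 (2 * x)"
    using m assms(1,3) by simp
  have r: "wval w (WLoad 3 (WAdd (WMul (WConst 2) (WReg 15)) (WConst 1))) s = wmem s 3 (2 * x + 1)"
    using m assms by simp
  have "0 < wlim w" using assms(3) by simp
  note W = runs_store_winner[OF l r this]
  show ?thesis
    unfolding update_node_def
  proof (rule runs_mono[OF W], goal_cases)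
    case (1 t s')
    from conjunct1[OF 1] have "t \<le> 60" by simp
    then show ?case using conjunct2[OF 1] unfolding assms(1) by (rule conjI)
  qed
qed

text \<open>Recomputing node \<open>x\<close> mends it, and the only other equation that mentions
  its entry is that of the parent.\<close>

lemma node_ok_update:
  assumes "x \<ge> 1" "\<And>z. 1 \<le> z \<Longrightarrow> z < q \<Longrightarrow> z \<noteq> x \<Longrightarrow> node_ok V tr z"
    and "1 \<le> z" "z < q" "z \<noteq> x div 2"
  shows "node_ok V (tr(x := win V (tr (2 * x)) (tr (2 * x + 1)))) z"
proof (cases "z = x")
  case True
  then show ?thesis using assms(1) unfolding node_ok_def by simp
next
  case False
  have "2 * z \<noteq> x" "2 * z + 1 \<noteq> x" using assms(5) by auto
  then show ?thesis using False assms(2)[OF assms(3,4) False] unfolding node_ok_def by simp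
qed

definition repair :: com where
  "repair = While (WLess (WConst 0) (WReg 15)) (update_node ;; WAssign 15 (WDiv (WReg 15) (WConst 2)))"

text \<open>The single possible fault sits at the node in register 15 and moves to the parent in
  each round. It disappears at 0, which is no node.\<close>

lemma runs_repair:
  assumes x: "wreg s 15 < q" and w: "2 * q < wlim w"
    and ok: "\<And>z. 1 \<le> z \<Longrightarrow> z < q \<Longrightarrow> z \<noteq> wreg s 15 \<Longrightarrow> node_ok (rmem s 2) (wmem s 3) z"
  shows "runs w repair s (\<lambda>t s'. t \<le> 70 * floorlog 2 (wreg s 15) + 10 \<and> same_regs {15} s s' \<and>
    (\<forall>z. 1 \<le> z \<longrightarrow> z < q \<longrightarrow> node_ok (rmem s 2) (wmem s' 3) z) \<and>
    (\<forall>y\<ge>q. wmem s' 3 y = wmem s 3 y) \<and> (\<forall>b. b \<noteq> 3 \<longrightarrow> wmem s' b = wmem s b) \<and>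
    rreg s' = rreg s \<and> rmem s' = rmem s)"
proof -
  define V where "V = rmem s 2"
  define J where "J s' \<longleftrightarrow> same_regs {15} s s' \<and> wreg s' 15 < q \<and>
    (\<forall>z. 1 \<le> z \<longrightarrow> z < q \<longrightarrow> z \<noteq> wreg s' 15 \<longrightarrow> node_ok V (wmem s' 3) z) \<and>
    (\<forall>y\<ge>q. wmem s' 3 y = wmem s 3 y) \<and> (\<forall>b. b \<noteq> 3 \<longrightarrow> wmem s' b = wmem s b) \<and>
    rreg s' = rreg s \<and> rmem s' = rmem s" for s'
  define \<Phi> where "\<Phi> s' = 70 * floorlog 2 (wreg s' 15)" for s' :: state
  have w2: "2 < wlim w" if "1 < q" using w that by simp
  have w0: "0 < wlim w" using w by simp
  have init: "J s" using x ok by (auto simp: J_def V_def same_regs_def)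
  have step: "runs w (update_node ;; WAssign 15 (WDiv (WReg 15) (WConst 2))) s'
      (\<lambda>t s''. J s'' \<and> t + 1 + bcost (WLess (WConst 0) (WReg 15)) + \<Phi> s'' \<le> \<Phi> s')"
    if J: "J s'" and b: "bval w (WLess (WConst 0) (WReg 15)) s'" for s'
  proof -
    define x where "x = wreg s' 15"
    have x: "1 \<le> x" "x < q" using J b w0 by (auto simp: J_def x_def)
    have w3: "2 < wlim w" "2 * x + 1 < wlim w" using x w by linarith+
    have V: "rmem s' 2 = V" using J by (simp add: J_def V_def)
    define tr where "tr = (wmem s' 3)(x := win V (wmem s' 3 (2 * x)) (wmem s' 3 (2 * x + 1)))"
    let ?s = "s'\<lparr>wmem := (wmem s')(3 := tr)\<rparr>"
    have U: "runs w update_node s' (\<lambda>t s''. t \<le> 60 \<and> s'' = ?s)"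
      unfolding tr_def V[symmetric] by (rule runs_update_node) (use w3 in \<open>auto simp: x_def\<close>)
    have ok: "node_ok V tr z" if "1 \<le> z" "z < q" "z \<noteq> x div 2" for z
      unfolding tr_def by (rule node_ok_update[of x q]) (use J x that in \<open>auto simp: J_def x_def\<close>)
    have J': "J (?s\<lparr>wreg := (wreg s')(15 := x div 2)\<rparr>)"
      using J ok x by (auto simp: J_def same_regs_def tr_def)
    have "floorlog 2 x = Suc (floorlog 2 (x div 2))" using x by (simp add: floorlog_step)
    then show ?thesis
      by (intro runs_SeqI[OF U]) (use J' w3 in \<open>auto simp: x_def[symmetric] \<Phi>_def\<close>)
  qed
  show ?thesis
    unfolding repair_def
  proof (rule runs_mono[OF runs_While[of J _ _ _ _ \<Phi>, OF init step]], goal_cases)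
    case (3 t s')
    then have "wreg s' 15 = 0" using w0 by auto
    then show ?case using 3 by (auto simp: J_def \<Phi>_def V_def)
  qed
qed

definition build_tree :: com where
  "build_tree = WAssign 15 (WSub (WReg 4) (WConst 1)) ;;
    While (WLess (WConst 0) (WReg 15)) (update_node ;; WAssign 15 (WSub (WReg 15) (WConst 1)))"

lemma runs_build_tree:
  assumes q: "wreg s 4 = q" "1 < q" and w: "2 * q < wlim w"
  shows "runs w build_tree s (\<lambda>t s'. t \<le> 70 * q + 20 \<and> same_regs {15} s s' \<and>
    (\<forall>z. 1 \<le> z \<longrightarrow> z < q \<longrightarrow> node_ok (rmem s 2) (wmem s' 3) z) \<and>
    (\<forall>y\<ge>q. wmem s' 3 y = wmem s 3 y) \<and> (\<forall>b. b \<noteq> 3 \<longrightarrow> wmem s' b = wmem s b) \<and>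
    rreg s' = rreg s \<and> rmem s' = rmem s)"
proof -
  define V where "V = rmem s 2"
  define J where "J s' \<longleftrightarrow> same_regs {15} s s' \<and> wreg s' 15 < q \<and>
    (\<forall>z. wreg s' 15 < z \<longrightarrow> z < q \<longrightarrow> node_ok V (wmem s' 3) z) \<and>
    (\<forall>y\<ge>q. wmem s' 3 y = wmem s 3 y) \<and> (\<forall>b. b \<noteq> 3 \<longrightarrow> wmem s' b = wmem s b) \<and>
    rreg s' = rreg s \<and> rmem s' = rmem s" for s'
  define \<Phi> where "\<Phi> s' = 70 * wreg s' 15" for s' :: state
  have w0: "0 < wlim w" "1 < wlim w" "2 < wlim w" "q < wlim w" using w q by linarith+
  let ?s0 = "s\<lparr>wreg := (wreg s)(15 := q - 1)\<rparr>"
  have init: "J ?s0" using q by (auto simp: J_def V_def same_regs_def)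
  have step: "runs w (update_node ;; WAssign 15 (WSub (WReg 15) (WConst 1))) s'
      (\<lambda>t s''. J s'' \<and> t + 1 + bcost (WLess (WConst 0) (WReg 15)) + \<Phi> s'' \<le> \<Phi> s')"
    if J: "J s'" and b: "bval w (WLess (WConst 0) (WReg 15)) s'" for s'
  proof -
    define x where "x = wreg s' 15"
    have x: "1 \<le> x" "x < q" using J b w0 by (auto simp: J_def x_def)
    have w3: "2 < wlim w" "2 * x + 1 < wlim w" "x < wlim w" "1 < wlim w" using x w by linarith+
    have V: "rmem s' 2 = V" using J by (simp add: J_def V_def)
    define tr where "tr = (wmem s' 3)(x := win V (wmem s' 3 (2 * x)) (wmem s' 3 (2 * x + 1)))"
    let ?s = "s'\<lparr>wmem := (wmem s')(3 := tr)\<rparr>"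
    have U: "runs w update_node s' (\<lambda>t s''. t \<le> 60 \<and> s'' = ?s)"
      unfolding tr_def V[symmetric] by (rule runs_update_node) (use w3 in \<open>auto simp: x_def\<close>)
    have ok: "node_ok V tr z" if "x - 1 < z" "z < q" for z
    proof (cases "z = x")
      case True
      then show ?thesis using x by (simp add: node_ok_def tr_def)
    next
      case False
      then have "node_ok V (wmem s' 3) z" using that J by (simp add: J_def x_def)
      \<comment> \<open>Overwriting node \<open>x\<close> disturbs at most its parent, whose turn
        comes later because the nodes are visited in descending order.\<close>
      moreover have "2 * z \<noteq> x" "2 * z + 1 \<noteq> x" using x that False by linarith+
      ultimately show ?thesis using False unfolding node_ok_def tr_def by simp
    qed
    have J': "J (?s\<lparr>wreg := (wreg s')(15 := x - 1)\<rparr>)"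
      using J ok x by (auto simp: J_def same_regs_def tr_def)
    show ?thesis
      by (intro runs_SeqI[OF U]) (use J' w3 x in \<open>auto simp: x_def[symmetric] \<Phi>_def\<close>)
  qed
  have loop: "runs w (While (WLess (WConst 0) (WReg 15)) (update_node ;; WAssign 15 (WSub (WReg 15) (WConst 1)))) ?s0
    (\<lambda>t s'. t \<le> 70 * q + 10 \<and> same_regs {15} s s' \<and>
    (\<forall>z. 1 \<le> z \<longrightarrow> z < q \<longrightarrow> node_ok (rmem s 2) (wmem s' 3) z) \<and>
    (\<forall>y\<ge>q. wmem s' 3 y = wmem s 3 y) \<and> (\<forall>b. b \<noteq> 3 \<longrightarrow> wmem s' b = wmem s b) \<and>
    rreg s' = rreg s \<and> rmem s' = rmem s)"
  proof (rule runs_mono[OF runs_While[of J _ _ _ _ \<Phi>, OF init step]], goal_cases)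
    case (3 t s')
    then have "wreg s' 15 = 0" using w0 by auto
    then show ?case using 3 by (auto simp: J_def \<Phi>_def V_def)
  qed
  show ?thesis unfolding build_tree_def using runs_mono[OF loop] w0 q by simp
qed

definition gather :: com where
  "gather = WAssign 11 (WConst 0) ;;
    While (WLess (WReg 11) (WReg 4))
      (eval_digits ;;
       RStore 2 (WAdd (WReg 4) (WReg 11)) (RLoad 0 (WAdd (WMul (WReg 11) (WReg 4)) (WReg 12))) ;;
       WStore 3 (WAdd (WReg 4) (WReg 11)) (WAdd (WReg 4) (WReg 11)) ;;
       WAssign 11 (WAdd (WReg 11) (WConst 1)))"

lemma runs_gather:
  assumes r: "wreg s 4 = q" "wreg s 10 = j" and q: "1 < q" "q * q < wlim w"
  shows "runs w gather s (\<lambda>t s'. t \<le> q * (30 * floorlog q j + 60) + 10 \<and> same_regs {11,12,13,14} s s' \<and>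
    (\<forall>a<q. rmem s' 2 (q + a) = rmem s 0 (a * q + digit_eval q a j mod q) \<and> wmem s' 3 (q + a) = q + a) \<and>
    (\<forall>b. b \<noteq> 3 \<longrightarrow> wmem s' b = wmem s b) \<and> (\<forall>b. b \<noteq> 2 \<longrightarrow> rmem s' b = rmem s b) \<and> rreg s' = rreg s)"
proof -
  define J where "J s' \<longleftrightarrow> same_regs {11,12,13,14} s s' \<and> wreg s' 11 \<le> q \<and>
    (\<forall>a<wreg s' 11. rmem s' 2 (q + a) = rmem s 0 (a * q + digit_eval q a j mod q) \<and> wmem s' 3 (q + a) = q + a) \<and>
    (\<forall>b. b \<noteq> 3 \<longrightarrow> wmem s' b = wmem s b) \<and> (\<forall>b. b \<noteq> 2 \<longrightarrow> rmem s' b = rmem s b) \<and> rreg s' = rreg s" for s'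
  define \<Phi> where "\<Phi> s' = (q - wreg s' 11) * (30 * floorlog q j + 60)" for s' :: state
  have "2 * q \<le> q * q" using q by (intro mult_right_mono) auto
  then have w0: "0 < wlim w" "1 < wlim w" "2 * q < wlim w" using q by linarith+
  let ?s0 = "s\<lparr>wreg := (wreg s)(11 := 0)\<rparr>"
  have init: "J ?s0" by (auto simp: J_def same_regs_def)
  let ?rest = "RStore 2 (WAdd (WReg 4) (WReg 11)) (RLoad 0 (WAdd (WMul (WReg 11) (WReg 4)) (WReg 12))) ;;
       WStore 3 (WAdd (WReg 4) (WReg 11)) (WAdd (WReg 4) (WReg 11)) ;;
       WAssign 11 (WAdd (WReg 11) (WConst 1))"
  have step: "runs w (eval_digits ;; ?rest) s'
      (\<lambda>t s''. J s'' \<and> t + 1 + bcost (WLess (WReg 11) (WReg 4)) + \<Phi> s'' \<le> \<Phi> s')"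
    if J: "J s'" and b: "bval w (WLess (WReg 11) (WReg 4)) s'" for s'
  proof -
    define a where "a = wreg s' 11"
    have rr: "wreg s' 4 = q" "wreg s' 10 = j" "wreg s' 11 = a"
      using J r by (auto simp: J_def same_regs_def a_def)
    have a: "a < q" using b rr by simp
    have E: "runs w eval_digits s' (\<lambda>t s''. t \<le> 30 * floorlog q j + 20 \<and> same_regs {12,13,14} s' s'' \<and>
      wreg s'' 12 = digit_eval q a j mod q \<and> wmem s'' = wmem s' \<and> rreg s'' = rreg s' \<and> rmem s'' = rmem s')"
      by (rule runs_eval_digits[OF rr q a])
    have \<Phi>': "\<Phi> s' = (30 * floorlog q j + 60) + (q - Suc a) * (30 * floorlog q j + 60)"
    proof -
      have "q - a = Suc (q - Suc a)" using a by simp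
      then show ?thesis by (simp only: \<Phi>_def rr mult_Suc)
    qed
    show ?thesis
    proof (rule runs_SeqI[OF E], goal_cases)
      case (1 t s1)
      define v where "v = digit_eval q a j mod q"
      have r1: "wreg s1 4 = q" "wreg s1 11 = a" "wreg s1 12 = v"
        using 1 rr by (auto simp: same_regs_def v_def)
      have v: "v < q" using q by (simp add: v_def)
      have "a * q + v < q * q"
      proof -
        have "a * q + v < Suc a * q" using v by simp
        also have "\<dots> \<le> q * q" using a by (intro mult_right_mono) auto
        finally show ?thesis .
      qed
      then have w1: "a * q + v < wlim w" "a * q < wlim w" "q + a < wlim w" "a + 1 < wlim w"
        using q w0 a by linarith+
      let ?s = "s1\<lparr>rmem := (rmem s1)(2 := (rmem s1 2)(q + a := rmem s1 0 (a * q + v))),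
        wmem := (wmem s1)(3 := (wmem s1 3)(q + a := q + a)), wreg := (wreg s1)(11 := Suc a)\<rparr>"
      have "J ?s"
        unfolding J_def
      proof (intro conjI allI impI)
        fix c assume "c < wreg ?s 11"
        then consider "c < a" | "c = a" by fastforce
        then show "rmem ?s 2 (q + c) = rmem s 0 (c * q + digit_eval q c j mod q)" "wmem ?s 3 (q + c) = q + c"
          by (cases; use J 1 rr in \<open>auto simp: J_def v_def\<close>)+
      qed (use J 1 a in \<open>auto simp: J_def same_regs_def\<close>)
      then show ?case using 1 r1 w1 w0 \<Phi>' by (simp add: \<Phi>_def)
    qed
  qed
  have loop: "runs w (While (WLess (WReg 11) (WReg 4)) (eval_digits ;; ?rest)) ?s0
    (\<lambda>t s'. t \<le> q * (30 * floorlog q j + 60) + 5 \<and> same_regs {11,12,13,14} s s' \<and>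
    (\<forall>a<q. rmem s' 2 (q + a) = rmem s 0 (a * q + digit_eval q a j mod q) \<and> wmem s' 3 (q + a) = q + a) \<and>
    (\<forall>b. b \<noteq> 3 \<longrightarrow> wmem s' b = wmem s b) \<and> (\<forall>b. b \<noteq> 2 \<longrightarrow> rmem s' b = rmem s b) \<and> rreg s' = rreg s)"
  proof (rule runs_mono[OF runs_While[of J _ _ _ _ \<Phi>, OF init step]], goal_cases)
    case (3 t s')
    then have "wreg s' 4 = q" using r by (auto simp: J_def same_regs_def)
    then have "wreg s' 11 = q" using 3 by (auto simp: J_def)
    then show ?case using 3 by (auto simp: J_def \<Phi>_def)
  qed
  show ?thesis unfolding gather_def using runs_mono[OF loop] w0 by simp
qed

definition extract_half :: com where
  "extract_half = WAssign 17 (WConst 0) ;;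
    While (WLess (WReg 17) (WDiv (WReg 4) (WConst 2)))
      (WAssign 15 (WLoad 3 (WConst 1)) ;; WStore 3 (WReg 15) (WConst 0) ;;
       WAssign 15 (WDiv (WReg 15) (WConst 2)) ;; repair ;; WAssign 17 (WAdd (WReg 17) (WConst 1))) ;;
    RAssign 1 (RLoad 2 (WLoad 3 (WConst 1)))"

text \<open>Minima are removed, so every removed value is at most every remaining one. After
  \<open>q div 2\<close> removals the root has \<open>q div 2 + 1\<close> values at or below it,
  counting itself, and \<open>q - q div 2\<close> at or above it; this is a median for either parity
  of \<open>q\<close>.\<close>

lemma runs_extract_half:
  assumes r: "wreg s 4 = q" and q: "1 < q" and w: "2 * q < wlim w"
    and ok: "\<And>z. 1 \<le> z \<Longrightarrow> z < q \<Longrightarrow> node_ok (rmem s 2) (wmem s 3) z"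
    and leaf: "\<And>a. a < q \<Longrightarrow> wmem s 3 (q + a) = q + a"
  shows "runs w extract_half s (\<lambda>t s'. t \<le> q * (70 * floorlog 2 q + 50) + 20 \<and> same_regs {15,17} s s' \<and>
    is_median q (\<lambda>a. rmem s 2 (q + a)) (rreg s' 1) \<and>
    (\<forall>b. b \<noteq> 3 \<longrightarrow> wmem s' b = wmem s b) \<and> rmem s' = rmem s \<and> (\<forall>r. r \<noteq> 1 \<longrightarrow> rreg s' r = rreg s r))"
proof -
  define V where "V = rmem s 2"
  define J where "J s' \<longleftrightarrow> same_regs {15,17} s s' \<and> wreg s' 17 \<le> q div 2 \<and>
    (\<forall>z. 1 \<le> z \<longrightarrow> z < q \<longrightarrow> node_ok V (wmem s' 3) z) \<and>
    (\<forall>a<q. wmem s' 3 (q + a) = 0 \<or> wmem s' 3 (q + a) = q + a) \<and>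
    card {a. a < q \<and> wmem s' 3 (q + a) = 0} = wreg s' 17 \<and>
    (\<forall>a<q. \<forall>c<q. wmem s' 3 (q + a) = 0 \<longrightarrow> wmem s' 3 (q + c) \<noteq> 0 \<longrightarrow> V (q + a) \<le> V (q + c)) \<and>
    (\<forall>b. b \<noteq> 3 \<longrightarrow> wmem s' b = wmem s b) \<and> rreg s' = rreg s \<and> rmem s' = rmem s" for s'
  define L where "L = 70 * floorlog 2 q + 50"
  define \<Phi> where "\<Phi> s' = (q - wreg s' 17) * L" for s' :: state
  have w0: "0 < wlim w" "1 < wlim w" "2 < wlim w" "q < wlim w" using w q by linarith+
  have root: "\<exists>a<q. wmem s' 3 1 = q + a \<and> wmem s' 3 (q + a) = q + a \<and>
      (\<forall>c<q. wmem s' 3 (q + c) \<noteq> 0 \<longrightarrow> V (q + a) \<le> V (q + c))" if J: "J s'" for s'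
  proof -
    let ?tr = "wmem s' 3"
    \<comment> \<open>Strictly fewer than \<open>q\<close> leaves are gone at any time, so some leaf
      survives and the root is never 0.\<close>
    have "card {a. a < q \<and> ?tr (q + a) = 0} \<le> q div 2" using J unfolding J_def by metis
    then have "card {a. a < q \<and> ?tr (q + a) = 0} \<noteq> card {..<q}" using q by simp
    then have "{a. a < q \<and> ?tr (q + a) = 0} \<noteq> {..<q}" by metis
    then obtain c where c: "c < q" "?tr (q + c) \<noteq> 0" by auto
    then have c': "?tr (q + c) = q + c" using J by (auto simp: J_def)
    have leaf': "?tr y = 0 \<or> ?tr y = y" if "q \<le> y" "y < 2 * q" for y
    proof -
      have "?tr (q + (y - q)) = 0 \<or> ?tr (q + (y - q)) = q + (y - q)"
        using J that unfolding J_def by (metis less_diff_conv2 mult_2)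
      then show ?thesis using that by simp
    qed
    have ok': "\<And>z. 1 \<le> z \<Longrightarrow> z < q \<Longrightarrow> node_ok V ?tr z" using J by (simp add: J_def)
    have lf: "\<forall>a<q. ?tr (q + a) = 0 \<or> ?tr (q + a) = q + a" using J unfolding J_def by (elim conjE)
    have q1: "1 \<le> q" using q by simp
    note T = tournament_root[of q V ?tr, OF ok' leaf' q1]
    have "?tr 1 \<noteq> 0" using T(2)[of "q + c"] c c' by simp
    then have m: "q \<le> ?tr 1" "?tr 1 < 2 * q" "?tr (?tr 1) = ?tr 1" using T(1) by auto
    have "V (?tr 1) \<le> V (q + e)" if "e < q" "?tr (q + e) \<noteq> 0" for e
    proof -
      have "?tr (q + e) = q + e" using lf[rule_format, OF that(1)] that(2) by argo
      then show ?thesis using T(2)[of "q + e"] that(1) by (simp only: le_add1 mult_2 nat_add_left_cancel_less)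
    qed
    then show ?thesis using m by (intro exI[of _ "?tr 1 - q"]) auto
  qed
  let ?s0 = "s\<lparr>wreg := (wreg s)(17 := 0)\<rparr>"
  have init: "J ?s0" using ok leaf q by (auto simp: J_def V_def same_regs_def)
  let ?body = "WAssign 15 (WLoad 3 (WConst 1)) ;; WStore 3 (WReg 15) (WConst 0) ;;
       WAssign 15 (WDiv (WReg 15) (WConst 2)) ;; repair ;; WAssign 17 (WAdd (WReg 17) (WConst 1))"
  let ?cond = "WLess (WReg 17) (WDiv (WReg 4) (WConst 2))"
  have step: "runs w ?body s' (\<lambda>t s''. J s'' \<and> t + 1 + bcost ?cond + \<Phi> s'' \<le> \<Phi> s')"
    if J: "J s'" and b: "bval w ?cond s'" for s'
  proof -
    define c where "c = wreg s' 17"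
    define tr where "tr = wmem s' 3"
    have r4: "wreg s' 4 = q" using J r by (simp add: J_def same_regs_def)
    have c: "c < q div 2" using b r4 w0 by (simp add: c_def)
    obtain a where a: "a < q" "tr 1 = q + a" "tr (q + a) = q + a"
      "\<And>e. e < q \<Longrightarrow> tr (q + e) \<noteq> 0 \<Longrightarrow> V (q + a) \<le> V (q + e)"
      using root[OF J] unfolding tr_def by blast
    \<comment> \<open>Only the equation at the parent of the removed leaf can become false, so the
      repair starts there.\<close>
    define x where "x = (q + a) div 2"
    have x: "x < q" using a by (simp add: x_def)
    let ?s1 = "s'\<lparr>wmem := (wmem s')(3 := tr(q + a := 0)), wreg := (wreg s')(15 := x)\<rparr>"
    have R: "runs w repair ?s1 (\<lambda>t s''. t \<le> 70 * floorlog 2 (wreg ?s1 15) + 10 \<and> same_regs {15} ?s1 s'' \<and>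
      (\<forall>z. 1 \<le> z \<longrightarrow> z < q \<longrightarrow> node_ok (rmem ?s1 2) (wmem s'' 3) z) \<and>
      (\<forall>y\<ge>q. wmem s'' 3 y = wmem ?s1 3 y) \<and> (\<forall>b. b \<noteq> 3 \<longrightarrow> wmem s'' b = wmem ?s1 b) \<and>
      rreg s'' = rreg ?s1 \<and> rmem s'' = rmem ?s1)"
    proof (rule runs_repair)
      fix z assume z: "1 \<le> z" "z < q" "z \<noteq> wreg ?s1 15"
      then have "node_ok V tr z" using J by (simp add: J_def tr_def)
      moreover have "2 * z \<noteq> q + a" "2 * z + 1 \<noteq> q + a" "z \<noteq> q + a" using z by (auto simp: x_def)
      ultimately show "node_ok (rmem ?s1 2) (wmem ?s1 3) z"
        using J by (simp add: node_ok_def J_def V_def)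
    qed (use x w in auto)
    have fl: "floorlog 2 x \<le> floorlog 2 q" by (rule floorlog_mono) (use x in simp)
    have \<Phi>': "\<Phi> s' = L + (q - Suc c) * L"
    proof -
      have "q - c = Suc (q - Suc c)" using c by simp
      then show ?thesis by (simp only: \<Phi>_def c_def[symmetric] mult_Suc)
    qed
    have R': "runs w (repair ;; WAssign 17 (WAdd (WReg 17) (WConst 1))) ?s1
      (\<lambda>t s''. J s'' \<and> t + 25 + \<Phi> s'' \<le> \<Phi> s')"
    proof (rule runs_SeqI[OF R], goal_cases)
      case (1 t s2)
      have r17: "wreg s2 17 = c" using 1 by (simp add: same_regs_def c_def)
      have tr2: "wmem s2 3 (q + e) = (if e = a then 0 else tr (q + e))" for e
        using 1 by simp
      let ?s = "s2\<lparr>wreg := (wreg s2)(17 := Suc c)\<rparr>"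
      have J': "J ?s"
        unfolding J_def
      proof (intro conjI allI impI)
        have "{e. e < q \<and> wmem ?s 3 (q + e) = 0} = insert a {e. e < q \<and> tr (q + e) = 0}"
          using a by (auto simp: tr2)
        moreover have "a \<notin> {e. e < q \<and> tr (q + e) = 0}" using a by simp
        moreover have "card {e. e < q \<and> tr (q + e) = 0} = c" using J by (simp add: J_def tr_def c_def)
        ultimately show "card {e. e < q \<and> wmem ?s 3 (q + e) = 0} = wreg ?s 17" by simp
      next
        fix e f assume ef: "e < q" "f < q" "wmem ?s 3 (q + e) = 0" "wmem ?s 3 (q + f) \<noteq> 0"
        then have f: "tr (q + f) \<noteq> 0" by (auto simp: tr2 split: if_splits)
        show "V (q + e) \<le> V (q + f)"
        proof (cases "e = a")
          case True
          then show ?thesis using a(4)[OF ef(2) f] by simp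
        next
          case False
          then have "tr (q + e) = 0" using ef by (simp add: tr2)
          then show ?thesis using J f ef(1,2) unfolding J_def tr_def by blast
        qed
      next
        fix e assume "e < q"
        then show "wmem ?s 3 (q + e) = 0 \<or> wmem ?s 3 (q + e) = q + e"
          using J by (auto simp: tr2 J_def tr_def)
      qed (use J 1 c in \<open>auto simp: J_def same_regs_def V_def\<close>)
      have "c + 1 < wlim w" using c w0 by linarith
      then show ?case using J' 1 r17 w0 fl \<Phi>' by (simp add: \<Phi>_def L_def)
    qed
    have "wmem s' 3 (Suc 0) = q + a" using a(2) by (simp add: tr_def)
    then show ?thesis
      using runs_mono[OF R', of "\<lambda>t s''. J s'' \<and> t + 25 + \<Phi> s'' \<le> \<Phi> s'"] w0
      by (simp add: tr_def[symmetric] x_def[symmetric]) (erule runs_mono, simp)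
  qed
  have loop: "runs w (While ?cond ?body) ?s0 (\<lambda>t s'. J s' \<and> wreg s' 17 = q div 2 \<and> t \<le> q * L + 10)"
  proof (rule runs_mono[OF runs_While[of J _ _ _ _ \<Phi>, OF init step]], goal_cases)
    case (3 t s')
    have "wreg s' 4 = q" using 3 r by (auto simp: J_def same_regs_def)
    then have "wreg s' 17 = q div 2" using 3 w0 by (auto simp: J_def)
    then show ?case using 3 by (auto simp: \<Phi>_def)
  qed
  have fin: "runs w (While ?cond ?body ;; RAssign 1 (RLoad 2 (WLoad 3 (WConst 1)))) ?s0
     (\<lambda>t s'. t \<le> q * L + 15 \<and> same_regs {15,17} s s' \<and>
    is_median q (\<lambda>a. rmem s 2 (q + a)) (rreg s' 1) \<and>
    (\<forall>b. b \<noteq> 3 \<longrightarrow> wmem s' b = wmem s b) \<and> rmem s' = rmem s \<and> (\<forall>r. r \<noteq> 1 \<longrightarrow> rreg s' r = rreg s r))"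
  proof (rule runs_SeqI[OF loop], goal_cases)
    case (1 t s')
    then have J: "J s'" by simp
    define tr where "tr = wmem s' 3"
    obtain a where a: "a < q" "tr 1 = q + a" "tr (q + a) = q + a"
      "\<And>e. e < q \<Longrightarrow> tr (q + e) \<noteq> 0 \<Longrightarrow> V (q + a) \<le> V (q + e)"
      using root[OF J] unfolding tr_def by blast
    let ?R = "{e. e < q \<and> tr (q + e) = 0}"
    have cR: "card ?R = q div 2" using 1 by (simp add: J_def tr_def)
    have "card (insert a ?R) \<le> card {e. e < q \<and> V (q + e) \<le> V (q + a)}"
    proof (rule card_mono)
      show "insert a ?R \<subseteq> {e. e < q \<and> V (q + e) \<le> V (q + a)}"
        using J a unfolding J_def tr_def by auto
    qed simp
    then have c1: "q div 2 + 1 \<le> card {e. e < q \<and> V (q + e) \<le> V (q + a)}"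
      using a cR by simp
    have "card ({..<q} - ?R) \<le> card {e. e < q \<and> V (q + a) \<le> V (q + e)}"
      by (rule card_mono) (use a(4) in auto)
    moreover have "card ({..<q} - ?R) = q - q div 2" using cR by (subst card_Diff_subset) auto
    ultimately have c2: "q - q div 2 \<le> card {e. e < q \<and> V (q + a) \<le> V (q + e)}" by simp
    have med: "is_median q (\<lambda>e. V (q + e)) (V (q + a))"
      unfolding is_median_def using c1 c2 by linarith
    have V: "rmem s' 2 = V" using J by (simp add: J_def V_def)
    have frame: "same_regs {15,17} s s'" "\<forall>b. b \<noteq> 3 \<longrightarrow> wmem s' b = wmem s b" "rmem s' = rmem s" "rreg s' = rreg s"
      using J by (auto simp: J_def)
    have "wmem s' 3 (Suc 0) = q + a" using a(2) by (simp add: tr_def)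
    moreover have "t \<le> q * L + 10" using 1 by simp
    ultimately show ?case using frame med w0(2) V by (simp add: V_def[symmetric] same_regs_def)
  qed
  have start: "runs w (WAssign 17 (WConst 0)) s (\<lambda>t s'. t = 2 \<and> s' = ?s0)" using w0 by simp
  show ?thesis
    unfolding extract_half_def
  proof (rule runs_SeqI[OF start], goal_cases)
    case (1 u s1)
    then have "u = 2" "s1 = ?s0" by auto
    show ?case
      unfolding \<open>s1 = ?s0\<close> \<open>u = 2\<close> by (rule runs_mono[OF fin]) (simp add: L_def)
  qed
qed

lemma is_median_cong:
  assumes "\<forall>a<q. f a = g a" and "is_median q f z"
  shows "is_median q g z"
proof -
  have "{a. a < q \<and> f a \<le> z} = {a. a < q \<and> g a \<le> z}" "{a. a < q \<and> z \<le> f a} = {a. a < q \<and> z \<le> g a}"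
    using assms(1) by auto
  then show ?thesis using assms(2) by (simp add: is_median_def)
qed

definition median_estimate :: com where
  "median_estimate = gather ;; build_tree ;; extract_half"

lemma runs_median_estimate:
  assumes r: "wreg s 4 = q" "wreg s 10 = j" and q: "1 < q" "q * q < wlim w"
  shows "runs w median_estimate s (\<lambda>t s'. t \<le> 300 * (q * (floorlog q j + floorlog 2 q)) \<and>
    same_regs {11,12,13,14,15,17} s s' \<and>
    is_median q (\<lambda>a. rmem s 0 (a * q + digit_eval q a j mod q)) (rreg s' 1) \<and>
    (\<forall>b. b \<noteq> 3 \<longrightarrow> wmem s' b = wmem s b) \<and> (\<forall>b. b \<noteq> 2 \<longrightarrow> rmem s' b = rmem s b) \<and>
    (\<forall>r. r \<noteq> 1 \<longrightarrow> rreg s' r = rreg s r))"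
proof -
  have "2 * q \<le> q * q" using q by (intro mult_right_mono) auto
  then have w: "2 * q < wlim w" using q by linarith
  show ?thesis
    unfolding median_estimate_def
  proof (rule runs_SeqI[OF runs_gather[OF r q]], goal_cases)
    case s1: (1 t1 s1)
    have r1: "wreg s1 4 = q" using s1 r by (auto simp: same_regs_def)
    show ?case
    proof (rule runs_SeqI[OF runs_build_tree[OF r1 q(1) w]], goal_cases)
      case s2: (1 t2 s2)
      have r2: "wreg s2 4 = q" using s2 r1 by (auto simp: same_regs_def)
      have E: "runs w extract_half s2 (\<lambda>t s'. t \<le> q * (70 * floorlog 2 q + 50) + 20 \<and> same_regs {15,17} s2 s' \<and>
        is_median q (\<lambda>a. rmem s2 2 (q + a)) (rreg s' 1) \<and>
        (\<forall>b. b \<noteq> 3 \<longrightarrow> wmem s' b = wmem s2 b) \<and> rmem s' = rmem s2 \<and> (\<forall>r. r \<noteq> 1 \<longrightarrow> rreg s' r = rreg s2 r))"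
        by (rule runs_extract_half[OF r2 q(1) w]) (use s1 s2 in auto)
      show ?case
      proof (rule runs_mono[OF E], goal_cases)
        case s3: (1 t3 s3)
        have "is_median q (\<lambda>a. rmem s 0 (a * q + digit_eval q a j mod q)) (rreg s3 1)"
        proof -
          have "rmem s2 = rmem s1" using s2 by (elim conjE)
          moreover have "\<forall>a<q. rmem s1 2 (q + a) = rmem s 0 (a * q + digit_eval q a j mod q)"
            using s1 by blast
          ultimately have "\<forall>a<q. rmem s2 2 (q + a) = rmem s 0 (a * q + digit_eval q a j mod q)"
            by (simp only:)
          moreover have "is_median q (\<lambda>a. rmem s2 2 (q + a)) (rreg s3 1)" using s3 by (elim conjE)
          ultimately show ?thesis by (rule is_median_cong)
        qed
        moreover have "t1 + (t2 + t3) \<le> 300 * (q * (floorlog q j + floorlog 2 q))"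
        proof -
          have f: "1 \<le> floorlog 2 q" by (rule floorlog_geI) (use q in auto)
          then have "q * 1 \<le> q * floorlog 2 q" by (intro mult_left_mono) auto
          moreover have "t1 \<le> 30 * (q * floorlog q j) + 60 * q + 10" using s1 by (simp add: algebra_simps)
          moreover have "t3 \<le> 70 * (q * floorlog 2 q) + 50 * q + 20" using s3 by (simp add: algebra_simps)
          moreover have "t2 \<le> 70 * q + 20" using s2 by simp
          moreover have "300 * (q * (floorlog q j + floorlog 2 q)) = 300 * (q * floorlog q j) + 300 * (q * floorlog 2 q)"
            by (simp add: algebra_simps)
          ultimately show ?thesis using q by linarith
        qed
        ultimately show ?case using s1 s2 s3 by (auto simp: same_regs_def)
      qed
    qed
  qed
qed

subsection \<open>Recovery and entry programs\<close>

text \<open>\<open>P\<close> is the set of candidates seen so far, and \<open>G i e\<close> says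
  that \<open>e\<close> is an acceptable estimate for \<open>i\<close>. A rejected candidate leaves
  no trace in memory, so for it only the existence of a dominated estimate is recorded; this is the
  form that \<open>recovery_guarantee\<close> asks for.\<close>

definition selected ::
  "nat \<Rightarrow> (nat \<Rightarrow> real \<Rightarrow> bool) \<Rightarrow> nat set \<Rightarrow> (nat \<Rightarrow> nat) \<Rightarrow> (nat \<Rightarrow> real) \<Rightarrow> nat \<Rightarrow> bool" where
  "selected K G P f v c \<longleftrightarrow> c \<le> K \<and> inj_on f {..<c} \<and> f ` {..<c} \<subseteq> P \<and> (\<forall>p<c. G (f p) (v p)) \<and>
    (\<forall>i \<in> P - f ` {..<c}. c = K \<and> (\<exists>e. G i e \<and> (\<forall>p<c. \<bar>e\<bar> \<le> \<bar>v p\<bar>)))"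

lemma selectedD:
  assumes "selected K G P f v c"
  shows "c \<le> K" "inj_on f {..<c}" "f ` {..<c} \<subseteq> P" "\<And>p. p < c \<Longrightarrow> G (f p) (v p)"
    "\<And>i. i \<in> P - f ` {..<c} \<Longrightarrow> c = K"
    "\<And>i. i \<in> P - f ` {..<c} \<Longrightarrow> \<exists>e. G i e \<and> (\<forall>p<c. \<bar>e\<bar> \<le> \<bar>v p\<bar>)"
  using assms unfolding selected_def by blast+

lemma selectedI:
  assumes "c \<le> K" "inj_on f {..<c}" "f ` {..<c} \<subseteq> P" "\<And>p. p < c \<Longrightarrow> G (f p) (v p)"
    "\<And>i. i \<in> P - f ` {..<c} \<Longrightarrow> c = K"
    "\<And>i. i \<in> P - f ` {..<c} \<Longrightarrow> \<exists>e. G i e \<and> (\<forall>p<c. \<bar>e\<bar> \<le> \<bar>v p\<bar>)"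
  shows "selected K G P f v c"
  using assms unfolding selected_def by (intro conjI ballI allI impI) auto

text \<open>Candidate \<open>(i, e)\<close> travels past the slots and changes places with every slot of smaller absolute
  value; \<open>m\<close> slots are done, and \<open>v0\<close> are the values before the pass.\<close>

definition push_inv ::
  "(nat \<Rightarrow> real \<Rightarrow> bool) \<Rightarrow> nat set \<Rightarrow> (nat \<Rightarrow> real) \<Rightarrow> nat \<Rightarrow> nat \<Rightarrow> (nat \<Rightarrow> nat) \<Rightarrow> (nat \<Rightarrow> real) \<Rightarrow> nat \<Rightarrow> real \<Rightarrow> bool"
  where
  "push_inv G U v0 c m f v i e \<longleftrightarrow> insert i (f ` {..<c}) = U \<and> i \<notin> f ` {..<c} \<and> inj_on f {..<c} \<and>
    (\<forall>p<c. G (f p) (v p)) \<and> G i e \<and> (\<forall>p<m. \<bar>e\<bar> \<le> \<bar>v p\<bar>) \<and> (\<forall>p<c. \<bar>v0 p\<bar> \<le> \<bar>v p\<bar>)"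

lemma push_inv_keep:
  assumes "push_inv G U v0 c m f v i e" "\<bar>e\<bar> \<le> \<bar>v m\<bar>"
  shows "push_inv G U v0 c (Suc m) f v i e"
  using assms by (auto simp: push_inv_def less_Suc_eq)

text \<open>The candidate picked up is smaller than the one put down, so it stays dominated by the
  slots already passed, and the values in the slots never decrease.\<close>

lemma push_inv_swap:
  assumes J: "push_inv G U v0 c m f v i e" and m: "m < c" and e: "\<bar>v m\<bar> < \<bar>e\<bar>"
  shows "push_inv G U v0 c (Suc m) (f(m := i)) (v(m := e)) (f m) (v m)"
proof -
  have f: "inj_on f {..<c}" "i \<notin> f ` {..<c}" using J by (auto simp: push_inv_def)
  have img: "(f(m := i)) ` {..<c} = insert i (f ` ({..<c} - {m}))" using m by auto
  have img0: "f ` {..<c} = insert (f m) (f ` ({..<c} - {m}))" using m by auto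
  have fm: "f m \<notin> f ` ({..<c} - {m})" using f(1) m by (auto simp: inj_on_def)
  have "f m \<noteq> i" using f(2) m by auto
  then have notin: "f m \<notin> (f(m := i)) ` {..<c}" using fm img by auto
  have "insert (f m) ((f(m := i)) ` {..<c}) = insert i (f ` {..<c})" using img img0 by auto
  moreover have "inj_on (f(m := i)) {..<c}"
    using f m by (auto simp: inj_on_def)
  ultimately show ?thesis using J notin m e
    by (auto simp: push_inv_def less_Suc_eq)
qed

text \<open>A free slot means that nothing has been rejected yet: the slots hold all of
  \<open>P\<close>, and the candidate still being carried takes the free one.\<close>

lemma selected_append:
  assumes S: "selected K G P f0 v0 c" and c: "c < K"
    and J: "push_inv G (insert i0 (f0 ` {..<c})) v0 c c f v i e"
  shows "selected K G (insert i0 P) (f(c := i)) (v(c := e)) (Suc c)"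
proof -
  have P: "P = f0 ` {..<c}" using selectedD(3)[OF S] selectedD(5)[OF S] c by blast
  have "(f(c := i)) ` {..<Suc c} = insert i (f ` {..<c})" by (auto simp: less_Suc_eq)
  also have "\<dots> = insert i0 P" using J P by (simp add: push_inv_def)
  finally have img: "(f(c := i)) ` {..<Suc c} = insert i0 P" .
  have inj: "inj_on (f(c := i)) {..<Suc c}"
    using J by (auto simp: push_inv_def inj_on_def less_Suc_eq)
  have G: "\<forall>p<c. G (f p) (v p)" "G i e"
    using J by (simp_all add: push_inv_def)
  have "G ((f(c := i)) p) ((v(c := e)) p)" if "p < Suc c" for p
    using G(1)[rule_format, of p] G(2) that by (cases "p = c") (simp_all add: less_Suc_eq)
  note G' = this
  show ?thesis
  proof (rule selectedI)
    show "Suc c \<le> K" using c by simp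
    show "(f(c := i)) ` {..<Suc c} \<subseteq> insert i0 P" using img by (rule equalityD1)
    fix j assume "j \<in> insert i0 P - (f(c := i)) ` {..<Suc c}"
    then have False using img by blast
    then show "Suc c = K" "\<exists>e'. G j e' \<and> (\<forall>p<Suc c. \<bar>e'\<bar> \<le> \<bar>(v(c := e)) p\<bar>)" by auto
  qed (rule inj G', assumption?)+
qed

text \<open>The candidate left over is dominated by every slot. Those rejected earlier stay
  dominated because the pass only increased the values, which is why \<open>push_inv\<close>
  remembers \<open>v0\<close>.\<close>

lemma selected_discard:
  assumes S: "selected K G P f0 v0 c" and c: "\<not> c < K"
    and J: "push_inv G (insert i0 (f0 ` {..<c})) v0 c c f v i e"
  shows "selected K G (insert i0 P) f v c"
proof -
  have cK: "c = K" using selectedD(1)[OF S] c by linarith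
  have f0: "f0 ` {..<c} \<subseteq> P" by (rule selectedD(3)[OF S])
  have U: "insert i (f ` {..<c}) = insert i0 (f0 ` {..<c})" using J unfolding push_inv_def by (elim conjE)
  have sub: "f ` {..<c} \<subseteq> insert i0 P" using f0 U by blast
  have "\<exists>e. G j e \<and> (\<forall>p<c. \<bar>e\<bar> \<le> \<bar>v p\<bar>)" if j: "j \<in> insert i0 P - f ` {..<c}" for j
  proof (cases "j = i")
    case True
    then show ?thesis using J by (auto simp: push_inv_def)
  next
    case False
    then have "j \<notin> insert i0 (f0 ` {..<c})" using U j by blast
    then have "j \<in> P - f0 ` {..<c}" using j by auto
    then obtain e' where e': "G j e'" "\<forall>p<c. \<bar>e'\<bar> \<le> \<bar>v0 p\<bar>" using selectedD(6)[OF S] by blast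
    have "\<forall>p<c. \<bar>e'\<bar> \<le> \<bar>v p\<bar>" using e'(2) J unfolding push_inv_def by (auto intro: order_trans)
    then show ?thesis using e'(1) by blast
  qed
  moreover have "inj_on f {..<c}" "\<And>p. p < c \<Longrightarrow> G (f p) (v p)" using J by (auto simp: push_inv_def)
  ultimately show ?thesis using sub cK by (intro selectedI) (blast | linarith)+
qed

definition swap_slot :: com where
  "swap_slot = WAssign 20 (WLoad 1 (WReg 18)) ;; RAssign 2 (RLoad 1 (WReg 18)) ;;
    WStore 1 (WReg 18) (WReg 10) ;; RStore 1 (WReg 18) (RReg 1) ;;
    WAssign 10 (WReg 20) ;; RAssign 1 (RReg 2)"

text \<open>Word register 1 holds \<open>k\<close>, while real register 1 holds the estimate being
  carried.\<close>

definition push :: com where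
  "push = WAssign 18 (WConst 0) ;;
    While (WLess (WReg 18) (WReg 19))
      (Cond (RLess (RMul (RLoad 1 (WReg 18)) (RLoad 1 (WReg 18))) (RMul (RReg 1) (RReg 1))) swap_slot Skip ;;
       WAssign 18 (WAdd (WReg 18) (WConst 1))) ;;
    Cond (WLess (WReg 19) (WMul (WConst 3) (WReg 1)))
      (WStore 1 (WReg 19) (WReg 10) ;; RStore 1 (WReg 19) (RReg 1) ;; WAssign 19 (WAdd (WReg 19) (WConst 1)))
      Skip"

text \<open>Real cells have no absolute value operation; comparing squares takes its place.\<close>

lemma square_less_iff: "a * a < b * b \<longleftrightarrow> \<bar>a\<bar> < \<bar>b\<bar>" for a b :: real
  using abs_le_square_iff[of b a] by (simp add: power2_eq_square not_le[symmetric])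

lemma runs_push:
  assumes r: "wreg s 19 = c" "wreg s 1 = k" "wreg s 10 = i" and k: "1 \<le> k" "3 * k < wlim w"
    and S: "selected (3 * k) G P (wmem s 1) (rmem s 1) c" and i: "i \<notin> P" "G i (rreg s 1)"
  shows "runs w push s (\<lambda>t s'. t \<le> 200 * k \<and> same_regs {10,18,19,20} s s' \<and>
    selected (3 * k) G (insert i P) (wmem s' 1) (rmem s' 1) (wreg s' 19) \<and>
    (\<forall>b. b \<noteq> 1 \<longrightarrow> wmem s' b = wmem s b) \<and> (\<forall>b. b \<noteq> 1 \<longrightarrow> rmem s' b = rmem s b))"
proof -
  define U where "U = insert i (wmem s 1 ` {..<c})"
  define J where "J s' \<longleftrightarrow> same_regs {10,18,20} s s' \<and> wreg s' 18 \<le> c \<and>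
    push_inv G U (rmem s 1) c (wreg s' 18) (wmem s' 1) (rmem s' 1) (wreg s' 10) (rreg s' 1) \<and>
    (\<forall>b. b \<noteq> 1 \<longrightarrow> wmem s' b = wmem s b) \<and> (\<forall>b. b \<noteq> 1 \<longrightarrow> rmem s' b = rmem s b)" for s'
  define \<Phi> where "\<Phi> s' = 40 * (c - wreg s' 18)" for s' :: state
  have c: "c \<le> 3 * k" by (rule selectedD(1)[OF S])
  have w0: "0 < wlim w" "1 < wlim w" "3 < wlim w" "c < wlim w" using k c by linarith+
  let ?s0 = "s\<lparr>wreg := (wreg s)(18 := 0)\<rparr>"
  have init: "J ?s0"
  proof -
    have "push_inv G U (rmem s 1) c 0 (wmem s 1) (rmem s 1) i (rreg s 1)"
      unfolding push_inv_def U_def using selectedD(2,3,4)[OF S] i by auto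
    then show ?thesis using r by (simp add: J_def same_regs_def)
  qed
  let ?test = "RLess (RMul (RLoad 1 (WReg 18)) (RLoad 1 (WReg 18))) (RMul (RReg 1) (RReg 1))"
  let ?body = "Cond ?test swap_slot Skip ;; WAssign 18 (WAdd (WReg 18) (WConst 1))"
  have step: "runs w ?body s' (\<lambda>t s''. J s'' \<and> t + 1 + bcost (WLess (WReg 18) (WReg 19)) + \<Phi> s'' \<le> \<Phi> s')"
    if J: "J s'" and b: "bval w (WLess (WReg 18) (WReg 19)) s'" for s'
  proof -
    define p where "p = wreg s' 18"
    have r19: "wreg s' 19 = c" using J r by (simp add: J_def same_regs_def)
    have p: "p < c" using b r19 by (simp add: p_def)
    have I: "push_inv G U (rmem s 1) c p (wmem s' 1) (rmem s' 1) (wreg s' 10) (rreg s' 1)"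
      using J by (simp add: J_def p_def)
    have pw: "Suc p < wlim w" using p w0 by linarith
    have \<Phi>': "40 * (c - p) = 40 + 40 * (c - Suc p)" using p by simp
    show ?thesis
    proof (cases "\<bar>rmem s' 1 p\<bar> < \<bar>rreg s' 1\<bar>")
      case True
      let ?s = "s'\<lparr>wmem := (wmem s')(1 := (wmem s' 1)(p := wreg s' 10)),
        rmem := (rmem s')(1 := (rmem s' 1)(p := rreg s' 1)),
        rreg := (rreg s')(2 := rmem s' 1 p, 1 := rmem s' 1 p),
        wreg := (wreg s')(20 := wmem s' 1 p, 10 := wmem s' 1 p, 18 := Suc p)\<rparr>"
      have "J ?s" using push_inv_swap[OF I p True] J p by (auto simp: J_def same_regs_def)
      then show ?thesis
        using True p pw w0 \<Phi>' by (simp add: swap_slot_def square_less_iff p_def[symmetric] \<Phi>_def)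
    next
      case False
      then have "\<bar>rreg s' 1\<bar> \<le> \<bar>rmem s' 1 p\<bar>" by simp
      from push_inv_keep[OF I this]
      have "J (s'\<lparr>wreg := (wreg s')(18 := Suc p)\<rparr>)" using J p by (auto simp: J_def same_regs_def)
      then show ?thesis
        using False p pw w0 \<Phi>' by (simp add: square_less_iff p_def[symmetric] \<Phi>_def)
    qed
  qed
  have loop: "runs w (While (WLess (WReg 18) (WReg 19)) ?body) ?s0 (\<lambda>t s'. J s' \<and> wreg s' 18 = c \<and> t \<le> 40 * c + 4)"
  proof (rule runs_mono[OF runs_While[of J _ _ _ _ \<Phi>, OF init step]], goal_cases)
    case (3 t s')
    have "wreg s' 19 = c" using 3 r by (simp add: J_def same_regs_def)
    then show ?case using 3 by (auto simp: J_def \<Phi>_def)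
  qed
  have start: "runs w (WAssign 18 (WConst 0)) s (\<lambda>t s'. t = 2 \<and> s' = ?s0)" using w0 by simp
  show ?thesis
    unfolding push_def
  proof (rule runs_SeqI[OF start], goal_cases)
    case (1 t0 s1)
    then have [simp]: "t0 = 2" "s1 = ?s0" by auto
    show ?case unfolding \<open>s1 = ?s0\<close>
    proof (rule runs_SeqI[OF loop], goal_cases)
      case (1 t s')
      then have J: "J s'" and r18: "wreg s' 18 = c" and t: "t \<le> 40 * c + 4" by auto
      have I: "push_inv G (insert i (wmem s 1 ` {..<c})) (rmem s 1) c c (wmem s' 1) (rmem s' 1) (wreg s' 10) (rreg s' 1)"
        using J r18 by (simp add: J_def U_def)
      have rr: "wreg s' 19 = c" "wreg s' 1 = k" using J r by (auto simp: J_def same_regs_def)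
      have fr: "same_regs {10,18,20} s s'" "\<forall>b. b \<noteq> 1 \<longrightarrow> wmem s' b = wmem s b"
        "\<forall>b. b \<noteq> 1 \<longrightarrow> rmem s' b = rmem s b" using J by (auto simp: J_def)
      show ?case
      proof (cases "c < 3 * k")
        case True
        have "Suc c < wlim w" using True k by linarith
        then show ?thesis using selected_append[OF S True I] True rr fr t c k w0
          by (simp add: same_regs_def)
      next
        case False
        then show ?thesis using selected_discard[OF S False I] rr fr t c k w0
          by (simp add: same_regs_def)
      qed
    qed
  qed
qed

section \<open>The complete recovery and entry programs\<close>

definition recover_coded :: com where
  "recover_coded = prepare ;; WAssign 19 (WConst 0) ;; WAssign 21 (WConst 0) ;;
    While (WLess (WReg 21) (WReg 3))
      (WAssign 10 (WLoad 0 (WReg 21)) ;; median_estimate ;; push ;; WAssign 21 (WAdd (WReg 21) (WConst 1))) ;;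
    WAssign 0 (WReg 19)"

definition word_bounds :: "nat \<Rightarrow> nat \<Rightarrow> nat \<Rightarrow> bool" where
  "word_bounds w n k \<longleftrightarrow> 1024 * (k * num_digits n k) < wlim w \<and> k * floorlog 2 n < wlim w \<and>
    field_size n k * field_size n k < wlim w \<and> n < wlim w \<and> 3 * k < wlim w"

definition prepare_time :: "nat \<Rightarrow> nat \<Rightarrow> nat" where
  "prepare_time n k = 15 * floorlog 2 n + 15 * num_digits n k +
    12 * (512 * (k * num_digits n k) * floorlog 2 (512 * (k * num_digits n k))) +
    40 * (512 * (k * num_digits n k)) + 100"

lemma field_size:
  assumes "2 \<le> n" "1 \<le> k"
  shows "prime (field_size n k)" "32 * (k * num_digits n k) \<le> field_size n k"
    "field_size n k < 512 * (k * num_digits n k)" "1 < field_size n k"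
proof -
  have "1 * 1 \<le> k * num_digits n k" using num_digits_pos[OF assms] assms by (intro mult_le_mono) auto
  then have "32 \<le> 32 * (k * num_digits n k)" by linarith
  note L = least_prime_from[OF this]
  show "prime (field_size n k)" "32 * (k * num_digits n k) \<le> field_size n k"
    "field_size n k < 512 * (k * num_digits n k)" using L by (auto simp: field_size_def)
  then show "1 < field_size n k" using prime_gt_1_nat by blast
qed

text \<open>Stated for any property \<open>G\<close> shared by all medians of the queried cells, so
  that the program analysis mentions neither the unknown vector nor its tail.\<close>

lemma runs_recover_coded:
  fixes n k :: nat
  defines "q \<equiv> field_size n k"
  assumes r: "wreg s 0 = n" "wreg s 1 = k" "wreg s 3 = length xs" and nk: "2 \<le> n" "1 \<le> k"
    and wb: "word_bounds w n k"
    and clean: "\<And>y. wmem s 2 y = 0" and xs: "\<And>p. p < length xs \<Longrightarrow> wmem s 0 p = xs ! p" "distinct xs"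
      "length xs \<le> n"
    and D: "\<And>i. i \<in> set xs \<Longrightarrow> floorlog q i \<le> D"
    and G: "\<And>i z. i \<in> set xs \<Longrightarrow> is_median q (\<lambda>a. rmem s 0 (a * q + digit_eval q a i mod q)) z \<Longrightarrow> G i z"
  shows "runs w recover_coded s (\<lambda>t s'.
    t \<le> prepare_time n k + length xs * (300 * (q * (D + floorlog 2 q)) + 200 * k + 20) + 20 \<and>
    selected (3 * k) G (set xs) (wmem s' 1) (rmem s' 1) (wreg s' 0))"
proof -
  have w: "1024 * (k * num_digits n k) < wlim w" "k * floorlog 2 n < wlim w" "q * q < wlim w"
    "n < wlim w" "3 * k < wlim w" using wb by (auto simp: word_bounds_def q_def)
  have q1: "1 < q" using field_size[OF nk] by (simp add: q_def)
  have w0: "0 < wlim w" "1 < wlim w" "length xs < wlim w" using w nk xs by linarith+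
  define T where "T = 300 * (q * (D + floorlog 2 q)) + 200 * k + 20"
  have P: "runs w prepare s (\<lambda>t s'. t \<le> prepare_time n k \<and>
    same_regs {4,5,6,7,8,9} s s' \<and> wreg s' 4 = q \<and>
    (\<forall>b. b \<noteq> 2 \<longrightarrow> wmem s' b = wmem s b) \<and> rreg s' = rreg s \<and> rmem s' = rmem s)"
    unfolding prepare_time_def q_def by (rule runs_prepare[OF r(1,2) nk w(1,2) clean])
  let ?body = "WAssign 10 (WLoad 0 (WReg 21)) ;; median_estimate ;; push ;; WAssign 21 (WAdd (WReg 21) (WConst 1))"
  let ?loop = "While (WLess (WReg 21) (WReg 3)) ?body"
  show ?thesis
    unfolding recover_coded_def
  proof (rule runs_SeqI[OF P], goal_cases)
    case s1: (1 t1 s1)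
    let ?s0 = "s1\<lparr>wreg := (wreg s1)(19 := 0, 21 := 0)\<rparr>"
    define J where "J s' \<longleftrightarrow> wreg s' 1 = k \<and> wreg s' 3 = length xs \<and> wreg s' 4 = q \<and>
      wreg s' 21 \<le> length xs \<and> wmem s' 0 = wmem s 0 \<and> rmem s' 0 = rmem s 0 \<and>
      selected (3 * k) G (set (take (wreg s' 21) xs)) (wmem s' 1) (rmem s' 1) (wreg s' 19)" for s' :: state
    define \<Phi> where "\<Phi> s' = (length xs - wreg s' 21) * T" for s' :: state
    have "selected (3 * k) G {} f v 0" for f v by (rule selectedI) auto
    then have init: "J ?s0" using s1 r by (auto simp: J_def same_regs_def)
    have step: "runs w ?body s' (\<lambda>t s''. J s'' \<and> t + 1 + bcost (WLess (WReg 21) (WReg 3)) + \<Phi> s'' \<le> \<Phi> s')"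
      if J: "J s'" and b: "bval w (WLess (WReg 21) (WReg 3)) s'" for s'
    proof -
      define p where "p = wreg s' 21"
      have p: "p < length xs" using J b by (simp add: J_def p_def)
      define i where "i = xs ! p"
      have i: "i \<in> set xs" using p by (simp add: i_def)
      let ?s1 = "s'\<lparr>wreg := (wreg s')(10 := i)\<rparr>"
      have A: "runs w (WAssign 10 (WLoad 0 (WReg 21))) s' (\<lambda>t s''. t = 3 \<and> s'' = ?s1)"
        using J p xs(1)[OF p] by (simp add: J_def p_def[symmetric] i_def)
      have M: "runs w median_estimate ?s1 (\<lambda>t s''. t \<le> 300 * (q * (floorlog q i + floorlog 2 q)) \<and>
        same_regs {11,12,13,14,15,17} ?s1 s'' \<and>
        is_median q (\<lambda>a. rmem ?s1 0 (a * q + digit_eval q a i mod q)) (rreg s'' 1) \<and>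
        (\<forall>b. b \<noteq> 3 \<longrightarrow> wmem s'' b = wmem ?s1 b) \<and> (\<forall>b. b \<noteq> 2 \<longrightarrow> rmem s'' b = rmem ?s1 b) \<and>
        (\<forall>r. r \<noteq> 1 \<longrightarrow> rreg s'' r = rreg ?s1 r))"
        by (rule runs_median_estimate) (use J q1 w in \<open>auto simp: J_def\<close>)
      show ?thesis
      proof (rule runs_SeqI[OF A], goal_cases)
        case a: (1 ta sa)
        then have "sa = ?s1" by simp
        show ?case unfolding \<open>sa = ?s1\<close>
        proof (rule runs_SeqI[OF M], goal_cases)
          case m: (1 tm sm)
          have rm: "wreg sm 1 = k" "wreg sm 3 = length xs" "wreg sm 4 = q" "wreg sm 10 = i" "wreg sm 21 = p"
            "wreg sm 19 = wreg s' 19"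
            using m J by (auto simp: same_regs_def J_def p_def)
          have mem: "wmem sm 0 = wmem s 0" "rmem sm 0 = rmem s 0" "wmem sm 1 = wmem s' 1" "rmem sm 1 = rmem s' 1"
            using m J by (auto simp: J_def)
          have "is_median q (\<lambda>a. rmem s' 0 (a * q + digit_eval q a i mod q)) (rreg sm 1)" using m by simp
          then have Gi: "G i (rreg sm 1)" using G[OF i] J by (simp add: J_def)
          have S: "selected (3 * k) G (set (take p xs)) (wmem sm 1) (rmem sm 1) (wreg s' 19)"
            using J mem by (simp add: J_def p_def)
          \<comment> \<open>Distinctness of the list enters here: a repeated candidate would occupy
            two slots.\<close>
          have "i \<notin> set (take p xs)"
            using xs(2) p by (auto simp: i_def in_set_conv_nth nth_eq_iff_index_eq)
          note PU = runs_push[OF rm(6,1,4) nk(2) w(5) S this Gi]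
          show ?case
          proof (rule runs_SeqI[OF PU], goal_cases)
            case u: (1 tu su)
            have ru: "wreg su 1 = k" "wreg su 3 = length xs" "wreg su 4 = q" "wreg su 21 = p"
              using u rm by (auto simp: same_regs_def)
            have memu: "wmem su 0 = wmem s 0" "rmem su 0 = rmem s 0" using u mem by auto
            have "insert i (set (take p xs)) = set (take (Suc p) xs)"
              using p by (simp add: take_Suc_conv_app_nth i_def)
            then have "selected (3 * k) G (set (take (Suc p) xs)) (wmem su 1) (rmem su 1) (wreg su 19)"
              using u by simp
            then have J': "J (su\<lparr>wreg := (wreg su)(21 := Suc p)\<rparr>)"
              using ru memu p by (simp add: J_def)
            have "Suc p < wlim w" using p w0 by linarith
            moreover have "ta + (tm + (tu + 4)) + 4 + (length xs - Suc p) * T \<le> (length xs - p) * T"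
            proof -
              have "length xs - p = Suc (length xs - Suc p)" using p by simp
              then have "(length xs - p) * T = T + (length xs - Suc p) * T" by (simp only: mult_Suc)
              moreover have "q * (floorlog q i + floorlog 2 q) \<le> q * (D + floorlog 2 q)"
                using D[OF i] by (intro mult_left_mono) auto
              moreover have "ta = 3" "tm \<le> 300 * (q * (floorlog q i + floorlog 2 q))" "tu \<le> 200 * k"
                using a m u by simp_all
              ultimately show ?thesis unfolding T_def by linarith
            qed
            ultimately show ?case using J' ru(4) w0 by (simp add: \<Phi>_def p_def)
          qed
        qed
      qed
    qed
    have loop: "runs w (?loop ;; WAssign 0 (WReg 19)) ?s0 (\<lambda>t s'. t \<le> length xs * T + 10 \<and>
      selected (3 * k) G (set xs) (wmem s' 1) (rmem s' 1) (wreg s' 0))"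
    proof (rule runs_SeqI[OF runs_While[of J _ _ _ _ \<Phi>, OF init step]], goal_cases)
      case (3 t s')
      then have "wreg s' 21 = length xs" by (simp add: J_def)
      then have "selected (3 * k) G (set xs) (wmem s' 1) (rmem s' 1) (wreg s' 19)"
        using 3 by (simp add: J_def)
      then show ?case using 3 by (simp add: \<Phi>_def)
    qed
    have A1: "runs w (WAssign 19 (WConst 0)) s1 (\<lambda>t s'. t = 2 \<and> s' = s1\<lparr>wreg := (wreg s1)(19 := 0)\<rparr>)"
      using w0 by simp
    show ?case
    proof (rule runs_SeqI[OF A1], goal_cases)
      case a1: (1 u1 z1)
      have A2: "runs w (WAssign 21 (WConst 0)) z1 (\<lambda>t s'. t = 2 \<and> s' = ?s0)"
        using w0 a1 by simp
      show ?case
      proof (rule runs_SeqI[OF A2], goal_cases)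
        case a2: (1 u2 z2)
        then have "z2 = ?s0" by simp
        show ?case unfolding \<open>z2 = ?s0\<close>
          by (rule runs_mono[OF loop]) (use a1 a2 s1 in \<open>simp add: T_def\<close>)
      qed
    qed
  qed
qed

text \<open>For \<open>n \<le> k\<close> the measurements are the coordinates themselves, and
  reporting every candidate is still sparse enough.\<close>

definition recover_direct :: com where
  "recover_direct = WAssign 21 (WConst 0) ;;
    While (WLess (WReg 21) (WReg 3))
      (WStore 1 (WReg 21) (WLoad 0 (WReg 21)) ;; RStore 1 (WReg 21) (RLoad 0 (WLoad 0 (WReg 21))) ;;
       WAssign 21 (WAdd (WReg 21) (WConst 1))) ;;
    WAssign 0 (WReg 3)"

lemma runs_recover_direct:
  assumes r: "wreg s 3 = l" and w: "l < wlim w" "1 < wlim w"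
  shows "runs w recover_direct s (\<lambda>t s'. t \<le> 30 * l + 20 \<and> wreg s' 0 = l \<and>
    (\<forall>p<l. wmem s' 1 p = wmem s 0 p \<and> rmem s' 1 p = rmem s 0 (wmem s 0 p)))"
proof -
  define J where "J s' \<longleftrightarrow> wreg s' 3 = l \<and> wreg s' 21 \<le> l \<and> wmem s' 0 = wmem s 0 \<and> rmem s' 0 = rmem s 0 \<and>
    (\<forall>p<wreg s' 21. wmem s' 1 p = wmem s 0 p \<and> rmem s' 1 p = rmem s 0 (wmem s 0 p))" for s' :: state
  define \<Phi> where "\<Phi> s' = 30 * (l - wreg s' 21)" for s' :: state
  let ?s0 = "s\<lparr>wreg := (wreg s)(21 := 0)\<rparr>"
  let ?body = "WStore 1 (WReg 21) (WLoad 0 (WReg 21)) ;; RStore 1 (WReg 21) (RLoad 0 (WLoad 0 (WReg 21))) ;;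
       WAssign 21 (WAdd (WReg 21) (WConst 1))"
  have init: "J ?s0" using r by (simp add: J_def)
  have step: "runs w ?body s' (\<lambda>t s''. J s'' \<and> t + 1 + bcost (WLess (WReg 21) (WReg 3)) + \<Phi> s'' \<le> \<Phi> s')"
    if J: "J s'" and b: "bval w (WLess (WReg 21) (WReg 3)) s'" for s'
  proof -
    define p where "p = wreg s' 21"
    have p: "p < l" using J b by (simp add: J_def p_def)
    have pw: "Suc p < wlim w" using p w by linarith
    let ?s = "s'\<lparr>wmem := (wmem s')(1 := (wmem s' 1)(p := wmem s' 0 p)),
        rmem := (rmem s')(1 := (rmem s' 1)(p := rmem s' 0 (wmem s' 0 p))),
        wreg := (wreg s')(21 := Suc p)\<rparr>"
    have "J ?s" using J p by (auto simp: J_def p_def[symmetric] less_Suc_eq)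
    moreover have "30 * (l - p) = 30 + 30 * (l - Suc p)" using p by simp
    ultimately show ?thesis using p pw w by (simp add: p_def[symmetric] \<Phi>_def)
  qed
  have loop: "runs w (While (WLess (WReg 21) (WReg 3)) ?body ;; WAssign 0 (WReg 3)) ?s0
    (\<lambda>t s'. t \<le> 30 * l + 10 \<and> wreg s' 0 = l \<and>
    (\<forall>p<l. wmem s' 1 p = wmem s 0 p \<and> rmem s' 1 p = rmem s 0 (wmem s 0 p)))"
  proof (rule runs_SeqI[OF runs_While[of J _ _ _ _ \<Phi>, OF init step]], goal_cases)
    case (3 t s')
    then have "wreg s' 21 = l" by (simp add: J_def)
    then show ?case using 3 by (simp add: \<Phi>_def J_def)
  qed
  have start: "runs w (WAssign 21 (WConst 0)) s (\<lambda>t s'. t = 2 \<and> s' = ?s0)" using w by simp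
  show ?thesis
    unfolding recover_direct_def
  proof (rule runs_SeqI[OF start], goal_cases)
    case (1 u s1)
    then have "u = 2" "s1 = ?s0" by auto
    show ?case unfolding \<open>s1 = ?s0\<close> \<open>u = 2\<close> by (rule runs_mono[OF loop]) simp
  qed
qed

text \<open>The empty list is treated apart because the time allowed for it is a constant, too
  little for computing the field size.\<close>

definition recover_com :: com where
  "recover_com = Cond (WLess (WReg 1) (WReg 0))
    (Cond (WLess (WConst 0) (WReg 3)) recover_coded (WAssign 0 (WConst 0)))
    recover_direct"

definition entry_com :: com where
  "entry_com =
    (let eq = (\<lambda>e f. BAnd (BNot (WLess e f)) (BNot (WLess f e)));
         answer = (\<lambda>b. Cond b (RAssign 0 (ROfWord (WConst 1))) (RAssign 0 (ROfWord (WConst 0))))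
     in Cond (WLess (WReg 1) (WReg 0))
       (prepare ;; WAssign 10 (WReg 3) ;; WAssign 11 (WDiv (WReg 2) (WReg 4)) ;; eval_digits ;;
        answer (eq (WReg 12) (WMod (WReg 2) (WReg 4))))
       (answer (eq (WReg 2) (WReg 3))))"

lemma runs_CondT:
  assumes "bval w g s" "runs w c s (\<lambda>t. Q (1 + bcost g + t))"
  shows "runs w (Cond g c d) s Q"
  using assms by simp

lemma runs_entry_direct:
  assumes "n \<le> k" "1 < wlim w"
  shows "runs w entry_com (entry_input n k i j) (\<lambda>t s'. t \<le> 30 \<and> rreg s' 0 = (if i = j then 1 else 0))"
  using assms by (auto simp: entry_com_def Let_def entry_input_def blank_def)

lemma runs_entry_coded:
  fixes n k :: nat
  defines "q \<equiv> field_size n k"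
  assumes nk: "2 \<le> n" "1 \<le> k" "k < n" and wb: "word_bounds w n k" and i: "i < q * q"
  shows "runs w entry_com (entry_input n k i j) (\<lambda>t s'. t \<le> prepare_time n k + 30 * floorlog q j + 100 \<and>
    rreg s' 0 = (if digit_eval q (i div q) j mod q = i mod q then 1 else 0))"
proof -
  define s where "s = entry_input n k i j"
  have r: "wreg s 0 = n" "wreg s 1 = k" "wreg s 2 = i" "wreg s 3 = j" "\<And>y. wmem s 2 y = 0"
    by (auto simp: s_def entry_input_def blank_def)
  have w: "1024 * (k * num_digits n k) < wlim w" "k * floorlog 2 n < wlim w" "q * q < wlim w"
    "n < wlim w" "3 * k < wlim w" using wb by (auto simp: word_bounds_def q_def)
  have q1: "1 < q" using field_size[OF nk(1,2)] by (simp add: q_def)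
  have w0: "0 < wlim w" "1 < wlim w" using w nk by linarith+
  have P: "runs w prepare s (\<lambda>t s'. t \<le> prepare_time n k \<and>
    same_regs {4,5,6,7,8,9} s s' \<and> wreg s' 4 = q \<and>
    (\<forall>b. b \<noteq> 2 \<longrightarrow> wmem s' b = wmem s b) \<and> rreg s' = rreg s \<and> rmem s' = rmem s)"
    unfolding prepare_time_def q_def by (rule runs_prepare[OF r(1,2) nk(1,2) w(1,2) r(5)])
  define A where "A = Cond (BAnd (BNot (WLess (WReg 12) (WMod (WReg 2) (WReg 4)))) (BNot (WLess (WMod (WReg 2) (WReg 4)) (WReg 12))))
      (RAssign 0 (ROfWord (WConst 1))) (RAssign 0 (ROfWord (WConst 0)))"
  have "runs w (prepare ;; WAssign 10 (WReg 3) ;; WAssign 11 (WDiv (WReg 2) (WReg 4)) ;; eval_digits ;; A) s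
    (\<lambda>t s'. t \<le> prepare_time n k + 30 * floorlog q j + 90 \<and>
    rreg s' 0 = (if digit_eval q (i div q) j mod q = i mod q then 1 else 0))"
  proof (rule runs_SeqI[OF P], goal_cases)
    case s1: (1 t1 s1)
    have r1: "wreg s1 2 = i" "wreg s1 3 = j" "wreg s1 4 = q" using s1 r by (auto simp: same_regs_def)
    let ?s2 = "s1\<lparr>wreg := (wreg s1)(10 := j, 11 := i div q)\<rparr>"
    have B: "runs w (WAssign 10 (WReg 3)) s1 (\<lambda>t s'. t = 2 \<and> s' = s1\<lparr>wreg := (wreg s1)(10 := j)\<rparr>)"
      using r1 by simp
    show ?case
    proof (rule runs_SeqI[OF B], goal_cases)
      case b: (1 tb sb)
      have C: "runs w (WAssign 11 (WDiv (WReg 2) (WReg 4))) sb (\<lambda>t s'. t = 4 \<and> s' = ?s2)"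
        using r1 b by simp
      show ?case
      proof (rule runs_SeqI[OF C], goal_cases)
        case c: (1 tc sc)
        have dq: "i div q < q" using i by (simp add: less_mult_imp_div_less)
        have E: "runs w eval_digits ?s2 (\<lambda>t s'. t \<le> 30 * floorlog q j + 20 \<and> same_regs {12,13,14} ?s2 s' \<and>
          wreg s' 12 = digit_eval q (i div q) j mod q \<and> wmem s' = wmem ?s2 \<and> rreg s' = rreg ?s2 \<and> rmem s' = rmem ?s2)"
          by (rule runs_eval_digits) (use r1 q1 w dq in auto)
        have "sc = ?s2" using c by simp
        show ?case unfolding \<open>sc = ?s2\<close>
        proof (rule runs_SeqI[OF E], goal_cases)
          case e: (1 te se)
          have re: "wreg se 2 = i" "wreg se 4 = q" "wreg se 12 = digit_eval q (i div q) j mod q"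
            using e r1 by (auto simp: same_regs_def)
          have bd: "t1 \<le> prepare_time n k" "tb = 2" "tc = 4" "te \<le> 30 * floorlog q j + 20"
            using s1 b c e by auto
          show ?case unfolding A_def using re w0 bd by auto
        qed
      qed
    qed
  qed
  note coded = this
  have "bval w (WLess (WReg 1) (WReg 0)) s" using r nk by simp
  then show ?thesis
    unfolding entry_com_def Let_def A_def[symmetric] s_def[symmetric]
    by (rule runs_CondT) (rule runs_mono[OF coded], simp)
qed

subsection \<open>Parameters and the main theorem\<close>

text \<open>The factor 2 absorbs b = 3, the only exception to b^2 \<le> 2^b.\<close>

lemma square_le_two_power: "b\<^sup>2 \<le> 2 * 2 ^ b" for b :: nat
proof (induction b)
  case (Suc b)
  show ?case
  proof (cases "b \<le> 2")
    case True
    then consider "b = 0" | "b = 1" | "b = 2" by linarith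
    then show ?thesis by cases (simp_all add: power2_eq_square)
  next
    case False
    then have "3 * b \<le> b * b" by (intro mult_right_mono) auto
    moreover have "(Suc b)\<^sup>2 = b * b + 2 * b + 1" "b\<^sup>2 = b * b" by (simp_all add: power2_eq_square)
    ultimately have "(Suc b)\<^sup>2 \<le> 2 * b\<^sup>2" using False by linarith
    then show ?thesis using Suc.IH by simp
  qed
qed simp

text \<open>The crux is \<open>n \<le> q ^ (2 * d)\<close>, although \<open>d\<close> counts digits
  in base b = k l and \<open>q\<close> has order k d. It reduces to b \<le> q^2. If
  \<open>\<beta>\<close> is the bit length of b, then n < b^d gives l \<le> \<beta> d; with
  \<beta>^2 \<le> 4 b, squaring and cancelling l leave l \<le> 4 k d^2, hence b \<le> 4 (k
  d)^2.\<close>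

lemma parameter_bounds:
  fixes n k :: nat
  assumes nk: "2 \<le> n" "1 \<le> k" "k < n"
  defines "l \<equiv> floorlog 2 n" and "d \<equiv> num_digits n k" and "q \<equiv> field_size n k"
  shows "d \<le> l" and "k * d < 2 ^ (2 * l)" and "n \<le> q ^ (2 * d)" and "q < 2 ^ (9 + 2 * l)"
    and "1 \<le> d" and "2 \<le> l" and "n < 2 ^ l"
proof -
  define b where "b = k * l"
  show l2: "2 \<le> l" unfolding l_def by (rule floorlog2_ge_2[OF nk(1)])
  have l: "n < 2 ^ l" "2 ^ (l - 1) \<le> n" using floorlog_bounds[of n 2] nk by (auto simp: l_def)
  then show "n < 2 ^ l" by simp
  have "1 * 2 \<le> b" unfolding b_def using nk l2 by (intro mult_le_mono) auto
  then have b2: "2 \<le> b" by simp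
  have "(2::nat) ^ l \<le> b ^ l" using b2 by (rule power_mono) simp
  then have "n < b ^ l" using l by linarith
  then show dl: "d \<le> l" unfolding d_def num_digits_def l_def[symmetric] b_def[symmetric]
    by (rule floorlog_leI) (use b2 in auto)
  show d1: "1 \<le> d" unfolding d_def by (rule num_digits_pos[OF nk(1,2)])
  have "l < 2 ^ l" by (rule less_exp)
  then have "d < 2 ^ l" using dl by linarith
  moreover have "k < 2 ^ l" using nk l by linarith
  ultimately have "k * d < 2 ^ l * 2 ^ l" by (intro mult_strict_mono) auto
  then show kd: "k * d < 2 ^ (2 * l)" by (simp add: mult_2 power_add)
  note q = field_size[OF nk(1,2), folded d_def q_def]
  show "q < 2 ^ (9 + 2 * l)" using q(3) kd by (simp add: power_add)
  have nb: "n < b ^ d"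
    unfolding d_def num_digits_def l_def[symmetric] b_def[symmetric]
    using floorlog_bounds[of n b] nk b2 by simp
  define \<beta> where "\<beta> = floorlog 2 b"
  have \<beta>: "b < 2 ^ \<beta>" "2 ^ (\<beta> - 1) \<le> b" using floorlog_bounds[of b 2] b2 by (auto simp: \<beta>_def)
  have \<beta>1: "1 \<le> \<beta>" unfolding \<beta>_def by (rule floorlog_geI) (use b2 in auto)
  have "b ^ d \<le> (2 ^ \<beta>) ^ d" using \<beta> by (intro power_mono) auto
  then have "(2::nat) ^ (l - 1) < 2 ^ (\<beta> * d)" using l nb by (simp add: power_mult)
  then have "l - 1 < \<beta> * d" by (simp add: power_strict_increasing_iff)
  then have "l \<le> \<beta> * d" by linarith
  then have "l * l \<le> (\<beta> * d) * (\<beta> * d)" by (intro mult_le_mono)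
  also have "\<dots> = \<beta>\<^sup>2 * (d * d)" by (simp add: power2_eq_square)
  also have "\<dots> \<le> (4 * b) * (d * d)"
  proof (rule mult_right_mono)
    have "(2::nat) ^ \<beta> = 2 * 2 ^ (\<beta> - 1)" using \<beta>1 by (metis Suc_diff_le diff_Suc_1 power_Suc One_nat_def)
    then show "\<beta>\<^sup>2 \<le> 4 * b" using square_le_two_power[of \<beta>] \<beta>(2) by linarith
  qed simp
  also have "\<dots> = l * (4 * k * (d * d))" by (simp add: b_def)
  finally have "l \<le> 4 * k * (d * d)" using l2 by (simp add: mult_le_cancel1)
  then have "b \<le> k * (4 * k * (d * d))" unfolding b_def by (intro mult_left_mono) auto
  also have "\<dots> = 4 * ((k * d) * (k * d))" by simp
  also have "\<dots> \<le> (32 * (k * d)) * (32 * (k * d))" by simp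
  also have "\<dots> \<le> q * q" using q(2) by (intro mult_le_mono) auto
  finally have "b \<le> q\<^sup>2" by (simp add: power2_eq_square)
  then have "b ^ d \<le> (q\<^sup>2) ^ d" by (intro power_mono) auto
  then show "n \<le> q ^ (2 * d)" using nb by (simp add: power_mult)
qed

lemma wlim_word_size:
  "wlim (word_size 40 n k) = 2 ^ (40 * floorlog 2 (max n k))"
  by (simp add: wlim_def word_size_def)

text \<open>The most demanding requirement is q^2 < 2^(18 + 4 l), and \<open>2 \<le> l\<close> makes
  this exponent at most 13 l; the constant 40 is generous.\<close>

lemma word_bounds_word_size:
  assumes nk: "2 \<le> n" "1 \<le> k" "k < n"
  shows "word_bounds (word_size 40 n k) n k"
proof -
  define l d q where "l = floorlog 2 n" "d = num_digits n k" "q = field_size n k"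
  note ldq = this
  note P = parameter_bounds[OF nk, folded ldq]
  have le: "(2::nat) ^ m \<le> wlim (word_size 40 n k)" if "m \<le> 40 * l" for m
    using nk that unfolding wlim_word_size ldq by (intro power_increasing) (auto simp: max_def)
  have "1024 * (k * d) < 2 ^ (10 + 2 * l)" using P(2) by (simp add: power_add)
  also have "\<dots> \<le> wlim (word_size 40 n k)" by (rule le) (use P(6) in simp)
  finally have 1: "1024 * (k * d) < wlim (word_size 40 n k)" .
  have "k * l < 2 ^ l * 2 ^ l"
    using nk P(7) less_exp[of l] by (intro mult_strict_mono) auto
  also have "\<dots> = 2 ^ (2 * l)" by (simp add: mult_2 power_add)
  also have "\<dots> \<le> wlim (word_size 40 n k)" by (rule le) simp
  finally have 2: "k * l < wlim (word_size 40 n k)" .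
  have "q * q < 2 ^ (9 + 2 * l) * 2 ^ (9 + 2 * l)" using P(4) by (intro mult_strict_mono) auto
  also have "\<dots> = 2 ^ (18 + 4 * l)" by (simp flip: power_add)
  also have "\<dots> \<le> wlim (word_size 40 n k)" by (rule le) (use P(6) in simp)
  finally have 3: "q * q < wlim (word_size 40 n k)" .
  have "4 * n < 2 ^ (2 + l)" using P(7) by (simp add: power_add)
  also have "\<dots> \<le> wlim (word_size 40 n k)" by (rule le) (use P(6) in simp)
  finally have 4: "4 * n < wlim (word_size 40 n k)" .
  show ?thesis unfolding word_bounds_def using 1 2 3 4 nk by (simp add: ldq)
qed

text \<open>All costs are folded into multiples of k d l, the product that matches the claimed time.
  From \<open>2 \<le> l\<close> one gets 9 + 2 l \<le> 7 l, which removes the additive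
  constants.\<close>

lemma floorlog_bounds_coded:
  fixes n k :: nat
  assumes nk: "2 \<le> n" "1 \<le> k" "k < n"
  defines "l \<equiv> floorlog 2 n" and "d \<equiv> num_digits n k" and "q \<equiv> field_size n k"
  shows "floorlog 2 q \<le> 7 * l" "prepare_time n k \<le> 70000 * (k * d * l)"
    "300 * (q * (2 * d + floorlog 2 q)) + 200 * k + 20 \<le> 1400000 * (k * d * l)"
    "\<And>i. i < n \<Longrightarrow> floorlog q i \<le> 2 * d"
proof -
  note P = parameter_bounds[OF nk, folded l_def d_def q_def]
  note q = field_size[OF nk(1,2), folded d_def q_def]
  have "floorlog 2 q \<le> 9 + 2 * l" by (rule floorlog_leI) (use P(4) in auto)
  then show fq: "floorlog 2 q \<le> 7 * l" using P(6) by linarith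
  have "512 * (k * d) < 2 ^ (9 + 2 * l)" using P(2) by (simp add: power_add)
  then have "floorlog 2 (512 * (k * d)) \<le> 9 + 2 * l" by (rule floorlog_leI) auto
  then have fM: "floorlog 2 (512 * (k * d)) \<le> 7 * l" using P(6) by linarith
  have kd: "1 \<le> k * d" using nk P(5) by simp
  have 1: "k * d \<le> k * d * l" "d \<le> k * d * l" "k \<le> k * d * l" using nk P(5,6) by auto
  have "1 * l \<le> (k * d) * l" using kd by (rule mult_right_mono) simp
  then have 2: "l \<le> k * d * l" by simp
  have "512 * (k * d) * floorlog 2 (512 * (k * d)) \<le> 512 * (k * d) * (7 * l)"
    using fM by (rule mult_left_mono) simp
  also have "\<dots> = 3584 * (k * d * l)" by simp
  finally have 3: "512 * (k * d) * floorlog 2 (512 * (k * d)) \<le> 3584 * (k * d * l)" .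
  show "prepare_time n k \<le> 70000 * (k * d * l)"
    unfolding prepare_time_def l_def[symmetric] d_def[symmetric] using 1 2 3 kd P(6) by linarith
  \<comment> \<open>Here \<open>d \<le> l\<close> absorbs the digit evaluation, giving 2 l + 7 l = 9
    l per measurement. As 300 * 512 * 9 = 1382400, there is room for the pass over the
    slots.\<close>
  have "q * (2 * d + floorlog 2 q) \<le> (512 * (k * d)) * (9 * l)"
    using q(3) fq P(1) by (intro mult_le_mono) auto
  also have "\<dots> = 4608 * (k * d * l)" by simp
  finally show "300 * (q * (2 * d + floorlog 2 q)) + 200 * k + 20 \<le> 1400000 * (k * d * l)"
    using 1 kd by linarith
  show "floorlog q i \<le> 2 * d" if "i < n" for i
    by (rule floorlog_leI) (use that P(3) q(4) in auto)
qed

definition design :: "nat \<Rightarrow> nat \<Rightarrow> real mat" where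
  "design n k = (if k < n then
     let q = field_size n k in
     mat (q * q) n (\<lambda>(i, j). if digit_eval q (i div q) j mod q = i mod q then 1 else 0)
   else 1\<^sub>m n)"

section \<open>Comparison of the parameters with \<open>log_ratio\<close>\<close>

lemma log_le_self:
  assumes "y > (0::real)"
  shows "log 2 y \<le> y"
proof -
  have "ln (1 / 2) \<le> (1 / 2 :: real) - 1" by (rule ln_le_minus_one) simp
  then have l2: "(1 / 2 :: real) \<le> ln 2" by (simp add: ln_div)
  \<comment> \<open>The tangent of the logarithm at 2. The one at 1 has slope 1, too steep once the
    base is changed to 2.\<close>
  have "ln (y / 2) \<le> y / 2 - 1" by (rule ln_le_minus_one) (use assms in simp)
  then have "ln y \<le> y / 2 - 1 + ln 2" using assms by (simp add: ln_div)
  moreover have "ln 2 \<le> (1::real)" using ln_le_minus_one[of "2::real"] by simp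
  moreover have "y / 2 \<le> y * ln 2" using assms l2 mult_left_mono[OF l2, of y] by simp
  ultimately have "ln y \<le> y * ln 2" by linarith
  then show ?thesis using l2 by (simp add: log_def divide_le_eq)
qed

text \<open>By definition of \<open>d\<close>, the power (k l)^(d - 1) is at most n, and l \<ge> log
  n. Taking logarithms bounds d - 1 by \<open>log_ratio\<close>.\<close>

lemma log_ratio_coded:
  fixes n k :: nat
  assumes dom: "log_ratio_dom n k" and k: "k < n"
  shows "real (num_digits n k) \<le> 3 * log_ratio n k"
    and "real (floorlog 2 n) \<le> 2 * log 2 (real n)" and "log_ratio n k > 0"
proof -
  define L where "L = log 2 (real n)"
  define l d where "l = floorlog 2 n" and "d = num_digits n k"
  define E where "E = log 2 L + log 2 (real k)"
  have n: "n > 1" and k1: "k \<ge> 1" and E: "E > 0" using dom by (auto simp: log_ratio_dom_def E_def L_def)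
  have L1: "1 \<le> L" unfolding L_def using n by (simp add: le_log_iff)
  have R: "log_ratio n k = L / E" by (simp add: log_ratio_def L_def E_def)
  then show "log_ratio n k > 0" using E L1 by simp
  have "l = nat \<lfloor>L\<rfloor> + 1" using n by (simp add: l_def floorlog_def L_def)
  then have l: "L \<le> real l" "real l \<le> L + 1" using L1 by (auto simp: of_nat_nat) linarith+
  then show "real (floorlog 2 n) \<le> 2 * log 2 (real n)" using L1 by (simp add: l_def L_def)
  have d1: "1 \<le> d" unfolding d_def by (rule num_digits_pos) (use n k1 in auto)
  have "1 * 2 \<le> k * l" unfolding l_def using n k1 floorlog2_ge_2[of n] by (intro mult_le_mono) auto
  then have "(k * l) ^ (d - 1) \<le> n"
    unfolding d_def num_digits_def l_def using floorlog_bounds[of n "k * floorlog 2 n"] n by (simp add: l_def)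
  then have "real (k * l) ^ (d - 1) \<le> real n" by (metis of_nat_le_iff of_nat_power)
  moreover have "(real k * L) ^ (d - 1) \<le> real (k * l) ^ (d - 1)"
    using l L1 by (intro power_mono) (auto intro: mult_left_mono)
  ultimately have "(real k * L) ^ (d - 1) \<le> real n" by linarith
  then have "log 2 ((real k * L) ^ (d - 1)) \<le> L"
    unfolding L_def[symmetric] using k1 L1 n by (simp add: L_def[symmetric]) (simp add: L_def log_mono)
  then have "real (d - 1) * E \<le> L"
    using k1 L1 by (simp add: log_nat_power log_mult E_def add.commute)
  then have "real (d - 1) \<le> L / E" using E by (simp add: le_divide_eq)
  \<comment> \<open>The remaining digit is paid for by \<open>log_ratio\<close> being at least 1/2;
    this is where \<open>k < n\<close> is used.\<close>
  moreover have "E \<le> 2 * L"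
  proof -
    have "log 2 (real k) \<le> L" unfolding L_def using k k1 by (intro log_mono) auto
    moreover have "log 2 L \<le> L" using L1 by (intro log_le_self) simp
    ultimately show ?thesis by (simp add: E_def)
  qed
  then have "1 \<le> 2 * (L / E)" using E by (simp add: field_simps)
  ultimately show "real (num_digits n k) \<le> 3 * log_ratio n k"
    unfolding R d_def[symmetric] using d1 by (simp add: of_nat_diff)
qed

text \<open>For \<open>n \<le> k\<close> the ratio can be small, but it is at least 1 / (2 log k),
  since log n \<ge> 1 and log log n \<le> log k. Both bounds then only compare log k with k: one
  pays the constant time per candidate, the other the n rows of the identity.\<close>

lemma log_ratio_direct:
  fixes n k :: nat
  assumes dom: "log_ratio_dom n k" and k: "n \<le> k"
  shows "1 \<le> 2 * (real k * log 2 (real n) * log_ratio n k)"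
    and "real n \<le> 16 * (real k)\<^sup>2 * (log_ratio n k)\<^sup>2"
proof -
  define L where "L = log 2 (real n)"
  define E where "E = log 2 L + log 2 (real k)"
  define \<kappa> where "\<kappa> = log 2 (real k)"
  have n: "n > 1" and E: "E > 0" using dom by (auto simp: log_ratio_dom_def E_def L_def)
  have k2: "k \<ge> 2" using n k by simp
  have L1: "1 \<le> L" unfolding L_def using n by (simp add: le_log_iff)
  have R: "log_ratio n k = L / E" by (simp add: log_ratio_def L_def E_def)
  have "L \<le> real n" unfolding L_def by (rule log_le_self) (use n in simp)
  then have "log 2 L \<le> \<kappa>" unfolding \<kappa>_def using L1 k by (intro log_mono) auto
  then have E2: "E \<le> 2 * \<kappa>" by (simp add: E_def \<kappa>_def)
  have \<kappa>k: "\<kappa> \<le> real k" unfolding \<kappa>_def by (rule log_le_self) (use k2 in simp)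
  have "1 / (2 * \<kappa>) \<le> 1 / E" using E E2 by (intro divide_left_mono) auto
  also have "\<dots> \<le> L / E" using L1 E by (intro divide_right_mono) auto
  finally have RR: "1 / (2 * \<kappa>) \<le> log_ratio n k" by (simp add: R)
  have \<kappa>0: "\<kappa> > 0" using E E2 by simp
  have "1 \<le> 2 * (real k * (1 / (2 * \<kappa>)))" using \<kappa>k \<kappa>0 by (simp add: field_simps)
  also have "\<dots> \<le> 2 * (real k * log_ratio n k)" using RR by (intro mult_left_mono) auto
  also have "\<dots> \<le> 2 * (real k * L * log_ratio n k)"
  proof -
    have "0 \<le> real k * log_ratio n k" using R L1 E by simp
    then have "1 * (real k * log_ratio n k) \<le> L * (real k * log_ratio n k)"
      using L1 by (rule mult_right_mono[rotated])
    then show ?thesis by (simp add: mult_ac)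
  qed
  finally show "1 \<le> 2 * (real k * log 2 (real n) * log_ratio n k)" by (simp add: L_def)
  \<comment> \<open>A bound on the square of log k is needed, so \<open>log_le_self\<close> is
    applied to the square root.\<close>
  have "\<kappa> = 2 * log 2 (sqrt (real k))" using k2 by (simp add: \<kappa>_def log_def ln_sqrt)
  then have "\<kappa> \<le> 2 * sqrt (real k)" using log_le_self[of "sqrt (real k)"] k2 by simp
  then have "\<kappa>\<^sup>2 \<le> (2 * sqrt (real k))\<^sup>2" using \<kappa>0 by (intro power_mono) auto
  then have \<kappa>2: "\<kappa>\<^sup>2 \<le> 4 * real k" by (simp add: power_mult_distrib)
  have "real n \<le> real k" using k by simp
  also have "\<dots> \<le> 16 * (real k)\<^sup>2 * (1 / (4 * \<kappa>\<^sup>2))"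
    using \<kappa>2 \<kappa>0 k2 by (simp add: field_simps power2_eq_square)
  also have "\<dots> = 16 * (real k)\<^sup>2 * (1 / (2 * \<kappa>))\<^sup>2" by (simp add: power_divide power_mult_distrib)
  also have "\<dots> \<le> 16 * (real k)\<^sup>2 * (log_ratio n k)\<^sup>2"
    using RR \<kappa>0 by (intro mult_left_mono power_mono) auto
  finally show "real n \<le> 16 * (real k)\<^sup>2 * (log_ratio n k)\<^sup>2" .
qed

text \<open>The exponent 3 comes from k d l with d \<le> l and l \<le> log n + 1 \<le> k + log n;
  running the preparation anew for each entry is affordable.\<close>

lemma strongly_explicit_design: "strongly_explicit 40 design"
  unfolding strongly_explicit_def
proof (rule exI[of _ entry_com], rule exI[of _ 100000], rule exI[of _ 3], intro allI impI conjI)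
  fix n k :: nat assume nk: "1 \<le> n" "1 \<le> k"
  define w where "w = word_size 40 n k"
  have "n < 2 ^ floorlog 2 n" using floorlog_bounds[of n 2] nk by simp
  also have "\<dots> \<le> wlim w" unfolding w_def wlim_word_size
    by (intro power_increasing order_trans[OF floorlog_mono[of n "max n k" 2]]) auto
  finally have nw: "n < wlim w" .
  show "dim_row (design n k) < 2 ^ word_size 40 n k"
  proof (cases "k < n")
    case True
    then have "word_bounds w n k" unfolding w_def using nk by (intro word_bounds_word_size) auto
    then show ?thesis using True by (simp add: design_def Let_def word_bounds_def wlim_def w_def)
  next
    case False
    then show ?thesis using nw by (simp add: design_def wlim_def w_def)
  qed
  fix i j assume i: "i < dim_row (design n k)" and j: "j < dim_col (design n k)"
  have L0: "0 \<le> log 2 (real n)" using nk by simp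
  have base: "1 \<le> real k + log 2 (real n)" using nk L0 by linarith
  have "runs w entry_com (entry_input n k i j) (\<lambda>t s'. rreg s' 0 = design n k $$ (i, j) \<and>
    real t \<le> 100000 * (real k + log 2 (real n)) ^ 3)"
  proof (cases "k < n")
    case True
    have n2: "2 \<le> n" using True nk by simp
    define q l d where "q = field_size n k" "l = floorlog 2 n" "d = num_digits n k"
    note qld = this
    have wb: "word_bounds w n k" unfolding w_def using True nk by (intro word_bounds_word_size) auto
    have iq: "i < q * q" and jn: "j < n" using i j True by (auto simp: design_def Let_def qld)
    note B = floorlog_bounds_coded[OF n2 nk(2) True, folded qld]
    note P = parameter_bounds[OF n2 nk(2) True, folded qld]
    show ?thesis
    proof (rule runs_mono[OF runs_entry_coded[OF n2 nk(2) True wb iq[unfolded qld]]], goal_cases)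
      case (1 t s')
      have "d \<le> k * d * l" "1 \<le> k * d * l" using nk P(5,6) by (auto simp: Suc_le_eq)
      then have "t \<le> 70000 * (k * d * l) + 60 * (k * d * l) + 100 * (k * d * l)"
        using 1 B(2) B(4)[OF jn] unfolding qld by linarith
      then have "t \<le> 100000 * (k * d * l)" by linarith
      also have "k * d * l = k * (d * l)" by simp
      also have "100000 * (k * (d * l)) \<le> 100000 * (k * (l * l))" using P(1) by (intro mult_left_mono mult_right_mono) auto
      finally have "real t \<le> real (100000 * (k * (l * l)))" by (simp only: of_nat_le_iff)
      also have "\<dots> = 100000 * (real k * (real l * real l))" by simp
      also have "\<dots> \<le> 100000 * ((real k + log 2 (real n)) * ((real k + log 2 (real n)) * (real k + log 2 (real n))))"
      proof -
        have "real l \<le> log 2 (real n) + 1"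
          using n2 L0 by (simp add: qld floorlog_def of_nat_nat)
        then have "real l \<le> real k + log 2 (real n)" using nk by linarith
        then show ?thesis using L0 by (intro mult_left_mono mult_mono) auto
      qed
      finally have "real t \<le> 100000 * (real k + log 2 (real n)) ^ 3" by (simp add: power3_eq_cube)
      moreover have "rreg s' 0 = design n k $$ (i, j)"
        using 1 True iq jn by (simp add: design_def Let_def qld)
      ultimately show ?case by simp
    qed
  next
    case False
    then have ij: "i < n" "j < n" using i j by (auto simp: design_def)
    have "1 < wlim w" using nw nk by linarith
    note D = runs_entry_direct[OF _ this, of n k i j]
    show ?thesis
    proof (rule runs_mono[OF D], goal_cases)
      case (2 t s')
      have "1 \<le> (real k + log 2 (real n)) ^ 3" using base by (rule one_le_power)
      moreover have "real t \<le> 30" using 2 by simp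
      ultimately have "real t \<le> 100000 * (real k + log 2 (real n)) ^ 3" by linarith
      then show ?case using 2 False ij by (simp add: design_def)
    qed (use False in simp)
  qed
  then show "\<exists>t s'. exec (word_size 40 n k) entry_com (entry_input n k i j) t s' \<and>
    rreg s' 0 = design n k $$ (i, j) \<and> real t \<le> 100000 * (real k + log 2 (real n)) ^ 3"
    by (simp add: runs_def w_def)
qed

lemma output_of_selected:
  assumes nk: "1 \<le> n" "1 \<le> k" and x: "x \<in> carrier_vec n" and xs: "set xs \<subseteq> {..<n}"
    and heavy: "heavy x k 1 \<subseteq> set xs"
    and S: "selected (3 * k) (\<lambda>i z. \<bar>z - x $ i\<bar> \<le> l1_norm (tail_vec x k) / (4 * real k)) (set xs)
      (wmem s 1) (rmem s 1) (wreg s 0)"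
  shows "\<exists>y. y \<in> carrier_vec n \<and> outputs_vec s y \<and> sparse (3 * k) y \<and>
    linf_norm (x - y) \<le> 1 / real k * l1_norm (tail_vec x k)"
proof -
  define f v c where "f = wmem s 1" "v = rmem s 1" "c = wreg s 0"
  note fvc = this
  define Rep where "Rep = f ` {..<c}"
  note S = selectedD[OF S, folded fvc]
  define y where "y = vec n (\<lambda>i. if i \<in> Rep then v (the_inv_into {..<c} f i) else 0)"
  have Rn: "Rep \<subseteq> {..<n}" using S(3) xs by (auto simp: Rep_def)
  have yf: "y $ f p = v p" if "p < c" for p
  proof -
    have "f p \<in> Rep" using that by (simp add: Rep_def)
    then show ?thesis using Rn that S(2) by (auto simp: y_def the_inv_into_f_f)
  qed
  have y0: "y $ i = 0" if "i < n" "i \<notin> Rep" for i using that by (simp add: y_def)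
  have yc: "y \<in> carrier_vec n" by (simp add: y_def)
  have "outputs_vec s y"
    unfolding outputs_vec_def fvc[symmetric] Rep_def[symmetric]
    using S(2) Rn yf y0 yc by auto
  moreover have "sparse (3 * k) y"
  proof -
    have "card {i. i < dim_vec y \<and> y $ i \<noteq> 0} \<le> card Rep"
      using y0 yc by (intro card_mono) (auto simp: Rep_def)
    also have "\<dots> \<le> c" unfolding Rep_def using card_image_le[of "{..<c}" f] by simp
    also have "\<dots> \<le> 3 * k" by (rule S(1))
    finally show ?thesis by (simp add: sparse_def)
  qed
  moreover have "linf_norm (x - y) \<le> 1 / real k * l1_norm (tail_vec x k)"
  proof (rule recovery_guarantee[of k x n y "set xs" Rep])
    show "Rep \<subseteq> set xs" using S(3) by (simp add: Rep_def)
    fix i assume i: "i \<in> Rep"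
    then obtain p where "p < c" "i = f p" by (auto simp: Rep_def)
    then show "\<bar>y $ i - x $ i\<bar> \<le> l1_norm (tail_vec x k) / (4 * real k)" using S(4) yf by simp
  next
    fix i assume i: "i \<in> set xs - Rep"
    have "card Rep = c" unfolding Rep_def using S(2) by (simp add: card_image)
    then have "card Rep = 3 * k" using S(5)[of i] i by (simp add: Rep_def)
    moreover obtain e where e: "\<bar>e - x $ i\<bar> \<le> l1_norm (tail_vec x k) / (4 * real k)"
      "\<forall>p<c. \<bar>e\<bar> \<le> \<bar>v p\<bar>" using S(6)[of i] i by (auto simp: Rep_def)
    moreover have "\<forall>j\<in>Rep. \<bar>e\<bar> \<le> \<bar>y $ j\<bar>" using e(2) yf by (auto simp: Rep_def)
    ultimately show "card Rep = 3 * k \<and> (\<exists>e. \<bar>e - x $ i\<bar> \<le> l1_norm (tail_vec x k) / (4 * real k) \<and>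
      (\<forall>j\<in>Rep. \<bar>e\<bar> \<le> \<bar>y $ j\<bar>))" by blast
  qed (use nk x yc heavy xs y0 in auto)
  ultimately show ?thesis using yc by blast
qed

lemma measurement:
  assumes k: "k < n" and x: "x \<in> carrier_vec n" and q: "q = field_size n k" "1 < q" and a: "a < q"
  shows "(design n k *\<^sub>v x) $ (a * q + digit_eval q a i mod q) =
    (\<Sum>j<n. if digit_eval q a j mod q = digit_eval q a i mod q then x $ j else 0)"
    and "a * q + digit_eval q a i mod q < dim_vec (design n k *\<^sub>v x)"
proof -
  define h where "h = digit_eval q a i mod q"
  have h: "h < q" using q by (simp add: h_def)
  have "a * q + h < Suc a * q" using h by simp
  also have "\<dots> \<le> q * q" using a by (intro mult_right_mono) auto
  finally have lt: "a * q + h < q * q" .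
  have D: "design n k = mat (q * q) n (\<lambda>(i, j). if digit_eval q (i div q) j mod q = i mod q then 1 else 0)"
    using k q by (simp add: design_def Let_def)
  show "a * q + digit_eval q a i mod q < dim_vec (design n k *\<^sub>v x)"
    using lt by (simp add: D h_def)
  have "(design n k *\<^sub>v x) $ (a * q + h) = (\<Sum>j<n. (if digit_eval q a j mod q = h then 1 else 0) * x $ j)"
    using lt x h q by (simp add: D scalar_prod_def atLeast0LessThan)
  also have "\<dots> = (\<Sum>j<n. if digit_eval q a j mod q = h then x $ j else 0)"
    by (rule sum.cong) auto
  finally show "(design n k *\<^sub>v x) $ (a * q + digit_eval q a i mod q) =
    (\<Sum>j<n. if digit_eval q a j mod q = digit_eval q a i mod q then x $ j else 0)" by (simp add: h_def)
qed

lemma median_estimate_error: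
  assumes nk: "2 \<le> n" "1 \<le> k" "k < n" and x: "x \<in> carrier_vec n" and i: "i < n" and q: "q = field_size n k"
    and M: "is_median q (\<lambda>a. (design n k *\<^sub>v x) $ (a * q + digit_eval q a i mod q)) z"
  shows "\<bar>z - x $ i\<bar> \<le> l1_norm (tail_vec x k) / (4 * real k)"
proof -
  define d where "d = num_digits n k"
  define h where "h a j = digit_eval q a j mod q" for a j
  define T where "T = l1_norm (tail_vec x k) / (4 * real k)"
  note qq = field_size[OF nk(1,2), folded q d_def]
  note P = parameter_bounds[OF nk, folded q d_def]
  have "is_median q (\<lambda>a. \<Sum>j<n. if h a j = h a i then x $ j else 0) z"
    by (rule is_median_cong[OF _ M]) (simp add: measurement[OF nk(3) x q qq(4)] h_def)
  then show ?thesis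
    unfolding T_def[symmetric]
  proof (rule median_between)
    have "card {a. a < q \<and> \<not> \<bar>(\<Sum>j<n. if h a j = h a i then x $ j else 0) - x $ i\<bar> \<le> T} \<le> 5 * k * (2 * d)"
      unfolding T_def
    proof (rule few_spoiled_measurements[OF _ x i])
      fix j assume "j < n" "j \<noteq> i"
      then show "card {a. a < q \<and> h a j = h a i} \<le> 2 * d"
        unfolding h_def using P(3) i by (intro code_agreements[OF qq(1)]) auto
    qed (use nk in simp)
    moreover have "1 \<le> k * d" using nk P(5) by simp
    \<comment> \<open>Twice this number is 20 k d, below the 32 k d guaranteed for
      \<open>q\<close>.\<close>
    moreover have "5 * k * (2 * d) = 10 * (k * d)" by simp
    ultimately show "2 * card {a. a < q \<and> \<not> \<bar>(\<Sum>j<n. if h a j = h a i then x $ j else 0) - x $ i\<bar> \<le> T} < q"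
      using qq(2) by linarith
  qed
qed

lemma runs_recover:
  fixes x :: "real vec" and n k :: nat
  assumes nk: "1 \<le> n" "1 \<le> k" and x: "x \<in> carrier_vec n"
    and xs: "distinct xs" "set xs \<subseteq> {..<n}"
  shows "runs (word_size 40 n k) recover_com (recover_input n k (design n k *\<^sub>v x) xs) (\<lambda>t s'.
    (if k < n then t \<le> 20 + length xs * (2000000 * (k * num_digits n k * floorlog 2 n)) else t \<le> 30 * length xs + 30) \<and>
    selected (3 * k) (\<lambda>i z. \<bar>z - x $ i\<bar> \<le> l1_norm (tail_vec x k) / (4 * real k)) (set xs)
      (wmem s' 1) (rmem s' 1) (wreg s' 0))"
proof -
  define w where "w = word_size 40 n k"
  define s where "s = recover_input n k (design n k *\<^sub>v x) xs"
  define G where "G = (\<lambda>i z. \<bar>z - x $ i\<bar> \<le> l1_norm (tail_vec x k) / (4 * real k))"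
  have "card (set xs) \<le> card {..<n}" using xs by (intro card_mono) auto
  then have len: "length xs \<le> n" using xs by (simp add: distinct_card)
  have r: "wreg s 0 = n" "wreg s 1 = k" "wreg s 3 = length xs" "\<And>y. wmem s 2 y = 0"
    "\<And>p. p < length xs \<Longrightarrow> wmem s 0 p = xs ! p"
    "\<And>p. p < dim_vec (design n k *\<^sub>v x) \<Longrightarrow> rmem s 0 p = (design n k *\<^sub>v x) $ p"
    by (auto simp: s_def recover_input_def blank_def)
  have "n < 2 ^ floorlog 2 n" using floorlog_bounds[of n 2] nk by simp
  also have "\<dots> \<le> wlim w" unfolding w_def wlim_word_size
    by (intro power_increasing order_trans[OF floorlog_mono[of n "max n k" 2]]) auto
  finally have nw: "n < wlim w" .
  then have w1: "1 < wlim w" using nk by linarith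
  have "runs w recover_com s (\<lambda>t s'.
    (if k < n then t \<le> 20 + length xs * (2000000 * (k * num_digits n k * floorlog 2 n)) else t \<le> 30 * length xs + 30) \<and>
    selected (3 * k) G (set xs) (wmem s' 1) (rmem s' 1) (wreg s' 0))"
  proof (cases "k < n")
    case True
    have n2: "2 \<le> n" using True nk by simp
    show ?thesis
    proof (cases "xs = []")
      case Nil: True
      have "selected (3 * k) G {} (wmem s 1) (rmem s 1) 0" by (rule selectedI) auto
      then show ?thesis using r True Nil w1 by (simp add: recover_com_def)
    next
      case False
      define q l d where "q = field_size n k" "l = floorlog 2 n" "d = num_digits n k"
      note qld = this
      have wb: "word_bounds w n k" unfolding w_def using True nk by (intro word_bounds_word_size) auto
      note B = floorlog_bounds_coded[OF n2 nk(2) True, folded qld]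
      note P = parameter_bounds[OF n2 nk(2) True, folded qld]
      have q1: "1 < q" using field_size[OF n2 nk(2)] by (simp add: qld)
      have R: "runs w recover_coded s (\<lambda>t s'.
        t \<le> prepare_time n k + length xs * (300 * (q * (2 * d + floorlog 2 q)) + 200 * k + 20) + 20 \<and>
        selected (3 * k) G (set xs) (wmem s' 1) (rmem s' 1) (wreg s' 0))"
        unfolding qld(1)
      proof (rule runs_recover_coded[OF r(1-3) n2 nk(2) wb r(4,5) xs(1) len])
        fix i assume "i \<in> set xs"
        then have i: "i < n" using xs by auto
        show "floorlog (field_size n k) i \<le> 2 * d" using B(4)[OF i] by (simp add: qld)
        fix z assume M: "is_median (field_size n k) (\<lambda>a. rmem s 0 (a * field_size n k +
          digit_eval (field_size n k) a i mod field_size n k)) z"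
        have "\<forall>a<q. rmem s 0 (a * q + digit_eval q a i mod q) =
            (design n k *\<^sub>v x) $ (a * q + digit_eval q a i mod q)"
          using r(6) measurement(2)[OF True x qld(1) q1] by blast
        then have "is_median q (\<lambda>a. (design n k *\<^sub>v x) $ (a * q + digit_eval q a i mod q)) z"
          using M unfolding qld(1)[symmetric] by (rule is_median_cong)
        then show "G i z" unfolding G_def by (rule median_estimate_error[OF n2 nk(2) True x i qld(1)])
      qed
      have time: "prepare_time n k + length xs * (300 * (q * (2 * d + floorlog 2 q)) + 200 * k + 20) + 20 + 10
          \<le> 20 + length xs * (2000000 * (k * d * l))"
      proof -
        define X where "X = k * d * l"
        have X: "1 \<le> X" using nk P(5,6) by (auto simp: X_def Suc_le_eq)
        \<comment> \<open>Nonemptiness charges the preparation to one candidate. The surplus 10 in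
          the claim covers the two tests of \<open>recover_com\<close>.\<close>
        have len1: "1 \<le> length xs" using False by (cases xs) auto
        have "length xs * (300 * (q * (2 * d + floorlog 2 q)) + 200 * k + 20) \<le> length xs * (1400000 * X)"
          using B(3) unfolding X_def by (rule mult_left_mono) simp
        moreover have "1 * X \<le> length xs * X" using len1 by (rule mult_right_mono) simp
        moreover have "length xs * (1400000 * X) = 1400000 * (length xs * X)"
          "length xs * (2000000 * X) = 2000000 * (length xs * X)" by simp_all
        ultimately show ?thesis using B(2) X unfolding X_def[symmetric] by linarith
      qed
      have len_pos: "0 < length xs" using False by simp
      have b1: "bval w (WLess (WReg 1) (WReg 0)) s" using r True by simp
      have b2: "bval w (WLess (WConst 0) (WReg 3)) s" using r len_pos w1 by simp
      show ?thesis
        unfolding recover_com_def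
      proof (rule runs_CondT[OF b1], rule runs_CondT[OF b2], rule runs_mono[OF R], goal_cases)
        case (1 t s')
        have "t + 10 \<le> 20 + length xs * (2000000 * (k * d * l))" using 1 time by linarith
        then show ?case using 1 True by (simp add: qld)
      qed
    qed
  next
    case False
    have v: "design n k *\<^sub>v x = x" using False x by (simp add: design_def)
    have lw: "length xs < wlim w" using len nw by linarith
    note R = runs_recover_direct[OF r(3) lw w1]
    have "runs w recover_com s Q = runs w recover_direct s (\<lambda>t. Q (1 + bcost (WLess (WReg 1) (WReg 0)) + t))" for Q
      using r False by (simp add: recover_com_def)
    then show ?thesis
    proof (simp only:, intro runs_mono[OF R], goal_cases)
      case (1 t s')
      have f: "wmem s' 1 p = xs ! p" "rmem s' 1 p = x $ (xs ! p)" if "p < length xs" for p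
      proof -
        have "xs ! p < n" using that xs(2) by (meson lessThan_iff nth_mem subsetD)
        then show "wmem s' 1 p = xs ! p" "rmem s' 1 p = x $ (xs ! p)"
          using 1 that r(5,6) v x by auto
      qed
      have img: "wmem s' 1 ` {..<length xs} = set xs"
        using f(1) by (auto simp: in_set_conv_nth image_iff)
      have "selected (3 * k) G (set xs) (wmem s' 1) (rmem s' 1) (length xs)"
      proof (rule selectedI)
        show "length xs \<le> 3 * k" using len False by simp
        show "inj_on (wmem s' 1) {..<length xs}"
          using xs(1) f(1) by (auto simp: inj_on_def nth_eq_iff_index_eq)
        \<comment> \<open>The estimates are exact here, so the error bound reduces to nonnegativity
          of the tail norm.\<close>
        show "G (wmem s' 1 p) (rmem s' 1 p)" if "p < length xs" for p
          using f[OF that] by (simp add: G_def l1_norm_nonneg)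
      qed (use img in auto)
      then show ?case using 1 False by simp
    qed
  qed
  then show ?thesis by (simp add: w_def s_def G_def)
qed

theorem theorem5:
  shows "\<exists>(\<Phi> :: nat \<Rightarrow> nat \<Rightarrow> real mat) (c :: nat) (recover :: com) (C :: real) (D :: nat).
    c > 0 \<and>
    strongly_explicit c \<Phi> \<and>
    (\<forall>n\<ge>1. \<forall>k\<ge>1.
       dim_col (\<Phi> n k) = n \<and>
       (log_ratio_dom n k \<longrightarrow> real (dim_row (\<Phi> n k)) \<le> C * (real k)\<^sup>2 * (log_ratio n k)\<^sup>2) \<and>
       (\<forall>x xs. x \<in> carrier_vec n \<longrightarrow> distinct xs \<longrightarrow> set xs \<subseteq> {..<n} \<longrightarrow>
          heavy x k 1 \<subseteq> set xs \<longrightarrow>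
          (\<exists>t s' y.
             exec (word_size c n k) recover (recover_input n k (\<Phi> n k *\<^sub>v x) xs) t s' \<and>
             y \<in> carrier_vec n \<and> outputs_vec s' y \<and>
             sparse (D * k) y \<and>
             linf_norm (x - y) \<le> 1 / real k * l1_norm (tail_vec x k) \<and>
             (log_ratio_dom n k \<longrightarrow>
                real t \<le> C * (1 + real (card (set xs)) * real k * log 2 (real n) * log_ratio n k)))))"
proof (rule exI[of _ design], rule exI[of _ 40], rule exI[of _ recover_com], rule exI[of _ 12000000],
    rule exI[of _ 3], intro conjI allI impI)
  show "strongly_explicit 40 design" by (rule strongly_explicit_design)
next
  fix n k :: nat assume "1 \<le> n" "1 \<le> k"
  show "dim_col (design n k) = n" by (simp add: design_def Let_def)
next
  fix n k :: nat assume nk: "1 \<le> n" "1 \<le> k" and dom: "log_ratio_dom n k"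
  show "real (dim_row (design n k)) \<le> 12000000 * (real k)\<^sup>2 * (log_ratio n k)\<^sup>2"
  proof (cases "k < n")
    case True
    define q d where "q = field_size n k" "d = num_digits n k"
    note qd = this
    have n2: "2 \<le> n" using True nk by simp
    have "q \<le> 512 * (k * d)" using field_size(3)[OF n2 nk(2)] by (simp add: qd)
    then have "real q \<le> real (512 * (k * d))" by (simp only: of_nat_le_iff)
    also have "\<dots> = 512 * (real k * real d)" by simp
    also have "\<dots> \<le> 512 * (real k * (3 * log_ratio n k))"
      using log_ratio_coded(1)[OF dom True] by (intro mult_left_mono) (auto simp: qd)
    finally have "(real q)\<^sup>2 \<le> (512 * (real k * (3 * log_ratio n k)))\<^sup>2" by (intro power_mono) auto
    \<comment> \<open>2359296 = (512 * 3)^2; the larger constant of the theorem comes from the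
      running time.\<close>
    also have "\<dots> = 2359296 * ((real k)\<^sup>2 * (log_ratio n k)\<^sup>2)" by (simp add: power_mult_distrib)
    also have "\<dots> \<le> 12000000 * ((real k)\<^sup>2 * (log_ratio n k)\<^sup>2)" by (intro mult_right_mono) auto
    finally show ?thesis using True by (simp add: design_def Let_def qd power2_eq_square mult.assoc)
  next
    case False
    then have "real n \<le> 16 * (real k)\<^sup>2 * (log_ratio n k)\<^sup>2" by (intro log_ratio_direct dom) simp
    also have "\<dots> \<le> 12000000 * (real k)\<^sup>2 * (log_ratio n k)\<^sup>2" by (intro mult_right_mono) auto
    finally show ?thesis using False by (simp add: design_def)
  qed
next
  fix n k :: nat and x :: "real vec" and xs :: "nat list"
  assume nk: "1 \<le> n" "1 \<le> k" and x: "x \<in> carrier_vec n" and xs: "distinct xs" "set xs \<subseteq> {..<n}"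
    and heavy: "heavy x k 1 \<subseteq> set xs"
  define K where "K = real k * log 2 (real n) * log_ratio n k"
  from runs_recover[OF nk x xs] obtain t s' where
    ex: "exec (word_size 40 n k) recover_com (recover_input n k (design n k *\<^sub>v x) xs) t s'"
    and t: "if k < n then t \<le> 20 + length xs * (2000000 * (k * num_digits n k * floorlog 2 n))
      else t \<le> 30 * length xs + 30"
    and S: "selected (3 * k) (\<lambda>i z. \<bar>z - x $ i\<bar> \<le> l1_norm (tail_vec x k) / (4 * real k)) (set xs)
      (wmem s' 1) (rmem s' 1) (wreg s' 0)"
    unfolding runs_def by blast
  obtain y where y: "y \<in> carrier_vec n" "outputs_vec s' y" "sparse (3 * k) y"
    "linf_norm (x - y) \<le> 1 / real k * l1_norm (tail_vec x k)"
    using output_of_selected[OF nk x xs(2) heavy S] by blast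
  have time: "real t \<le> 12000000 * (1 + real (length xs) * K)" if dom: "log_ratio_dom n k"
  proof (cases "k < n")
    case True
    define l d where "l = floorlog 2 n" "d = num_digits n k"
    note ld = this
    note LR = log_ratio_coded[OF dom True, folded ld]
    have "real t \<le> real (20 + length xs * (2000000 * (k * d * l)))"
      using t True by (simp only: of_nat_le_iff ld if_True)
    also have "\<dots> = 20 + 2000000 * (real (length xs) * (real k * real d * real l))" by simp
    \<comment> \<open>The factors 3 and 2 of \<open>log_ratio_coded\<close> give 2000000 * 3 * 2 =
      12000000, the constant chosen as witness.\<close>
    also have "\<dots> \<le> 20 + 2000000 * (real (length xs) * (real k * (3 * log_ratio n k) * (2 * log 2 (real n))))"
      using LR by (intro add_left_mono mult_left_mono mult_mono) auto
    also have "\<dots> = 20 + 12000000 * (real (length xs) * K)" by (simp add: K_def)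
    also have "\<dots> \<le> 12000000 * (1 + real (length xs) * K)" by simp
    finally show ?thesis .
  next
    case False
    then have "1 \<le> 2 * K" unfolding K_def by (intro log_ratio_direct dom) simp
    then have "real (length xs) * 1 \<le> real (length xs) * (2 * K)" by (intro mult_left_mono) auto
    moreover have "real t \<le> 30 * real (length xs) + 30" using t False by simp
    ultimately have "real t \<le> 60 * (real (length xs) * K) + 30" by linarith
    also have "\<dots> \<le> 12000000 * (real (length xs) * K) + 12000000"
      using \<open>1 \<le> 2 * K\<close> by (intro add_mono mult_right_mono) auto
    finally show ?thesis by simp
  qed
  have "card (set xs) = length xs" using xs(1) by (rule distinct_card)
  then show "\<exists>t s' y.
      exec (word_size 40 n k) recover_com (recover_input n k (design n k *\<^sub>v x) xs) t s' \<and>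
      y \<in> carrier_vec n \<and> outputs_vec s' y \<and> sparse (3 * k) y \<and>
      linf_norm (x - y) \<le> 1 / real k * l1_norm (tail_vec x k) \<and>
      (log_ratio_dom n k \<longrightarrow>
        real t \<le> 12000000 * (1 + real (card (set xs)) * real k * log 2 (real n) * log_ratio n k))"
    using ex y time by (intro exI[of _ t] exI[of _ s'] exI[of _ y]) (simp add: K_def mult.assoc)
qed simp

end
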